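(* Let $\mathcal{T}$ be a simply connected T-mesh and $(m,m')\in\mathbb{Z}_{\ge 0}^2$. Let $\mathbf{r}$ be an $(m+1,m'+1)$ smoothness distribution on $\mathcal{T}$, and let $\mathbf{s}$ be any smoothness distribution on $\mathcal{T}$ such that $\mathbf{s}(\tau)\le\mathbf{r}(\tau)$ for all edges $\tau$ of $\mathcal{T}$. If $H_0(\mathcal{I}^{\mathbf{r}})=0$, then $H_0(\mathcal{I}^{\mathbf{s}})=0$ and $\dim\mathcal{R}^{\mathbf{s}}=\chi(\mathcal{Q}^{\mathbf{s}})$.
   Context: **T-mesh.** A T-mesh $\mathcal{T}$ of $\mathbb{R}^2$ consists of a finite collection $\mathcal{T}_2$ of axis-aligned open rectangles $\sigma$ of non-zero measure (faces), a finite set $\mathcal{T}_1$ of closed axis-aligned segments $\tau$ (edges), which are edges of the closures of the faces, and the set $\mathcal{T}_0$ of vertices $\gamma$ (endpoints) of the edges, such that: the boundary $\partial\sigma$ of each face is a finite union of edges in $\mathcal{T}_1$; for distinct faces $\sigma,\sigma'$, $\overline{\sigma}\cap\overline{\sigma'}=\partial\sigma\cap\partial\sigma'$ is a finite (possibly empty) union of edges in $\mathcal{T}_1$ and vertices in $\mathcal{T}_0$; for distinct edges $\tau,\tau'$, $\tau\cap\tau'$ is empty or a single vertex in $\mathcal{T}_0$. Every vertex is contained in at least one horizontal and at least one vertical edge. The domain is $\Omega=\bigcup_{\sigma\in\mathcal{T}_2}\overline{\sigma}$. $\mathcal{T}$ is called simply connected if $\Omega$ is simply connected and its interior $\mathring\Omega$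 is connected. An edge is interior if it intersects $\mathring\Omega$, otherwise it is a boundary edge; a vertex is interior if it lies in $\mathring\Omega$. $\mathring{\mathcal{T}}_1$ and $\mathring{\mathcal{T}}_0$ denote the sets of interior edges and interior vertices; ${}^h\mathcal{T}_1$ and ${}^v\mathcal{T}_1$ denote the sets of horizontal and vertical edges. **Splines.** With $(s,t)$ the (horizontal, vertical) coordinates, $\mathcal{P}_{mm'}$ is the real vector space spanned by $s^it^j$, $0\le i\le m$, $0\le j\le m'$. A smoothness distribution is a map $\mathbf{r}:\mathcal{T}_1\to\mathbb{Z}_{\ge -1}$ with $\mathbf{r}(\tau)=-1$ for all $\tau\notin\mathring{\mathcal{T}}_1$. It is an $(m+1,m'+1)$ smoothness distribution if $\mathbf{r}(\tau)\le (m'-1)/2$ for all $\tau\in{}^h\mathcal{T}_1$ and $\mathbf{r}(\tau)\le(m-1)/2$ for all $\tau\in{}^v\mathcal{T}_1$. The spline space $\mathcal{R}^{\mathbf{r}}=\mathcal{R}^{\mathbf{r}}_{mm'}(\mathcal{T})$ consists of the piecewise polynomial functions $f$ with $f|_\sigma\in\mathcal{P}_{mm'}$ for every face $\sigma$ that are $C^{\mathbf{r}(\tau)}$ smooth across every interior edge $\tau$; equivalently, for $\tau\in\mathring{\mathcal{T}}_1$ shared by faces $\sigma,\sigma'$, $\ell_\tau^{\mathbf{r}(\tau)+1}$ divides $f|_\sigma-f|_{\sigma'}$, where $\ell_\tau$ is a non-zero linear polynomial vanishing on $\tau$ (no condition if $\mathbf{r}(\tau)=-1$). **Complexes.** For an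 interior edge $\tau$, $\mathfrak{I}^{\mathbf{r}}_\tau\subseteq\mathcal{P}_{mm'}$ is the subspace of all elements of $\mathcal{P}_{mm'}$ that are polynomial multiples of $\ell_\tau^{\mathbf{r}(\tau)+1}$ (equal to $\mathcal{P}_{mm'}$ if $\mathbf{r}(\tau)=-1$); for an interior vertex $\gamma$, $\mathfrak{I}^{\mathbf{r}}_\gamma=\sum_{\tau\ni\gamma}\mathfrak{I}^{\mathbf{r}}_\tau$. Fix orientations of the cells and let $\partial$ be the usual cellular boundary map with all boundary edges and boundary vertices set to zero (i.e. relative to the boundary of $\Omega$). Then $\mathcal{I}^{\mathbf{r}}$ is the chain complex $0\to\bigoplus_{\tau\in\mathring{\mathcal{T}}_1}[\tau]\mathfrak{I}^{\mathbf{r}}_\tau\xrightarrow{\partial}\bigoplus_{\gamma\in\mathring{\mathcal{T}}_0}[\gamma]\mathfrak{I}^{\mathbf{r}}_\gamma\to 0$ (terms in degrees $2,1,0$, the degree-2 term being $0$), so $H_0(\mathcal{I}^{\mathbf{r}})$ is the cokernel of this map $\partial$. $\mathcal{Q}^{\mathbf{r}}$ is the complex $\bigoplus_{\sigma\in\mathcal{T}_2}[\sigma]\mathcal{P}_{mm'}\to\bigoplus_{\tau\in\mathring{\mathcal{T}}_1}[\tau]\mathcal{P}_{mm'}/\mathfrak{I}^{\mathbf{r}}_\tau\to\bigoplus_{\gamma\in\mathring{\mathcal{T}}_0}[\gamma]\mathcal{P}_{mm'}/\mathfrak{I}^{\mathbf{r}}_\gamma\to0$ (terms in degrees $2,1,0$,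 maps induced by $\partial$), and $\chi(\mathcal{Q}^{\mathbf{r}})=\dim\mathcal{Q}^{\mathbf{r}}_2-\dim\mathcal{Q}^{\mathbf{r}}_1+\dim\mathcal{Q}^{\mathbf{r}}_0$ is its Euler characteristic. The same definitions apply to any smoothness distribution in place of $\mathbf{r}$. *)

theory Defs
  imports
    "HOL-Analysis.Analysis"
    "HOL-Computational_Algebra.Polynomial"
    "HOL-Library.Function_Algebras"
begin

section \<open>Vector spaces of functions and of polynomials\<close>

instantiation "fun" :: (type, real_vector) real_vector
begin

definition scaleR_fun_def: "c *\<^sub>R f = (\<lambda>x. c *\<^sub>R f x)"

instance
  by standard (auto simp: scaleR_fun_def fun_eq_iff scaleR_add_right scaleR_add_left)

end

instantiation poly :: (real_vector) real_vector
begin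

definition scaleR_poly_def: "c *\<^sub>R p = map_poly (\<lambda>a. c *\<^sub>R a) p"

instance
  by standard
    (auto simp: scaleR_poly_def poly_eq_iff coeff_map_poly scaleR_add_right scaleR_add_left)

end

text \<open>The direct sum of the subspaces \<open>G a\<close>, for \<open>a\<close> in a finite set \<open>A\<close>.\<close>

definition direct_sum :: "'a set \<Rightarrow> ('a \<Rightarrow> 'b::real_vector set) \<Rightarrow> ('a \<Rightarrow> 'b) set" where
  "direct_sum A G = {f. (\<forall>a\<in>A. f a \<in> G a) \<and> (\<forall>a. a \<notin> A \<longrightarrow> f a = 0)}"

text \<open>For a subspace \<open>W\<close> of \<open>V\<close>, the quotient \<open>V/W\<close> is the set of cosets; its zero element is
  \<open>W\<close>. Its dimension is the number of elements of a finite basis, where a basis is given by a set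
  of representatives: the class of a vector vanishes iff the vector lies in \<open>W\<close>. As for
  \<open>dim\<close>, the value is 0 by convention if there is no finite basis.\<close>

definition quotient_space :: "'a::real_vector set \<Rightarrow> 'a set \<Rightarrow> 'a set set" where
  "quotient_space V W = (\<lambda>v. (\<lambda>w. v + w) ` W) ` V"

definition quotient_basis :: "'a::real_vector set \<Rightarrow> 'a set \<Rightarrow> 'a set \<Rightarrow> bool" where
  "quotient_basis V W B \<longleftrightarrow> finite B \<and> B \<subseteq> V \<and>
     (\<forall>u. (\<Sum>b\<in>B. u b *\<^sub>R b) \<in> W \<longrightarrow> (\<forall>b\<in>B. u b = 0)) \<and>
     (\<forall>v\<in>V. \<exists>u. v - (\<Sum>b\<in>B. u b *\<^sub>R b) \<in> W)"

definition quotient_dim :: "'a::real_vector set \<Rightarrow> 'a set \<Rightarrow> nat" where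
  "quotient_dim V W =
     (if \<exists>B. quotient_basis V W B then card (SOME B. quotient_basis V W B) else 0)"

lemma quotient_basis_card:
  assumes V: "subspace V" and W: "subspace W" and WV: "W \<subseteq> V"
    and C: "independent C" "span C = W" "finite C"
    and B: "quotient_basis V W B"
  shows "card B + card C = dim V"
proof -
  have fB: "finite B" and BV: "B \<subseteq> V"
    and ind: "\<And>u. (\<Sum>b\<in>B. u b *\<^sub>R b) \<in> W \<Longrightarrow> \<forall>b\<in>B. u b = 0"
    and gen: "\<And>v. v \<in> V \<Longrightarrow> \<exists>u. v - (\<Sum>b\<in>B. u b *\<^sub>R b) \<in> W"
    using B unfolding quotient_basis_def by blast+
  have CW: "C \<subseteq> W" using C(2) span_superset by blast
  have disj: "B \<inter> C = {}"
  proof (rule ccontr)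
    assume "B \<inter> C \<noteq> {}"
    then obtain x where x: "x \<in> B" "x \<in> C" by blast
    have "(\<Sum>b\<in>B. of_bool (b = x) *\<^sub>R b) = (\<Sum>b\<in>B. if b = x then b else 0)"
      by (rule sum.cong) auto
    also have "\<dots> = x" using x fB by simp
    finally have "(\<Sum>b\<in>B. of_bool (b = x) *\<^sub>R b) \<in> W" using x CW by auto
    from ind[OF this] x show False by auto
  qed
  have "independent (B \<union> C)"
  proof (rule independent_if_scalars_zero)
    show "finite (B \<union> C)" using fB C by simp
    fix u x assume sum0: "(\<Sum>x\<in>B \<union> C. u x *\<^sub>R x) = 0" and x: "x \<in> B \<union> C"
    have split: "(\<Sum>b\<in>B. u b *\<^sub>R b) + (\<Sum>c\<in>C. u c *\<^sub>R c) = 0"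
      using sum0 by (simp add: sum.union_disjoint fB C disj)
    have "(\<Sum>c\<in>C. u c *\<^sub>R c) \<in> W"
      using CW by (intro subspace_sum[OF W] subspace_scale[OF W]) auto
    then have "(\<Sum>b\<in>B. u b *\<^sub>R b) \<in> W"
      using split W by (metis add_eq_0_iff2 subspace_neg)
    then have B0: "\<forall>b\<in>B. u b = 0" by (rule ind)
    then have "(\<Sum>c\<in>C. u c *\<^sub>R c) = 0" using split by simp
    then have "\<forall>c\<in>C. u c = 0" using independentD[OF C(1,3) subset_refl] by blast
    with B0 x show "u x = 0" by blast
  qed
  moreover have "span (B \<union> C) = V"
  proof
    show "span (B \<union> C) \<subseteq> V" using BV CW WV V by (intro span_minimal) auto
    show "V \<subseteq> span (B \<union> C)"
    proof
      fix v assume "v \<in> V"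
      from gen[OF this] obtain u where u: "v - (\<Sum>b\<in>B. u b *\<^sub>R b) \<in> W" by blast
      have "v - (\<Sum>b\<in>B. u b *\<^sub>R b) \<in> span (B \<union> C)"
        using u C(2) span_mono[of C "B \<union> C"] by blast
      moreover have "(\<Sum>b\<in>B. u b *\<^sub>R b) \<in> span (B \<union> C)"
        by (intro span_sum span_scale span_base) auto
      ultimately have "v - (\<Sum>b\<in>B. u b *\<^sub>R b) + (\<Sum>b\<in>B. u b *\<^sub>R b) \<in> span (B \<union> C)"
        by (rule span_add)
      then show "v \<in> span (B \<union> C)" by simp
    qed
  qed
  ultimately have "dim V = card (B \<union> C)"
    using dim_eq_card_independent[of "B \<union> C"] dim_span[of "B \<union> C"] by simp
  then show ?thesis by (simp add: card_Un_disjoint fB C disj)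
qed

lemma quotient_dim_eq:
  assumes V: "subspace V" and W: "subspace W" and WV: "W \<subseteq> V"
    and S: "finite S" "V \<subseteq> span S"
  shows "quotient_dim V W + dim W = dim V"
proof -
  obtain C where C: "C \<subseteq> W" "independent C" "W \<subseteq> span C" "card C = dim W"
    using basis_exists by blast
  have spanC: "span C = W" using C W by (metis span_minimal subset_antisym)
  have fin: "finite D" if "independent D" "D \<subseteq> V" for D
    using independent_span_bound[OF S(1) that(1)] that(2) S(2) by blast
  have fC: "finite C" using fin C WV by blast
  obtain D where D: "C \<subseteq> D" "D \<subseteq> V" "independent D" "V \<subseteq> span D"
    using maximal_independent_subset_extend[of C V] C WV by blast
  have fD: "finite D" using fin D by blast
  have "quotient_basis V W (D - C)"
    unfolding quotient_basis_def
  proof (intro conjI allI impI ballI)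
    show "finite (D - C)" "D - C \<subseteq> V" using fD D by auto
    fix u :: "_ \<Rightarrow> real" and b
    assume "(\<Sum>b\<in>D - C. u b *\<^sub>R b) \<in> W" and b: "b \<in> D - C"
    then have "(\<Sum>b\<in>D - C. u b *\<^sub>R b) \<in> span C" using spanC by simp
    then obtain w where w: "(\<Sum>b\<in>D - C. u b *\<^sub>R b) = (\<Sum>c\<in>C. w c *\<^sub>R c)"
      using span_finite[OF fC] by auto
    let ?g = "\<lambda>x. if x \<in> C then - w x else u x"
    have "(\<Sum>x\<in>D. ?g x *\<^sub>R x) = (\<Sum>x\<in>D - C. ?g x *\<^sub>R x) + (\<Sum>x\<in>C. ?g x *\<^sub>R x)"
      using sum.subset_diff[OF D(1) fD] by blast
    also have "\<dots> = (\<Sum>x\<in>D - C. u x *\<^sub>R x) + (\<Sum>x\<in>C. - (w x *\<^sub>R x))"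
      by (intro arg_cong2[where f = "(+)"] sum.cong) auto
    also have "\<dots> = 0" using w by (simp add: sum_negf)
    finally have "?g b = 0" using independentD[OF D(3) fD subset_refl, of ?g b] b by simp
    then show "u b = 0" using b by simp
  next
    fix v assume "v \<in> V"
    then have "v \<in> span D" using D by blast
    then obtain u where u: "v = (\<Sum>x\<in>D. u x *\<^sub>R x)" using span_finite[OF fD] by auto
    have "v = (\<Sum>x\<in>D - C. u x *\<^sub>R x) + (\<Sum>x\<in>C. u x *\<^sub>R x)"
      using sum.subset_diff[OF D(1) fD] u by blast
    then have "v - (\<Sum>x\<in>D - C. u x *\<^sub>R x) = (\<Sum>x\<in>C. u x *\<^sub>R x)" by simp
    moreover have "(\<Sum>x\<in>C. u x *\<^sub>R x) \<in> W"
      using C by (intro subspace_sum[OF W] subspace_scale[OF W]) auto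
    ultimately show "\<exists>u. v - (\<Sum>b\<in>D - C. u b *\<^sub>R b) \<in> W" by metis
  qed
  then have ex: "\<exists>B. quotient_basis V W B" by blast
  then have "quotient_basis V W (SOME B. quotient_basis V W B)" by (rule someI_ex)
  from quotient_basis_card[OF V W WV C(2) spanC fC this] ex C(4)
  show ?thesis by (simp add: quotient_dim_def)
qed

section \<open>T-meshes\<close>

type_synonym point = "real \<times> real"

record tmesh =
  faces :: "point set set"
  edges :: "point set set"

definition horizontal :: "point set \<Rightarrow> bool" where
  "horizontal \<tau> \<longleftrightarrow> (\<exists>a b. a \<noteq> b \<and> snd a = snd b \<and> \<tau> = closed_segment a b)"

definition vertical :: "point set \<Rightarrow> bool" where
  "vertical \<tau> \<longleftrightarrow> (\<exists>a b. a \<noteq> b \<and> fst a = fst b \<and> \<tau> = closed_segment a b)"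

definition endpoints :: "point set \<Rightarrow> point set" where
  "endpoints \<tau> = {a. \<exists>b. \<tau> = closed_segment a b}"

definition vertices :: "tmesh \<Rightarrow> point set" where
  "vertices T = (\<Union>\<tau>\<in>edges T. endpoints \<tau>)"

text \<open>An edge need not be a full side of a face: at a T-junction a side is subdivided. Hence edges
  are only required to be axis-aligned segments contained in the boundary of some face.\<close>

definition is_tmesh :: "tmesh \<Rightarrow> bool" where
  "is_tmesh T \<longleftrightarrow>
     finite (faces T) \<and> finite (edges T) \<and>
     (\<forall>\<sigma>\<in>faces T. \<exists>a b. \<sigma> = box a b \<and> box a b \<noteq> {}) \<and>
     (\<forall>\<tau>\<in>edges T. (horizontal \<tau> \<or> vertical \<tau>) \<and> (\<exists>\<sigma>\<in>faces T. \<tau> \<subseteq> frontier \<sigma>)) \<and>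
     (\<forall>\<sigma>\<in>faces T. \<exists>A\<subseteq>edges T. frontier \<sigma> = \<Union>A) \<and>
     (\<forall>\<sigma>\<in>faces T. \<forall>\<sigma>'\<in>faces T. \<sigma> \<noteq> \<sigma>' \<longrightarrow>
        closure \<sigma> \<inter> closure \<sigma>' = frontier \<sigma> \<inter> frontier \<sigma>' \<and>
        (\<exists>A\<subseteq>edges T. \<exists>B\<subseteq>vertices T. frontier \<sigma> \<inter> frontier \<sigma>' = \<Union>A \<union> B)) \<and>
     (\<forall>\<tau>\<in>edges T. \<forall>\<tau>'\<in>edges T. \<tau> \<noteq> \<tau>' \<longrightarrow>
        \<tau> \<inter> \<tau>' = {} \<or> (\<exists>\<gamma>\<in>vertices T. \<tau> \<inter> \<tau>' = {\<gamma>})) \<and>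
     (\<forall>\<gamma>\<in>vertices T. (\<exists>\<tau>\<in>edges T. horizontal \<tau> \<and> \<gamma> \<in> \<tau>) \<and>
                     (\<exists>\<tau>\<in>edges T. vertical \<tau> \<and> \<gamma> \<in> \<tau>))"

definition domain :: "tmesh \<Rightarrow> point set" where
  "domain T = (\<Union>\<sigma>\<in>faces T. closure \<sigma>)"

definition simply_connected_tmesh :: "tmesh \<Rightarrow> bool" where
  "simply_connected_tmesh T \<longleftrightarrow>
     is_tmesh T \<and> simply_connected (domain T) \<and> connected (interior (domain T))"

definition interior_edges :: "tmesh \<Rightarrow> point set set" where
  "interior_edges T = {\<tau>\<in>edges T. \<tau> \<inter> interior (domain T) \<noteq> {}}"

definition interior_vertices :: "tmesh \<Rightarrow> point set" where
  "interior_vertices T = vertices T \<inter> interior (domain T)"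

section \<open>Bivariate polynomials and splines\<close>

text \<open>Elements of \<^typ>\<open>real poly poly\<close> are polynomials in \<open>t\<close> whose coefficients are polynomials
  in \<open>s\<close>, where \<open>(s, t)\<close> are the horizontal and vertical coordinates.\<close>

definition eval2 :: "real poly poly \<Rightarrow> point \<Rightarrow> real" where
  "eval2 p x = poly (poly p [:snd x:]) (fst x)"

definition bipoly_space :: "nat \<Rightarrow> nat \<Rightarrow> real poly poly set" where
  "bipoly_space m m' = span {monom (monom 1 i) j | i j. i \<le> m \<and> j \<le> m'}"

text \<open>A non-zero linear polynomial \<open>a s + b t + c\<close> vanishing on the edge \<open>\<tau>\<close>; it is unique up to a
  non-zero constant factor.\<close>

definition edge_form :: "point set \<Rightarrow> real poly poly" where
  "edge_form \<tau> =
     (SOME l. l \<noteq> 0 \<and> (\<exists>a b c. l = [:[:c, a:], [:b:]:]) \<and> (\<forall>x\<in>\<tau>. eval2 l x = 0))"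

definition smoothness_distribution ::
    "tmesh \<Rightarrow> (point set \<Rightarrow> int) \<Rightarrow> bool" where
  "smoothness_distribution T r \<longleftrightarrow>
     (\<forall>\<tau>\<in>edges T. - 1 \<le> r \<tau>) \<and> (\<forall>\<tau>\<in>edges T - interior_edges T. r \<tau> = - 1)"

text \<open>The \<open>(m + 1, m' + 1)\<close> smoothness distributions.\<close>

definition bounded_smoothness_distribution ::
    "tmesh \<Rightarrow> nat \<Rightarrow> nat \<Rightarrow> (point set \<Rightarrow> int) \<Rightarrow> bool" where
  "bounded_smoothness_distribution T m m' r \<longleftrightarrow> smoothness_distribution T r \<and>
     (\<forall>\<tau>\<in>edges T. horizontal \<tau> \<longrightarrow> real_of_int (r \<tau>) \<le> (real m' - 1) / 2) \<and>
     (\<forall>\<tau>\<in>edges T. vertical \<tau> \<longrightarrow> real_of_int (r \<tau>) \<le> (real m - 1) / 2)"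

text \<open>A piecewise polynomial function is given by its polynomial pieces on the open faces, and
  \<open>C\<^sup>r\<close> smoothness across an edge (no condition if \<open>r \<tau> = -1\<close>) by the usual divisibility
  condition on the difference of the two adjacent pieces.\<close>

definition spline_space ::
    "tmesh \<Rightarrow> nat \<Rightarrow> nat \<Rightarrow> (point set \<Rightarrow> int) \<Rightarrow> (point set \<Rightarrow> real poly poly) set" where
  "spline_space T m m' r =
     {f \<in> direct_sum (faces T) (\<lambda>\<sigma>. bipoly_space m m').
        \<forall>\<tau>\<in>interior_edges T. \<forall>\<sigma>\<in>faces T. \<forall>\<sigma>'\<in>faces T.
          \<sigma> \<noteq> \<sigma>' \<and> \<tau> \<subseteq> closure \<sigma> \<and> \<tau> \<subseteq> closure \<sigma>' \<longrightarrow>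
          edge_form \<tau> ^ nat (r \<tau> + 1) dvd f \<sigma> - f \<sigma>'}"

section \<open>Complexes\<close>

definition edge_ideal ::
    "nat \<Rightarrow> nat \<Rightarrow> (point set \<Rightarrow> int) \<Rightarrow> point set \<Rightarrow> real poly poly set" where
  "edge_ideal m m' r \<tau> = {p \<in> bipoly_space m m'. edge_form \<tau> ^ nat (r \<tau> + 1) dvd p}"

text \<open>The sum of the subspaces of the edges at \<open>\<gamma>\<close>; all edges at an interior vertex are interior.\<close>

definition vertex_ideal ::
    "tmesh \<Rightarrow> nat \<Rightarrow> nat \<Rightarrow> (point set \<Rightarrow> int) \<Rightarrow> point \<Rightarrow> real poly poly set" where
  "vertex_ideal T m m' r \<gamma> = span (\<Union>\<tau>\<in>{\<tau>\<in>interior_edges T. \<gamma> \<in> \<tau>}. edge_ideal m m' r \<tau>)"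

text \<open>An orientation sends each edge to its pair (tail, head) of endpoints.\<close>

definition orientation :: "tmesh \<Rightarrow> (point set \<Rightarrow> point \<times> point) \<Rightarrow> bool" where
  "orientation T ori \<longleftrightarrow>
     (\<forall>\<tau>\<in>edges T. \<tau> = closed_segment (fst (ori \<tau>)) (snd (ori \<tau>)))"

definition incidence :: "(point set \<Rightarrow> point \<times> point) \<Rightarrow> point set \<Rightarrow> point \<Rightarrow> real" where
  "incidence ori \<tau> \<gamma> = of_bool (\<gamma> = snd (ori \<tau>)) - of_bool (\<gamma> = fst (ori \<tau>))"

text \<open>The cellular boundary map from edges to vertices, relative to the boundary of the domain.\<close>

definition boundary_map ::
    "tmesh \<Rightarrow> (point set \<Rightarrow> point \<times> point) \<Rightarrow>
     (point set \<Rightarrow> real poly poly) \<Rightarrow> point \<Rightarrow> real poly poly" where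
  "boundary_map T ori f =
     (\<lambda>\<gamma>. if \<gamma> \<in> interior_vertices T
           then \<Sum>\<tau>\<in>interior_edges T. incidence ori \<tau> \<gamma> *\<^sub>R f \<tau> else 0)"

definition I_chains1 ::
    "tmesh \<Rightarrow> nat \<Rightarrow> nat \<Rightarrow> (point set \<Rightarrow> int) \<Rightarrow> (point set \<Rightarrow> real poly poly) set" where
  "I_chains1 T m m' r = direct_sum (interior_edges T) (edge_ideal m m' r)"

definition I_chains0 ::
    "tmesh \<Rightarrow> nat \<Rightarrow> nat \<Rightarrow> (point set \<Rightarrow> int) \<Rightarrow> (point \<Rightarrow> real poly poly) set" where
  "I_chains0 T m m' r = direct_sum (interior_vertices T) (vertex_ideal T m m' r)"

definition I_boundaries0 ::
    "tmesh \<Rightarrow> (point set \<Rightarrow> point \<times> point) \<Rightarrow> nat \<Rightarrow> nat \<Rightarrow> (point set \<Rightarrow> int) \<Rightarrow>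
     (point \<Rightarrow> real poly poly) set" where
  "I_boundaries0 T ori m m' r = boundary_map T ori ` I_chains1 T m m' r"

definition I_homology0 ::
    "tmesh \<Rightarrow> (point set \<Rightarrow> point \<times> point) \<Rightarrow> nat \<Rightarrow> nat \<Rightarrow> (point set \<Rightarrow> int) \<Rightarrow>
     (point \<Rightarrow> real poly poly) set set" where
  "I_homology0 T ori m m' r = quotient_space (I_chains0 T m m' r) (I_boundaries0 T ori m m' r)"

text \<open>\<open>H\<^sub>0 = 0\<close>: the only element of the quotient is its zero element.\<close>

definition I_homology0_zero ::
    "tmesh \<Rightarrow> (point set \<Rightarrow> point \<times> point) \<Rightarrow> nat \<Rightarrow> nat \<Rightarrow> (point set \<Rightarrow> int) \<Rightarrow> bool" where
  "I_homology0_zero T ori m m' r \<longleftrightarrow> I_homology0 T ori m m' r = {I_boundaries0 T ori m m' r}"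

text \<open>The direct sums of quotients in degrees 1 and 0 of the complex \<open>Q\<close> are taken as quotients of
  direct sums. The Euler characteristic does not involve the differentials of \<open>Q\<close>.\<close>

definition Q_dim2 :: "tmesh \<Rightarrow> nat \<Rightarrow> nat \<Rightarrow> nat" where
  "Q_dim2 T m m' = dim (direct_sum (faces T) (\<lambda>\<sigma>. bipoly_space m m'))"

definition Q_dim1 :: "tmesh \<Rightarrow> nat \<Rightarrow> nat \<Rightarrow> (point set \<Rightarrow> int) \<Rightarrow> nat" where
  "Q_dim1 T m m' r =
     quotient_dim (direct_sum (interior_edges T) (\<lambda>\<tau>. bipoly_space m m')) (I_chains1 T m m' r)"

definition Q_dim0 :: "tmesh \<Rightarrow> nat \<Rightarrow> nat \<Rightarrow> (point set \<Rightarrow> int) \<Rightarrow> nat" where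
  "Q_dim0 T m m' r =
     quotient_dim (direct_sum (interior_vertices T) (\<lambda>\<gamma>. bipoly_space m m')) (I_chains0 T m m' r)"

definition Q_euler_char :: "tmesh \<Rightarrow> nat \<Rightarrow> nat \<Rightarrow> (point set \<Rightarrow> int) \<Rightarrow> int" where
  "Q_euler_char T m m' r =
     int (Q_dim2 T m m') - int (Q_dim1 T m m' r) + int (Q_dim0 T m m' r)"

end

theory Submission
  imports Defs
begin

text \<open>Let \<open>P\<close> be the space of polynomials of degree at most \<open>m\<close> in \<open>s\<close> and at most \<open>m'\<close> in \<open>t\<close>,
  and write \<open>[\<gamma>] p\<close> for the 0-chain with value \<open>p\<close> at the vertex \<open>\<gamma>\<close>.

  Lowering the smoothness. For an interior vertex \<open>\<gamma>\<close>, an edge \<open>\<tau>\<close> at \<open>\<gamma>\<close> and \<open>p\<close> in the ideal of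
  \<open>\<tau>\<close> for \<open>s\<close>, the chain \<open>[\<gamma>] p\<close> has to be a boundary. Up to the boundary of \<open>[\<tau>] p\<close> it can be
  moved to the other end \<open>\<gamma>'\<close> of \<open>\<tau>\<close>, where it vanishes if \<open>\<gamma>'\<close> is not interior. If both
  ends are interior, each of them lies on an edge perpendicular to \<open>\<tau>\<close>, and these two edges
  lie on distinct parallel lines. The orders of vanishing \<open>r + 1\<close> on the two lines add up to at most
  \<open>m + 1\<close> (respectively \<open>m' + 1\<close>); this is what the bound on \<open>r\<close> is for. By Bezout's identity with
  control of degrees, \<open>p\<close> is therefore a sum \<open>p1 + p2\<close> in which \<open>p1\<close> lies in the ideal for \<open>r\<close> of the
  perpendicular edge at \<open>\<gamma>\<close> and \<open>p2\<close> in that of the perpendicular edge at \<open>\<gamma>'\<close>, and both stay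
  in the ideal of \<open>\<tau>\<close> for \<open>s\<close> (\<open>edge_ideal_split\<close>). So \<open>[\<gamma>] p1\<close> is a boundary by the
  hypothesis on \<open>r\<close>, and \<open>[\<gamma>] p2\<close>, moved to \<open>[\<gamma>'] p2\<close>, is one as well
  (\<open>I_homology0_zero_decreasing\<close>).

  The dimension. The jumps of a piecewise polynomial across the interior edges form a 1-chain;
  this defines a coboundary map \<open>\<delta>\<close>, and the splines are the elements whose image under \<open>\<delta>\<close> lies in
  the chains of the complex \<open>I\<close>. If the sequence of constant coefficients,
  from \<open>P\<close>-valued functions on faces to those on interior edges, those on interior vertices and \<open>0\<close>,
  given by \<open>\<delta>\<close> and the boundary map \<open>\<partial>\<close> is exact, the formula follows by counting dimensions
  (\<open>spline_dimension\<close>). Exactness at the vertices is the first part for the smoothness \<open>-1\<close>.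
  That \<open>\<partial>\<close> vanishes on the image of \<open>\<delta>\<close> can be checked on the boundary of one face at a time
  (\<open>boundary_coboundary\<close>).

  Exactness at the edges uses that the domain is simply connected. Its complement is then connected
  by Borsuk's separation theorem, so its frontier is connected, and so is the graph of the boundary
  edges. The net flow of a relative cycle into the boundary vertices has sum zero, hence weights on the
  boundary edges can compensate it: the cycle extends to weights on all edges whose net flow vanishes
  at every vertex (\<open>boundary_fill\<close>). For such weights a potential on the faces is written down
  explicitly: minus the sum of the weights of the vertical edges that a horizontal ray from the face
  to the left crosses. Its jumps across vertical edges are right by definition, and those across
  horizontal edges by summing the vanishing net flow over all vertices in a half-strip, a discrete
  Green's formula (\<open>left_sum_vertical_step\<close>, \<open>potential_exists\<close>).

  Horizontal and vertical edges are mostly treated together: a pair \<open>u\<close>, \<open>v\<close> stands for the two coordinate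
  functions in either order.\<close>

section \<open>Polynomials in two variables as sums of products\<close>

lemma subspace_bipoly: "subspace (bipoly_space m m')"
  unfolding bipoly_space_def by (rule subspace_span)

lemma finite_bipoly_gen: "finite {monom (monom (1::real) i) j | i j. i \<le> m \<and> j \<le> m'}"
proof -
  have "{monom (monom (1::real) i) j | i j. i \<le> m \<and> j \<le> m'} = (\<lambda>(i,j). monom (monom 1 i) j) ` ({..m} \<times> {..m'})"
    by auto
  then show ?thesis by simp
qed

lemma coeff_scaleR_poly [simp]: "coeff (c *\<^sub>R p) i = c *\<^sub>R coeff p i"
  by (simp add: scaleR_poly_def coeff_map_poly)

lemma scaleR_poly_poly: "c *\<^sub>R (p::real poly poly) = smult [:c:] p"
  by (simp add: poly_eq_iff)

lemma dvd_scaleR_poly: "(l::real poly poly) dvd p \<Longrightarrow> l dvd c *\<^sub>R p"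
  by (simp add: scaleR_poly_poly dvd_smult)

lemma bipoly_space_iff:
  "p \<in> bipoly_space m m' \<longleftrightarrow> degree p \<le> m' \<and> (\<forall>j. degree (coeff p j) \<le> m)"
proof
  have sub: "subspace {p::real poly poly. degree p \<le> m' \<and> (\<forall>j. degree (coeff p j) \<le> m)}"
  proof (rule subspaceI)
    fix c :: real and x :: "real poly poly"
    assume "x \<in> {p. degree p \<le> m' \<and> (\<forall>j. degree (coeff p j) \<le> m)}"
    then show "c *\<^sub>R x \<in> {p. degree p \<le> m' \<and> (\<forall>j. degree (coeff p j) \<le> m)}"
      by (auto simp: scaleR_poly_poly intro: order_trans[OF degree_smult_le] order_trans[OF degree_mult_le])
  qed (auto intro: degree_add_le)
  assume "p \<in> bipoly_space m m'"
  moreover have "bipoly_space m m' \<subseteq> {p::real poly poly. degree p \<le> m' \<and> (\<forall>j. degree (coeff p j) \<le> m)}"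
    unfolding bipoly_space_def
    by (rule span_minimal[OF _ sub])
       (auto simp: intro: order_trans[OF degree_monom_le])
  ultimately show "degree p \<le> m' \<and> (\<forall>j. degree (coeff p j) \<le> m)" by blast
next
  assume d: "degree p \<le> m' \<and> (\<forall>j. degree (coeff p j) \<le> m)"
  have "p = (\<Sum>j\<le>m'. monom (coeff p j) j)" using d by (simp add: poly_as_sum_of_monoms')
  also have "\<dots> = (\<Sum>j\<le>m'. \<Sum>i\<le>m. coeff (coeff p j) i *\<^sub>R monom (monom 1 i) j)"
  proof (rule sum.cong[OF refl])
    fix j
    have "monom (coeff p j) j = monom (\<Sum>i\<le>m. monom (coeff (coeff p j) i) i) j"
      using d by (simp add: poly_as_sum_of_monoms')
    also have "\<dots> = (\<Sum>i\<le>m. coeff (coeff p j) i *\<^sub>R monom (monom 1 i) j)"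
      by (simp add: poly_eq_iff coeff_sum if_distrib cong: if_cong)
    finally show "monom (coeff p j) j = (\<Sum>i\<le>m. coeff (coeff p j) i *\<^sub>R monom (monom 1 i) j)" .
  qed
  also have "\<dots> \<in> bipoly_space m m'"
    unfolding bipoly_space_def
    by (intro span_sum span_scale span_base) auto
  finally show "p \<in> bipoly_space m m'" .
qed

text \<open>The polynomial \<open>f(s) g(t)\<close>.\<close>

definition tensor :: "real poly \<Rightarrow> real poly \<Rightarrow> real poly poly" where
  "tensor f g = map_poly (\<lambda>a. smult a f) g"

lemma coeff_tensor [simp]: "coeff (tensor f g) j = smult (coeff g j) f"
  by (simp add: tensor_def coeff_map_poly)

lemma tensor_eq: "tensor f g = smult f (map_poly (\<lambda>a. [:a:]) g)"
  by (simp add: poly_eq_iff coeff_map_poly)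

lemma map_poly_const_mult:
  "map_poly (\<lambda>a. [:a:]) (f * g) = map_poly (\<lambda>a. [:a:]) f * map_poly (\<lambda>a. [:a::real:]) g"
proof (rule poly_eqI)
  fix n
  have *: "[:sum h A:] = (\<Sum>x\<in>A. [:h x::real:])" for h and A :: "nat set"
    by (simp add: poly_eq_iff coeff_sum coeff_pCons split: nat.split)
  show "coeff (map_poly (\<lambda>a. [:a:]) (f * g)) n = coeff (map_poly (\<lambda>a. [:a:]) f * map_poly (\<lambda>a. [:a:]) g) n"
    by (simp add: coeff_map_poly coeff_mult * mult.commute)
qed

lemma map_poly_const_power:
  "map_poly (\<lambda>a. [:a:]) (f ^ k) = map_poly (\<lambda>a. [:a::real:]) f ^ k"
  by (induction k) (simp_all add: map_poly_const_mult)

lemma tensor_mult: "tensor (f * f') (g * g') = tensor f g * tensor f' g'"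
  by (simp add: tensor_eq map_poly_const_mult mult.commute)

lemma tensor_add_left: "tensor (f + f') g = tensor f g + tensor f' g"
  by (simp add: poly_eq_iff algebra_simps)

lemma tensor_bipoly: "degree f \<le> m \<Longrightarrow> degree g \<le> m' \<Longrightarrow> tensor f g \<in> bipoly_space m m'"
  unfolding bipoly_space_iff
  by (auto intro!: degree_le order_trans[OF degree_smult_le] simp: coeff_eq_0)

lemma tensor_add_right: "tensor f (g + g') = tensor f g + tensor f g'"
  by (simp add: poly_eq_iff algebra_simps)

lemma bipoly_expand_t:
  assumes "p \<in> bipoly_space m m'"
  shows "p = (\<Sum>j\<le>m'. tensor (coeff p j) (monom 1 j))"
proof -
  have "p = (\<Sum>j\<le>m'. monom (coeff p j) j)" using assms by (simp add: bipoly_space_iff poly_as_sum_of_monoms')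
  also have "\<dots> = (\<Sum>j\<le>m'. tensor (coeff p j) (monom 1 j))"
    by (rule sum.cong[OF refl]) (simp add: poly_eq_iff)
  finally show ?thesis .
qed

text \<open>Taking coefficients in \<open>s\<close> turns a polynomial of \<open>real poly poly\<close> into polynomials in \<open>t\<close>
  over the reals. In this form a divisor in \<open>t\<close> alone is tested coefficient by coefficient.\<close>

lemma bipoly_expand_s:
  assumes "p \<in> bipoly_space m m'"
  shows "p = (\<Sum>i\<le>m. tensor (monom 1 i) (map_poly (\<lambda>f. coeff f i) p))"
proof (rule poly_eqI)
  fix j
  have "coeff p j = (\<Sum>i\<le>m. monom (coeff (coeff p j) i) i)"
    using assms by (simp add: bipoly_space_iff poly_as_sum_of_monoms')
  then show "coeff p j = coeff (\<Sum>i\<le>m. tensor (monom 1 i) (map_poly (\<lambda>f. coeff f i) p)) j"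
    by (simp add: coeff_sum coeff_map_poly smult_monom)
qed

lemma dvd_tensor_right:
  assumes "map_poly (\<lambda>a. [:a:]) d dvd p"
  shows "d dvd map_poly (\<lambda>f. coeff f i) p"
proof -
  obtain q where q: "p = map_poly (\<lambda>a. [:a:]) d * q" using assms by blast
  have "map_poly (\<lambda>f. coeff f i) p = d * map_poly (\<lambda>f. coeff f i) q"
    by (rule poly_eqI) (simp add: q coeff_map_poly coeff_mult coeff_sum)
  then show ?thesis by simp
qed

section \<open>Splitting polynomials with prescribed zeros\<close>

text \<open>Multiplying identities of Bezout's form shows that an element comaximal with \<open>b\<close> is comaximal with
  its powers.\<close>

lemma comaximal_power:
  fixes a b :: "'a::comm_ring_1"
  assumes "x * a + y * b = 1"
  shows "\<exists>x y. x * a + y * b ^ k = 1"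
proof (induction k)
  case (Suc k)
  then obtain x' y' where "x' * a + y' * b ^ k = 1" by blast
  then have "(x * a + y * b) * (x' * a + y' * b ^ k) = 1" using assms by simp
  then have "(x * (x' * a + y' * b ^ k) + y * b * x') * a + (y * y') * b ^ Suc k = 1"
    by (simp add: algebra_simps)
  then show ?case by blast
qed (auto intro: exI[of _ 0])

lemma comaximal_powers:
  fixes a b :: "'a::comm_ring_1"
  assumes "x * a + y * b = 1"
  shows "\<exists>x y. x * a ^ k + y * b ^ l = 1"
proof -
  obtain x' y' where "x' * a + y' * b ^ l = 1" using comaximal_power[OF assms] by blast
  then have "y' * b ^ l + x' * a = 1" by (simp add: add.commute)
  then show ?thesis using comaximal_power by (metis add.commute)
qed

text \<open>The multiples of \<open>(x - a)^k\<close> and of \<open>(x - c)^l\<close> together span the polynomials of degree at most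
  \<open>m\<close>: reducing the Bezout coefficient modulo \<open>(x - c)^l\<close> keeps the first summand below degree
  \<open>k + l\<close>, hence within degree \<open>m\<close>.\<close>

lemma univariate_split:
  fixes a c :: real
  assumes "a \<noteq> c" "k + l \<le> Suc m" "degree f \<le> m"
  obtains f1 f2 where "f = f1 + f2" "degree f1 \<le> m" "degree f2 \<le> m"
    "[:-a,1:] ^ k dvd f1" "[:-c,1:] ^ l dvd f2"
proof -
  let ?A = "[:-a,1:] ^ k" and ?C = "[:-c,1:] ^ l"
  have "[:inverse (c - a):] * [:-a,1:] + [:- inverse (c - a):] * [:-c,1:] = 1"
  proof -
    have "inverse (c - a) * (c - a) = 1" using assms(1) by simp
    then have "- (inverse (c - a) * a) + inverse (c - a) * c = 1" by (simp add: right_diff_distrib)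
    then show ?thesis by (simp add: one_pCons mult.commute)
  qed
  then obtain x y where xy: "x * ?A + y * ?C = 1"
    using comaximal_powers by metis
  \<comment> \<open>The first summand is \<open>g * ?A\<close>: modulo \<open>?C\<close> it agrees with \<open>f * x * ?A\<close>, hence with \<open>f\<close>.\<close>
  define g where "g = (f * x) mod ?C"
  have dg: "g = 0 \<or> degree g < l"
    using degree_mod_less[of ?C "f * x"] by (auto simp: g_def degree_power_eq)
  show ?thesis
  proof
    show "f = g * ?A + (f - g * ?A)" by simp
    show d1: "degree (g * ?A) \<le> m"
    proof (cases "g = 0")
      case False
      then have "degree (g * ?A) = degree g + k" by (simp add: degree_mult_eq degree_power_eq)
      then show ?thesis using dg False assms(2) by linarith
    qed simp
    show "degree (f - g * ?A) \<le> m" using d1 assms(3) by (rule degree_diff_le[rotated])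
    show "?A dvd g * ?A" by simp
    have "?C dvd f * x - g" by (simp add: g_def minus_mod_eq_div_mult)
    then have "?C dvd (f * x - g) * ?A" by (rule dvd_mult2)
    moreover have "f - g * ?A = (f * x - g) * ?A + f * y * ?C"
    proof -
      have "f = f * (x * ?A + y * ?C)" using xy by simp
      then show ?thesis by (simp add: algebra_simps)
    qed
    ultimately show "?C dvd f - g * ?A" by (metis dvd_add dvd_triv_right)
  qed
qed


lemma const_mult_power_dvd_iff:
  assumes "k \<noteq> 0"
  shows "(smult [:k::real:] l) ^ n dvd p \<longleftrightarrow> l ^ n dvd p"
proof -
  have "(smult [:k:] l) ^ n = l ^ n * [:[:k ^ n:]:]"
    by (simp add: smult_power poly_const_pow mult.commute)
  moreover have "is_unit [:[:k ^ n:]:]" using assms by (simp add: is_unit_const_poly_iff dvd_field_iff)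
  ultimately show ?thesis by (metis mult_unit_dvd_iff)
qed

text \<open>The choice in \<^const>\<open>edge_form\<close> is meaningful as soon as one suitable linear form is known.\<close>

lemma edge_form_exists:
  assumes "\<tau> = closed_segment a b" "a \<noteq> b" "l = [:[:c, d:], [:e:]:]" "l \<noteq> 0" "\<forall>x\<in>\<tau>. eval2 l x = 0"
  shows "edge_form \<tau> \<noteq> 0 \<and> (\<exists>a b c. edge_form \<tau> = [:[:c, a:], [:b:]:]) \<and> (\<forall>x\<in>\<tau>. eval2 (edge_form \<tau>) x = 0)"
  unfolding edge_form_def
  by (rule someI[of _ l]) (use assms in auto)

text \<open>A linear form that vanishes at two points of a line \<open>t = b\<close> is a constant multiple of \<open>t - b\<close>, and
  constant factors do not affect divisibility.\<close>

lemma edge_form_horizontal: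
  assumes "horizontal \<tau>" "p \<in> \<tau>"
  shows "edge_form \<tau> ^ n dvd P \<longleftrightarrow> tensor 1 ([:- snd p, 1:] ^ n) dvd P"
proof -
  obtain a b where ab: "a \<noteq> b" "snd a = snd b" "\<tau> = closed_segment a b"
    using assms by (auto simp: horizontal_def)
  have y: "snd x = snd p" if "x \<in> \<tau>" for x
  proof -
    have "snd z = snd a" if "z \<in> \<tau>" for z
      using that ab by (auto simp: closed_segment_def scaleR_left_diff_distrib)
    then show ?thesis using that assms by metis
  qed
  let ?l = "[:[:- snd p, 0:], [:1:]:] :: real poly poly"
  have "edge_form \<tau> \<noteq> 0 \<and> (\<exists>a b c. edge_form \<tau> = [:[:c, a:], [:b:]:]) \<and> (\<forall>x\<in>\<tau>. eval2 (edge_form \<tau>) x = 0)"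
    by (rule edge_form_exists[OF ab(3,1), where l = ?l]) (simp_all add: eval2_def y)
  then obtain d e c where l: "edge_form \<tau> = [:[:c, d:], [:e:]:]" "edge_form \<tau> \<noteq> 0"
    "\<forall>x\<in>\<tau>. eval2 (edge_form \<tau>) x = 0" by blast
  have "a \<in> \<tau>" "b \<in> \<tau>" using ab by auto
  then have *: "c + fst a * d + snd p * e = 0" "c + fst b * d + snd p * e = 0"
    using l(1,3) y[of a] y[of b] by (auto simp: eval2_def algebra_simps)
  have "(fst a - fst b) * d = 0" using * by (simp only: left_diff_distrib)
  then have "d = 0" using ab by (auto simp: prod_eq_iff)
  then have c: "c = - (snd p * e)" using * by simp
  with \<open>d = 0\<close> l have e: "e \<noteq> 0" by auto
  have "edge_form \<tau> = smult [:e:] (tensor 1 [:- snd p, 1:])"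
    using l(1) c \<open>d = 0\<close> by (simp add: tensor_eq map_poly_pCons one_pCons mult.commute)
  moreover have "tensor 1 [:- snd p, 1:] ^ n = tensor 1 ([:- snd p, 1:] ^ n)"
    by (simp add: tensor_eq map_poly_const_power)
  ultimately show ?thesis using const_mult_power_dvd_iff[OF e] by simp
qed

lemma edge_form_vertical:
  assumes "vertical \<tau>" "p \<in> \<tau>"
  shows "edge_form \<tau> ^ n dvd P \<longleftrightarrow> tensor ([:- fst p, 1:] ^ n) 1 dvd P"
proof -
  obtain a b where ab: "a \<noteq> b" "fst a = fst b" "\<tau> = closed_segment a b"
    using assms by (auto simp: vertical_def)
  have y: "fst x = fst p" if "x \<in> \<tau>" for x
  proof -
    have "fst z = fst a" if "z \<in> \<tau>" for z
      using that ab by (auto simp: closed_segment_def scaleR_left_diff_distrib)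
    then show ?thesis using that assms by metis
  qed
  let ?l = "[:[:- fst p, 1:], [:0:]:] :: real poly poly"
  have "edge_form \<tau> \<noteq> 0 \<and> (\<exists>a b c. edge_form \<tau> = [:[:c, a:], [:b:]:]) \<and> (\<forall>x\<in>\<tau>. eval2 (edge_form \<tau>) x = 0)"
    by (rule edge_form_exists[OF ab(3,1), where l = ?l]) (simp_all add: eval2_def y)
  then obtain d e c where l: "edge_form \<tau> = [:[:c, d:], [:e:]:]" "edge_form \<tau> \<noteq> 0"
    "\<forall>x\<in>\<tau>. eval2 (edge_form \<tau>) x = 0" by blast
  have "a \<in> \<tau>" "b \<in> \<tau>" using ab by auto
  then have *: "c + fst p * d + snd a * e = 0" "c + fst p * d + snd b * e = 0"
    using l(1,3) y[of a] y[of b] by (auto simp: eval2_def algebra_simps)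
  have "(snd a - snd b) * e = 0" using * by (simp only: left_diff_distrib)
  then have "e = 0" using ab by (auto simp: prod_eq_iff)
  then have c: "c = - (fst p * d)" using * by simp
  with \<open>e = 0\<close> l have d: "d \<noteq> 0" by auto
  have "edge_form \<tau> = smult [:d:] (tensor [:- fst p, 1:] 1)"
    using l(1) c \<open>e = 0\<close> by (simp add: tensor_eq map_poly_pCons one_pCons mult.commute)
  moreover have "tensor [:- fst p, 1:] 1 ^ n = tensor ([:- fst p, 1:] ^ n) 1"
    by (simp add: tensor_eq poly_const_pow)
  ultimately show ?thesis using const_mult_power_dvd_iff[OF d] by simp
qed

lemma tensor_dvd: "f dvd f' \<Longrightarrow> g dvd g' \<Longrightarrow> tensor f g dvd tensor f' g'"
  by (auto simp: tensor_mult elim!: dvdE)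

text \<open>The univariate splitting is applied to the powers of \<open>s\<close> only. The factors in \<open>t\<close> are left alone, so
  that the divisor \<open>h\<close> in \<open>t\<close> survives in both summands.\<close>

lemma split_horizontal:
  assumes P: "P \<in> bipoly_space m m'" "tensor 1 h dvd P"
    and ac: "a \<noteq> c" "k + l \<le> Suc m"
  obtains p1 p2 where "P = p1 + p2" "p1 \<in> bipoly_space m m'" "p2 \<in> bipoly_space m m'"
    "tensor 1 h dvd p1" "tensor 1 h dvd p2"
    "tensor ([:-a,1:] ^ k) 1 dvd p1" "tensor ([:-c,1:] ^ l) 1 dvd p2"
proof -
  have "\<exists>f1 f2. monom (1::real) i = f1 + f2 \<and> degree f1 \<le> m \<and> degree f2 \<le> m \<and>
    [:-a,1:] ^ k dvd f1 \<and> [:-c,1:] ^ l dvd f2" if "i \<le> m" for i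
    using univariate_split[OF ac, of "monom 1 i"] that
    by (metis degree_monom_le order_trans)
  then obtain f1 f2 where f: "\<And>i. i \<le> m \<Longrightarrow> monom (1::real) i = f1 i + f2 i"
    "\<And>i. i \<le> m \<Longrightarrow> degree (f1 i) \<le> m" "\<And>i. i \<le> m \<Longrightarrow> degree (f2 i) \<le> m"
    "\<And>i. i \<le> m \<Longrightarrow> [:-a,1:] ^ k dvd f1 i" "\<And>i. i \<le> m \<Longrightarrow> [:-c,1:] ^ l dvd f2 i"
    by metis
  define G where "G i = map_poly (\<lambda>f. coeff f i) P" for i
  have dG: "degree (G i) \<le> m'" for i
    using P(1) by (intro degree_le) (auto simp: G_def coeff_map_poly bipoly_space_iff coeff_eq_0)
  have hG: "h dvd G i" for i
    using dvd_tensor_right[of h P i] P(2) by (simp add: tensor_eq G_def)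
  show thesis
  proof (rule that)
    have "P = (\<Sum>i\<le>m. tensor (monom 1 i) (G i))" using bipoly_expand_s[OF P(1)] by (simp add: G_def)
    also have "\<dots> = (\<Sum>i\<le>m. tensor (f1 i) (G i)) + (\<Sum>i\<le>m. tensor (f2 i) (G i))"
      by (simp add: f(1) tensor_add_left sum.distrib)
    finally show "P = (\<Sum>i\<le>m. tensor (f1 i) (G i)) + (\<Sum>i\<le>m. tensor (f2 i) (G i))" .
    show "(\<Sum>i\<le>m. tensor (f1 i) (G i)) \<in> bipoly_space m m'" "(\<Sum>i\<le>m. tensor (f2 i) (G i)) \<in> bipoly_space m m'"
      using f dG by (auto intro!: subspace_sum subspace_bipoly tensor_bipoly)
    show "tensor 1 h dvd (\<Sum>i\<le>m. tensor (f1 i) (G i))" "tensor 1 h dvd (\<Sum>i\<le>m. tensor (f2 i) (G i))"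
      "tensor ([:-a,1:] ^ k) 1 dvd (\<Sum>i\<le>m. tensor (f1 i) (G i))"
      "tensor ([:-c,1:] ^ l) 1 dvd (\<Sum>i\<le>m. tensor (f2 i) (G i))"
      using f hG by (auto intro!: dvd_sum tensor_dvd)
  qed
qed

text \<open>The same with the roles of \<open>s\<close> and \<open>t\<close> exchanged.\<close>

lemma split_vertical:
  assumes P: "P \<in> bipoly_space m m'" "tensor h 1 dvd P"
    and ac: "a \<noteq> c" "k + l \<le> Suc m'"
  obtains p1 p2 where "P = p1 + p2" "p1 \<in> bipoly_space m m'" "p2 \<in> bipoly_space m m'"
    "tensor h 1 dvd p1" "tensor h 1 dvd p2"
    "tensor 1 ([:-a,1:] ^ k) dvd p1" "tensor 1 ([:-c,1:] ^ l) dvd p2"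
proof -
  have "\<exists>f1 f2. monom (1::real) i = f1 + f2 \<and> degree f1 \<le> m' \<and> degree f2 \<le> m' \<and>
    [:-a,1:] ^ k dvd f1 \<and> [:-c,1:] ^ l dvd f2" if "i \<le> m'" for i
    using univariate_split[OF ac, of "monom 1 i"] that
    by (metis degree_monom_le order_trans)
  then obtain f1 f2 where f: "\<And>i. i \<le> m' \<Longrightarrow> monom (1::real) i = f1 i + f2 i"
    "\<And>i. i \<le> m' \<Longrightarrow> degree (f1 i) \<le> m'" "\<And>i. i \<le> m' \<Longrightarrow> degree (f2 i) \<le> m'"
    "\<And>i. i \<le> m' \<Longrightarrow> [:-a,1:] ^ k dvd f1 i" "\<And>i. i \<le> m' \<Longrightarrow> [:-c,1:] ^ l dvd f2 i"
    by metis
  define G where "G i = coeff P i" for i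
  have dG: "degree (G i) \<le> m" for i
    using P(1) by (auto simp: G_def bipoly_space_iff)
  have hG: "h dvd G i" for i
    using P(2) by (simp add: tensor_eq G_def const_poly_dvd_iff)
  show thesis
  proof (rule that)
    have "P = (\<Sum>i\<le>m'. tensor (G i) (monom 1 i))" using bipoly_expand_t[OF P(1)] by (simp add: G_def)
    also have "\<dots> = (\<Sum>i\<le>m'. tensor (G i) (f1 i)) + (\<Sum>i\<le>m'. tensor (G i) (f2 i))"
      by (simp add: f(1) tensor_add_right sum.distrib)
    finally show "P = (\<Sum>i\<le>m'. tensor (G i) (f1 i)) + (\<Sum>i\<le>m'. tensor (G i) (f2 i))" .
    show "(\<Sum>i\<le>m'. tensor (G i) (f1 i)) \<in> bipoly_space m m'" "(\<Sum>i\<le>m'. tensor (G i) (f2 i)) \<in> bipoly_space m m'"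
      using f dG by (auto intro!: subspace_sum subspace_bipoly tensor_bipoly)
    show "tensor h 1 dvd (\<Sum>i\<le>m'. tensor (G i) (f1 i))" "tensor h 1 dvd (\<Sum>i\<le>m'. tensor (G i) (f2 i))"
      "tensor 1 ([:-a,1:] ^ k) dvd (\<Sum>i\<le>m'. tensor (G i) (f1 i))"
      "tensor 1 ([:-c,1:] ^ l) dvd (\<Sum>i\<le>m'. tensor (G i) (f2 i))"
      using f hG by (auto intro!: dvd_sum tensor_dvd)
  qed
qed

section \<open>Lowering the smoothness\<close>

lemma direct_sum_subspace:
  assumes "\<And>a. a \<in> A \<Longrightarrow> subspace (G a)"
  shows "subspace (direct_sum A G)"
  using assms unfolding direct_sum_def subspace_def
  by (auto simp: scaleR_fun_def)

lemma subspace_edge_ideal: "subspace (edge_ideal m m' r \<tau>)"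
  unfolding edge_ideal_def subspace_def
  using subspace_bipoly[of m m'] by (auto simp: subspace_def dvd_scaleR_poly)

lemma edge_ideal_mono: "s \<tau> \<le> r \<tau> \<Longrightarrow> edge_ideal m m' r \<tau> \<subseteq> edge_ideal m m' s \<tau>"
  unfolding edge_ideal_def
  using le_imp_power_dvd[of "nat (s \<tau> + 1)" "nat (r \<tau> + 1)" "edge_form \<tau>"] by (auto intro: dvd_trans)

lemma linear_boundary_map: "linear (boundary_map T ori)"
  by (rule linearI)
     (simp_all add: boundary_map_def fun_eq_iff scaleR_fun_def scaleR_add_right sum.distrib
       scaleR_sum_right mult.commute)

lemma subspace_I_chains1: "subspace (I_chains1 T m m' r)"
  unfolding I_chains1_def by (intro direct_sum_subspace subspace_edge_ideal)

lemma subspace_I_chains0: "subspace (I_chains0 T m m' r)"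
  unfolding I_chains0_def vertex_ideal_def by (intro direct_sum_subspace subspace_span)

lemma subspace_I_boundaries0: "subspace (I_boundaries0 T ori m m' r)"
  unfolding I_boundaries0_def by (intro linear_subspace_image linear_boundary_map subspace_I_chains1)

lemma quotient_space_zero_iff:
  assumes "subspace V" "subspace W"
  shows "quotient_space V W = {W} \<longleftrightarrow> V \<subseteq> W"
proof
  assume "quotient_space V W = {W}"
  then have *: "(\<lambda>w. v + w) ` W = W" if "v \<in> V" for v
  proof -
    have "(\<lambda>w. v + w) ` W \<in> quotient_space V W" unfolding quotient_space_def using that by (rule imageI)
    then show ?thesis unfolding \<open>quotient_space V W = {W}\<close> by (rule singletonD)
  qed
  show "V \<subseteq> W"
  proof
    fix v assume "v \<in> V"
    have "v + 0 \<in> (\<lambda>w. v + w) ` W" using subspace_0[OF assms(2)] by (rule imageI)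
    then have "v + 0 \<in> W" unfolding *[OF \<open>v \<in> V\<close>] .
    then show "v \<in> W" by simp
  qed
next
  assume VW: "V \<subseteq> W"
  have "(\<lambda>w. v + w) ` W = W" if "v \<in> V" for v
  proof
    show "(\<lambda>w. v + w) ` W \<subseteq> W" using that VW subspace_add[OF assms(2)] by blast
    show "W \<subseteq> (\<lambda>w. v + w) ` W"
    proof
      fix w assume "w \<in> W"
      then have "w - v \<in> W" using that VW subspace_diff[OF assms(2)] by blast
      then show "w \<in> (\<lambda>w. v + w) ` W" by (intro image_eqI[of _ _ "w - v"]) auto
    qed
  qed
  then show "quotient_space V W = {W}"
    unfolding quotient_space_def using subspace_0[OF assms(1)] by (metis (no_types, lifting) empty_iff image_constant_conv image_cong)
qed

lemma I_homology0_zero_iff: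
  "I_homology0_zero T ori m m' r \<longleftrightarrow> I_chains0 T m m' r \<subseteq> I_boundaries0 T ori m m' r"
  unfolding I_homology0_zero_def I_homology0_def
  by (intro quotient_space_zero_iff subspace_I_chains0 subspace_I_boundaries0)

definition single :: "'a \<Rightarrow> 'b::zero \<Rightarrow> 'a \<Rightarrow> 'b" where
  "single a p = (\<lambda>x. if x = a then p else 0)"

lemma linear_single: "linear (single a)"
  by (rule linearI) (auto simp: single_def scaleR_fun_def)

lemma direct_sum_expand:
  assumes "finite A" "f \<in> direct_sum A G"
  shows "f = (\<Sum>a\<in>A. single a (f a))"
proof
  fix x
  have *: "(\<Sum>a\<in>A. single a (f a)) x = (\<Sum>a\<in>A. single a (f a) x)"
    by (induction A rule: infinite_finite_induct) auto
  show "f x = (\<Sum>a\<in>A. single a (f a)) x"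
    unfolding * using assms by (auto simp: single_def direct_sum_def)
qed

lemma single_mem_direct_sum:
  assumes "a \<in> A" "p \<in> G a" "\<And>b. b \<in> A \<Longrightarrow> 0 \<in> G b"
  shows "single a p \<in> direct_sum A G"
  using assms by (auto simp: direct_sum_def single_def)

lemma boundary_map_single:
  assumes "finite (edges T)" "\<tau> \<in> interior_edges T"
  shows "boundary_map T ori (single \<tau> p) =
    (\<lambda>\<gamma>. if \<gamma> \<in> interior_vertices T then incidence ori \<tau> \<gamma> *\<^sub>R p else 0)"
proof -
  have fin: "finite (interior_edges T)" using assms(1) by (simp add: interior_edges_def)
  have "(\<Sum>\<tau>'\<in>interior_edges T. incidence ori \<tau>' \<gamma> *\<^sub>R single \<tau> p \<tau>') = incidence ori \<tau> \<gamma> *\<^sub>R p" for \<gamma>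
  proof -
    have "(\<Sum>\<tau>'\<in>interior_edges T. incidence ori \<tau>' \<gamma> *\<^sub>R single \<tau> p \<tau>') =
      (\<Sum>\<tau>'\<in>interior_edges T. if \<tau>' = \<tau> then incidence ori \<tau> \<gamma> *\<^sub>R p else 0)"
      by (rule sum.cong) (auto simp: single_def)
    then show ?thesis using assms fin by simp
  qed
  then show ?thesis unfolding boundary_map_def by presburger
qed

text \<open>The boundary of \<open>[\<tau>] p\<close> moves \<open>p\<close> from one end of \<open>\<tau>\<close> to the other, or removes it if the other
  end is not interior.\<close>

lemma single_edge_ideal_boundary:
  assumes fin: "finite (edges T)" and \<tau>: "\<tau> \<in> interior_edges T"
    and p: "p \<in> edge_ideal m m' r \<tau>"
    and g: "\<gamma> \<in> interior_vertices T" "\<gamma>' \<noteq> \<gamma>"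
      "ori \<tau> = (\<gamma>, \<gamma>') \<or> ori \<tau> = (\<gamma>', \<gamma>)"
  shows "single \<gamma> p - (if \<gamma>' \<in> interior_vertices T then single \<gamma>' p else 0) \<in> I_boundaries0 T ori m m' r"
proof -
  have c: "single \<tau> p \<in> I_chains1 T m m' r"
    unfolding I_chains1_def
    using \<tau> p subspace_0[OF subspace_edge_ideal] by (rule single_mem_direct_sum)
  define c :: real where "c = (if ori \<tau> = (\<gamma>', \<gamma>) then 1 else -1)"
  have "c *\<^sub>R boundary_map T ori (single \<tau> p) =
     single \<gamma> p - (if \<gamma>' \<in> interior_vertices T then single \<gamma>' p else 0)"
  proof
    fix x
    have "\<gamma> = \<gamma>' \<longleftrightarrow> False" using g(2) by blast
    then show "(c *\<^sub>R boundary_map T ori (single \<tau> p)) x =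
      (single \<gamma> p - (if \<gamma>' \<in> interior_vertices T then single \<gamma>' p else 0)) x"
      unfolding boundary_map_single[OF fin \<tau>] scaleR_fun_def
      using g by (elim disjE; cases "x = \<gamma>"; cases "x = \<gamma>'")
        (simp_all add: c_def incidence_def single_def)
  qed
  moreover have "c *\<^sub>R boundary_map T ori (single \<tau> p) \<in> I_boundaries0 T ori m m' r"
    by (intro subspace_scale subspace_I_boundaries0) (use c in \<open>auto simp: I_boundaries0_def\<close>)
  ultimately show ?thesis by simp
qed

lemma I_boundaries0_mono:
  assumes "\<forall>\<tau>\<in>edges T. s \<tau> \<le> r \<tau>"
  shows "I_boundaries0 T ori m m' r \<subseteq> I_boundaries0 T ori m m' s"
proof -
  have "I_chains1 T m m' r \<subseteq> I_chains1 T m m' s"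
    unfolding I_chains1_def direct_sum_def
    using assms edge_ideal_mono[of s _ r] by (auto simp: interior_edges_def subset_iff)
  then show ?thesis by (auto simp: I_boundaries0_def)
qed

lemma horizontal_snd_eq:
  assumes "horizontal \<tau>" "p \<in> \<tau>" "q \<in> \<tau>"
  shows "snd p = snd q"
proof -
  obtain a b where ab: "snd a = snd b" "\<tau> = closed_segment a b"
    using assms by (auto simp: horizontal_def)
  have "snd z = snd a" if "z \<in> \<tau>" for z
    using that ab by (auto simp: closed_segment_def scaleR_left_diff_distrib)
  then show ?thesis using assms by metis
qed

lemma vertical_fst_eq:
  assumes "vertical \<tau>" "p \<in> \<tau>" "q \<in> \<tau>"
  shows "fst p = fst q"
proof -
  obtain a b where ab: "fst a = fst b" "\<tau> = closed_segment a b"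
    using assms by (auto simp: vertical_def)
  have "fst z = fst a" if "z \<in> \<tau>" for z
    using that ab by (auto simp: closed_segment_def scaleR_left_diff_distrib)
  then show ?thesis using assms by metis
qed

text \<open>The perpendicular edges at the two ends lie on distinct lines, and the bound on \<open>r\<close> says that the
  orders of vanishing along them leave enough room in the degree for \<open>split_horizontal\<close> or
  \<open>split_vertical\<close>.\<close>

lemma edge_ideal_split:
  assumes \<tau>: "horizontal \<tau> \<or> vertical \<tau>" "\<gamma> \<in> \<tau>" "\<gamma>' \<in> \<tau>" "\<gamma> \<noteq> \<gamma>'"
    and p: "p \<in> edge_ideal m m' s \<tau>"
    and h: "horizontal h" "horizontal h'" "\<gamma> \<in> h" "\<gamma>' \<in> h'"
    and v: "vertical v" "vertical v'" "\<gamma> \<in> v" "\<gamma>' \<in> v'"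
    and bh: "real_of_int (r h) \<le> (real m' - 1) / 2" "real_of_int (r h') \<le> (real m' - 1) / 2"
    and bv: "real_of_int (r v) \<le> (real m - 1) / 2" "real_of_int (r v') \<le> (real m - 1) / 2"
  obtains e e' p1 p2 where "e = h \<and> e' = h' \<or> e = v \<and> e' = v'" "p = p1 + p2"
     "p1 \<in> edge_ideal m m' s \<tau>" "p2 \<in> edge_ideal m m' s \<tau>"
     "p1 \<in> edge_ideal m m' r e" "p2 \<in> edge_ideal m m' r e'"
  using \<tau>(1)
proof
  assume hor: "horizontal \<tau>"
  then have "snd \<gamma> = snd \<gamma>'" using horizontal_snd_eq \<tau> by blast
  then have ne: "fst \<gamma> \<noteq> fst \<gamma>'" using \<tau> by (auto simp: prod_eq_iff)
  have le: "nat (r v + 1) + nat (r v' + 1) \<le> Suc m"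
  proof -
    have "real_of_int (2 * r v) \<le> real_of_int (int m - 1)" "real_of_int (2 * r v') \<le> real_of_int (int m - 1)"
      using bv by auto
    then have "2 * r v \<le> int m - 1" "2 * r v' \<le> int m - 1" unfolding of_int_le_iff .
    then show ?thesis by arith
  qed
  have p': "p \<in> bipoly_space m m'" "tensor 1 ([:- snd \<gamma>, 1:] ^ nat (s \<tau> + 1)) dvd p"
    using p edge_form_horizontal[OF hor \<tau>(2)] by (auto simp: edge_ideal_def)
  obtain p1 p2 where P: "p = p1 + p2" and b: "p1 \<in> bipoly_space m m'" "p2 \<in> bipoly_space m m'"
    and d: "tensor 1 ([:- snd \<gamma>, 1:] ^ nat (s \<tau> + 1)) dvd p1" "tensor 1 ([:- snd \<gamma>, 1:] ^ nat (s \<tau> + 1)) dvd p2"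
    "tensor ([:-fst \<gamma>,1:] ^ nat (r v + 1)) 1 dvd p1" "tensor ([:-fst \<gamma>',1:] ^ nat (r v' + 1)) 1 dvd p2"
    by (rule split_horizontal[OF p' ne le])
  have "p1 \<in> edge_ideal m m' s \<tau>" "p2 \<in> edge_ideal m m' s \<tau>"
    using b d(1,2) by (simp_all add: edge_ideal_def edge_form_horizontal[OF hor \<tau>(2)])
  moreover have "p1 \<in> edge_ideal m m' r v" "p2 \<in> edge_ideal m m' r v'"
    using b d(3,4)
    by (simp_all add: edge_ideal_def edge_form_vertical[OF v(1,3)] edge_form_vertical[OF v(2,4)])
  ultimately show ?thesis by (rule that[OF disjI2[OF conjI[OF refl refl]] P])
next
  assume ver: "vertical \<tau>"
  then have "fst \<gamma> = fst \<gamma>'" using vertical_fst_eq \<tau> by blast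
  then have ne: "snd \<gamma> \<noteq> snd \<gamma>'" using \<tau> by (auto simp: prod_eq_iff)
  have le: "nat (r h + 1) + nat (r h' + 1) \<le> Suc m'"
  proof -
    have "real_of_int (2 * r h) \<le> real_of_int (int m' - 1)" "real_of_int (2 * r h') \<le> real_of_int (int m' - 1)"
      using bh by auto
    then have "2 * r h \<le> int m' - 1" "2 * r h' \<le> int m' - 1" unfolding of_int_le_iff .
    then show ?thesis by arith
  qed
  have p': "p \<in> bipoly_space m m'" "tensor ([:- fst \<gamma>, 1:] ^ nat (s \<tau> + 1)) 1 dvd p"
    using p edge_form_vertical[OF ver \<tau>(2)] by (auto simp: edge_ideal_def)
  obtain p1 p2 where P: "p = p1 + p2" and b: "p1 \<in> bipoly_space m m'" "p2 \<in> bipoly_space m m'"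
    and d: "tensor ([:- fst \<gamma>, 1:] ^ nat (s \<tau> + 1)) 1 dvd p1" "tensor ([:- fst \<gamma>, 1:] ^ nat (s \<tau> + 1)) 1 dvd p2"
    "tensor 1 ([:-snd \<gamma>,1:] ^ nat (r h + 1)) dvd p1" "tensor 1 ([:-snd \<gamma>',1:] ^ nat (r h' + 1)) dvd p2"
    by (rule split_vertical[OF p' ne le])
  have "p1 \<in> edge_ideal m m' s \<tau>" "p2 \<in> edge_ideal m m' s \<tau>"
    using b d(1,2) by (simp_all add: edge_ideal_def edge_form_vertical[OF ver \<tau>(2)])
  moreover have "p1 \<in> edge_ideal m m' r h" "p2 \<in> edge_ideal m m' r h'"
    using b d(3,4)
    by (simp_all add: edge_ideal_def edge_form_horizontal[OF h(1,3)] edge_form_horizontal[OF h(2,4)])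
  ultimately show ?thesis by (rule that[OF disjI1[OF conjI[OF refl refl]] P])
qed

lemma vertex_edge_interior:
  "\<gamma> \<in> interior_vertices T \<Longrightarrow> \<tau> \<in> edges T \<Longrightarrow> \<gamma> \<in> \<tau> \<Longrightarrow> \<tau> \<in> interior_edges T"
  by (auto simp: interior_vertices_def interior_edges_def)

lemma tmesh_vertex_edges:
  assumes "is_tmesh T" "\<gamma> \<in> vertices T"
  obtains h v where "h \<in> edges T" "horizontal h" "\<gamma> \<in> h" "v \<in> edges T" "vertical v" "\<gamma> \<in> v"
proof -
  have "\<forall>\<gamma>\<in>vertices T. (\<exists>\<tau>\<in>edges T. horizontal \<tau> \<and> \<gamma> \<in> \<tau>) \<and> (\<exists>\<tau>\<in>edges T. vertical \<tau> \<and> \<gamma> \<in> \<tau>)"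
    using assms(1) unfolding is_tmesh_def by (elim conjE)
  then show thesis using assms(2) that by blast
qed

text \<open>The premise \<open>VE\<close> excludes vertices in the middle of an edge. It holds in every T-mesh, as
  \<open>vertex_in_edge\<close> below shows.\<close>

lemma I_homology0_zero_decreasing:
  assumes T: "is_tmesh T" and ori: "orientation T ori"
    and VE: "\<And>\<gamma> \<tau>. \<gamma> \<in> vertices T \<Longrightarrow> \<tau> \<in> edges T \<Longrightarrow> \<gamma> \<in> \<tau> \<Longrightarrow> \<gamma> = fst (ori \<tau>) \<or> \<gamma> = snd (ori \<tau>)"
    and br: "bounded_smoothness_distribution T m m' r"
    and sr: "\<forall>\<tau>\<in>edges T. s \<tau> \<le> r \<tau>"
    and H: "I_homology0_zero T ori m m' r"
  shows "I_homology0_zero T ori m m' s"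
proof -
  have finE: "finite (edges T)" using T by (simp add: is_tmesh_def)
  have hv_dir: "horizontal \<tau> \<or> vertical \<tau>" if "\<tau> \<in> edges T" for \<tau> using T that by (simp add: is_tmesh_def)
  have seg: "\<tau> = closed_segment (fst (ori \<tau>)) (snd (ori \<tau>))" if "\<tau> \<in> edges T" for \<tau>
    using ori that by (simp add: orientation_def)
  have nondeg: "fst (ori \<tau>) \<noteq> snd (ori \<tau>)" if "\<tau> \<in> edges T" for \<tau>
  proof
    assume "fst (ori \<tau>) = snd (ori \<tau>)"
    then have "\<tau> = {fst (ori \<tau>)}" using seg[OF that] by simp
    moreover obtain a b where "a \<noteq> b" "\<tau> = closed_segment a b"
      using hv_dir[OF \<open>\<tau> \<in> edges T\<close>] by (auto simp: horizontal_def vertical_def)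
    ultimately show False by (metis ends_in_segment singletonD)
  qed
  have fin0: "finite (interior_vertices T)"
  proof -
    have "vertices T \<subseteq> fst ` ori ` edges T \<union> snd ` ori ` edges T"
    proof
      fix \<gamma> assume g: "\<gamma> \<in> vertices T"
      then obtain \<tau> where \<tau>: "\<tau> \<in> edges T" "\<gamma> \<in> endpoints \<tau>" by (auto simp: vertices_def)
      then have "\<gamma> \<in> \<tau>" by (auto simp: endpoints_def)
      from VE[OF g \<tau>(1) this] show "\<gamma> \<in> fst ` ori ` edges T \<union> snd ` ori ` edges T" using \<tau> by blast
    qed
    then show ?thesis using finE by (auto simp: interior_vertices_def intro: finite_subset)
  qed
  let ?W = "I_boundaries0 T ori m m' s"
  note W = subspace_I_boundaries0[of T ori m m' s]
  \<comment> \<open>For \<open>p\<close> in the ideal of an edge for \<open>r\<close> the hypothesis on \<open>r\<close> applies directly.\<close>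
  have rW: "single \<gamma> p \<in> ?W"
    if "\<gamma> \<in> interior_vertices T" "e \<in> edges T" "\<gamma> \<in> e" "p \<in> edge_ideal m m' r e" for \<gamma> e p
  proof -
    have "e \<in> interior_edges T" using vertex_edge_interior that by blast
    then have "p \<in> vertex_ideal T m m' r \<gamma>"
      unfolding vertex_ideal_def using that by (intro span_base) auto
    then have "single \<gamma> p \<in> I_chains0 T m m' r"
      unfolding I_chains0_def
      by (rule single_mem_direct_sum[OF that(1)]) (auto simp: vertex_ideal_def span_zero)
    then show ?thesis using H I_boundaries0_mono[OF sr] unfolding I_homology0_zero_iff by blast
  qed
  \<comment> \<open>For an ideal for \<open>s\<close>, move along \<open>\<tau>\<close> to its other end \<open>\<gamma>'\<close>.\<close>
  have sW: "single \<gamma> p \<in> ?W"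
    if g: "\<gamma> \<in> interior_vertices T" and \<tau>: "\<tau> \<in> interior_edges T" "\<gamma> \<in> \<tau>"
      and p: "p \<in> edge_ideal m m' s \<tau>" for \<gamma> \<tau> p
  proof -
    have \<tau>E: "\<tau> \<in> edges T" using \<tau> by (simp add: interior_edges_def)
    have gv: "\<gamma> \<in> vertices T" using g by (simp add: interior_vertices_def)
    obtain \<gamma>' where g': "\<gamma>' \<noteq> \<gamma>" "ori \<tau> = (\<gamma>, \<gamma>') \<or> ori \<tau> = (\<gamma>', \<gamma>)"
    proof (cases "\<gamma> = fst (ori \<tau>)")
      case True
      then show ?thesis using that[of "snd (ori \<tau>)"] nondeg[OF \<tau>E] by simp
    next
      case False
      then show ?thesis using that[of "fst (ori \<tau>)"] VE[OF gv \<tau>E \<tau>(2)] by simp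
    qed
    have move: "single \<gamma> q - (if \<gamma>' \<in> interior_vertices T then single \<gamma>' q else 0) \<in> ?W"
      if q: "q \<in> edge_ideal m m' s \<tau>" for q
      using single_edge_ideal_boundary[where ori = ori, OF finE \<tau>(1) q g g'] .
    show ?thesis
    proof (cases "\<gamma>' \<in> interior_vertices T")
      case False
      then show ?thesis using move[OF p] by simp
    next
      case True
      have g't: "\<gamma>' \<in> \<tau>" using g'(2) by (subst seg[OF \<tau>E]) auto
      have gv': "\<gamma>' \<in> vertices T" using True by (simp add: interior_vertices_def)
      obtain h v where h: "h \<in> edges T" "horizontal h" "\<gamma> \<in> h"
        and v: "v \<in> edges T" "vertical v" "\<gamma> \<in> v" by (rule tmesh_vertex_edges[OF T gv])
      obtain h' v' where h': "h' \<in> edges T" "horizontal h'" "\<gamma>' \<in> h'"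
        and v': "v' \<in> edges T" "vertical v'" "\<gamma>' \<in> v'" by (rule tmesh_vertex_edges[OF T gv'])
      have bnd: "horizontal e \<Longrightarrow> real_of_int (r e) \<le> (real m' - 1) / 2"
        "vertical e \<Longrightarrow> real_of_int (r e) \<le> (real m - 1) / 2" if "e \<in> edges T" for e
        using br that unfolding bounded_smoothness_distribution_def by blast+
      have b: "real_of_int (r h) \<le> (real m' - 1) / 2" "real_of_int (r h') \<le> (real m' - 1) / 2"
        "real_of_int (r v) \<le> (real m - 1) / 2" "real_of_int (r v') \<le> (real m - 1) / 2"
        using bnd h(1,2) h'(1,2) v(1,2) v'(1,2) by blast+
      obtain e1 e2 p1 p2 where ee: "e1 = h \<and> e2 = h' \<or> e1 = v \<and> e2 = v'" and P: "p = p1 + p2"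
        "p1 \<in> edge_ideal m m' s \<tau>" "p2 \<in> edge_ideal m m' s \<tau>"
        "p1 \<in> edge_ideal m m' r e1" "p2 \<in> edge_ideal m m' r e2"
        by (rule edge_ideal_split[where r = r, OF hv_dir[OF \<tau>E] \<tau>(2) g't g'(1)[symmetric] p
          h(2) h'(2) h(3) h'(3) v(2) v'(2) v(3) v'(3) b])
      have e: "e1 \<in> edges T" "e2 \<in> edges T" "\<gamma> \<in> e1" "\<gamma>' \<in> e2" using ee h h' v v' by auto
      have 1: "single \<gamma> p1 \<in> ?W" using rW[OF g e(1,3) P(4)] .
      have 2: "single \<gamma>' p2 \<in> ?W" using rW[OF True e(2,4) P(5)] .
      have "single \<gamma> p2 - single \<gamma>' p2 \<in> ?W" using move[OF P(3)] True by simp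
      from subspace_add[OF W this 2] have "single \<gamma> p2 \<in> ?W" by simp
      from subspace_add[OF W 1 this] show ?thesis
        by (simp add: P(1) linear_add[OF linear_single])
    qed
  qed
  show ?thesis
    unfolding I_homology0_zero_iff
  proof
    fix f assume f: "f \<in> I_chains0 T m m' s"
    have "single \<gamma> (f \<gamma>) \<in> ?W" if g: "\<gamma> \<in> interior_vertices T" for \<gamma>
    proof -
      have "f \<gamma> \<in> vertex_ideal T m m' s \<gamma>" using f g by (auto simp: I_chains0_def direct_sum_def)
      then have "single \<gamma> (f \<gamma>) \<in> single \<gamma> ` span (\<Union>\<tau>\<in>{\<tau>\<in>interior_edges T. \<gamma> \<in> \<tau>}. edge_ideal m m' s \<tau>)"
        unfolding vertex_ideal_def by blast
      also have "\<dots> = span (single \<gamma> ` (\<Union>\<tau>\<in>{\<tau>\<in>interior_edges T. \<gamma> \<in> \<tau>}. edge_ideal m m' s \<tau>))"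
        by (rule linear_span_image[OF linear_single, symmetric])
      also have "\<dots> \<subseteq> ?W"
        using sW[OF g] by (intro span_minimal W) auto
      finally show ?thesis .
    qed
    then have "(\<Sum>\<gamma>\<in>interior_vertices T. single \<gamma> (f \<gamma>)) \<in> ?W" by (intro subspace_sum W)
    then show "f \<in> ?W" unfolding direct_sum_expand[OF fin0 f[unfolded I_chains0_def], symmetric] .
  qed
qed

section \<open>Coordinates of edges and faces\<close>

definition lo :: "(point \<Rightarrow> real) \<Rightarrow> point set \<Rightarrow> real" where "lo u S = Inf (u ` S)"
definition hi :: "(point \<Rightarrow> real) \<Rightarrow> point set \<Rightarrow> real" where "hi u S = Sup (u ` S)"

text \<open>The two coordinate functions in either order. Statements about \<open>u\<close> and \<open>v\<close> with \<open>axes u v\<close> cover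
  horizontal and vertical edges at once.\<close>

definition axes :: "(point \<Rightarrow> real) \<Rightarrow> (point \<Rightarrow> real) \<Rightarrow> bool" where
  "axes u v \<longleftrightarrow> u = fst \<and> v = snd \<or> u = snd \<and> v = fst"

lemma axes_sym: "axes u v \<Longrightarrow> axes v u"
  by (auto simp: axes_def)

lemma axes_fst_snd [simp]: "axes fst snd" "axes snd fst"
  by (auto simp: axes_def)

lemma axes_point: "axes u v \<Longrightarrow> \<exists>p. u p = a \<and> v p = b"
  by (auto simp: axes_def)

lemma axes_eq_iff: "axes u v \<Longrightarrow> p = q \<longleftrightarrow> u p = u q \<and> v p = v q"
  by (auto simp: axes_def prod_eq_iff)

lemma axes_continuous: "axes u v \<Longrightarrow> continuous_on A u \<and> continuous_on A v"
  by (auto simp: axes_def intro: continuous_intros)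

lemma box_coords:
  fixes a b :: point
  shows "box a b = {p. fst a < fst p \<and> fst p < fst b \<and> snd a < snd p \<and> snd p < snd b}"
    "cbox a b = {p. fst a \<le> fst p \<and> fst p \<le> fst b \<and> snd a \<le> snd p \<and> snd p \<le> snd b}"
  by (auto simp: box_def cbox_def Basis_prod_def inner_prod_def)

lemma finite_avoid:
  fixes a b :: real
  assumes "a < b" "finite X"
  obtains x where "a < x" "x < b" "x \<notin> X"
proof -
  have "infinite ({a<..<b} - X)" using assms by (simp add: Diff_infinite_finite)
  then obtain x where "x \<in> {a<..<b} - X" by (metis ex_in_conv finite.emptyI)
  then show ?thesis using that by auto
qed

text \<open>\<open>along fst snd\<close> are the horizontal and \<open>along snd fst\<close> the vertical segments.\<close>

definition along :: "(point \<Rightarrow> real) \<Rightarrow> (point \<Rightarrow> real) \<Rightarrow> point set \<Rightarrow> bool" where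
  "along u v \<tau> \<longleftrightarrow> lo u \<tau> < hi u \<tau> \<and> hi v \<tau> = lo v \<tau> \<and>
     \<tau> = {p. lo u \<tau> \<le> u p \<and> u p \<le> hi u \<tau> \<and> v p = lo v \<tau>}"

lemma alongI:
  assumes "axes u v" "\<tau> = {p. a \<le> u p \<and> u p \<le> b \<and> v p = c}" "a < b"
  shows "along u v \<tau>" "lo u \<tau> = a" "hi u \<tau> = b" "lo v \<tau> = c"
proof -
  obtain p where p: "u p = a" "v p = c" using axes_point[OF assms(1)] by blast
  have u: "u ` \<tau> = {a..b}"
  proof
    show "{a..b} \<subseteq> u ` \<tau>"
    proof
      fix x assume "x \<in> {a..b}"
      moreover obtain q where "u q = x" "v q = c" using axes_point[OF assms(1)] by blast
      ultimately show "x \<in> u ` \<tau>" using assms(2) by force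
    qed
  qed (use assms in auto)
  have v: "v ` \<tau> = {c}" using assms p by force
  show l: "lo u \<tau> = a" "hi u \<tau> = b" "lo v \<tau> = c"
    using assms(3) by (simp_all add: lo_def hi_def u v)
  have "hi v \<tau> = c" by (simp add: hi_def v)
  then show "along u v \<tau>" unfolding along_def l using assms by simp
qed

lemma along_mem:
  "along u v \<tau> \<Longrightarrow> p \<in> \<tau> \<longleftrightarrow> lo u \<tau> \<le> u p \<and> u p \<le> hi u \<tau> \<and> v p = lo v \<tau>"
  unfolding along_def by blast

lemma along_less: "along u v \<tau> \<Longrightarrow> lo u \<tau> < hi u \<tau>" "along u v \<tau> \<Longrightarrow> hi v \<tau> = lo v \<tau>"
  unfolding along_def by blast+

lemma closed_segment_horizontal:
  fixes a b :: point
  assumes "snd a = snd b" "fst a \<le> fst b"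
  shows "closed_segment a b = {p. fst a \<le> fst p \<and> fst p \<le> fst b \<and> snd p = snd a}"
proof -
  obtain a1 a2 b1 where ab: "a = (a1, a2)" "b = (b1, a2)" using assms by (metis prod.collapse)
  have "(x, y) \<in> closed_segment a b \<longleftrightarrow> y = a2 \<and> x \<in> closed_segment a1 b1" for x y
    by (auto simp: ab closed_segment_def scaleR_left_diff_distrib algebra_simps)
  moreover have "closed_segment a1 b1 = {a1..b1}" using assms by (simp add: ab closed_segment_eq_real_ivl)
  ultimately show ?thesis by (auto simp: ab)
qed

lemma closed_segment_vertical:
  fixes a b :: point
  assumes "fst a = fst b" "snd a \<le> snd b"
  shows "closed_segment a b = {p. snd a \<le> snd p \<and> snd p \<le> snd b \<and> fst p = fst a}"
proof -
  obtain a1 a2 b2 where ab: "a = (a1, a2)" "b = (a1, b2)" using assms by (metis prod.collapse)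
  have "(x, y) \<in> closed_segment a b \<longleftrightarrow> x = a1 \<and> y \<in> closed_segment a2 b2" for x y
    by (auto simp: ab closed_segment_def scaleR_left_diff_distrib algebra_simps)
  moreover have "closed_segment a2 b2 = {a2..b2}" using assms by (simp add: ab closed_segment_eq_real_ivl)
  ultimately show ?thesis by (auto simp: ab)
qed

lemma horizontal_imp_along: "horizontal \<tau> \<Longrightarrow> along fst snd \<tau>"
proof -
  assume "horizontal \<tau>"
  then obtain a b where ab: "a \<noteq> b" "snd a = snd b" "\<tau> = closed_segment a b" "fst a \<le> fst b"
    unfolding horizontal_def by (metis closed_segment_commute linorder_le_cases)
  then have "fst a < fst b" by (auto simp: prod_eq_iff)
  then show ?thesis using alongI(1)[OF axes_fst_snd(1) ab(3)[unfolded closed_segment_horizontal[OF ab(2,4)]]] by blast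
qed

lemma vertical_imp_along: "vertical \<tau> \<Longrightarrow> along snd fst \<tau>"
proof -
  assume "vertical \<tau>"
  then obtain a b where ab: "a \<noteq> b" "fst a = fst b" "\<tau> = closed_segment a b" "snd a \<le> snd b"
    unfolding vertical_def by (metis closed_segment_commute linorder_le_cases)
  then have "snd a < snd b" by (auto simp: prod_eq_iff)
  then show ?thesis using alongI(1)[OF axes_fst_snd(2) ab(3)[unfolded closed_segment_vertical[OF ab(2,4)]]] by blast
qed

text \<open>The ends of a segment, ordered by the coordinate that varies.\<close>

definition top_end :: "point set \<Rightarrow> point" where "top_end \<tau> = (hi fst \<tau>, hi snd \<tau>)"
definition bot_end :: "point set \<Rightarrow> point" where "bot_end \<tau> = (lo fst \<tau>, lo snd \<tau>)"

lemma along_segment: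
  assumes "axes u v" "along u v \<tau>"
  shows "\<tau> = closed_segment (bot_end \<tau>) (top_end \<tau>)" "bot_end \<tau> \<noteq> top_end \<tau>"
proof -
  have "\<tau> = closed_segment (bot_end \<tau>) (top_end \<tau>) \<and> bot_end \<tau> \<noteq> top_end \<tau>"
    using assms(1) unfolding axes_def
  proof (elim disjE conjE)
    assume "u = fst" "v = snd"
    then have a: "along fst snd \<tau>" using assms by simp
    have "closed_segment (bot_end \<tau>) (top_end \<tau>) = {p. lo fst \<tau> \<le> fst p \<and> fst p \<le> hi fst \<tau> \<and> snd p = lo snd \<tau>}"
      using closed_segment_horizontal[of "bot_end \<tau>" "top_end \<tau>"] along_less[OF a]
      by (simp add: bot_end_def top_end_def)
    then have "\<tau> = closed_segment (bot_end \<tau>) (top_end \<tau>)" using along_mem[OF a] by blast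
    then show ?thesis using along_less[OF a] by (simp add: bot_end_def top_end_def)
  next
    assume "u = snd" "v = fst"
    then have a: "along snd fst \<tau>" using assms by simp
    have "closed_segment (bot_end \<tau>) (top_end \<tau>) = {p. lo snd \<tau> \<le> snd p \<and> snd p \<le> hi snd \<tau> \<and> fst p = lo fst \<tau>}"
      using closed_segment_vertical[of "bot_end \<tau>" "top_end \<tau>"] along_less[OF a]
      by (simp add: bot_end_def top_end_def)
    then have "\<tau> = closed_segment (bot_end \<tau>) (top_end \<tau>)" using along_mem[OF a] by blast
    then show ?thesis using along_less[OF a] by (simp add: bot_end_def top_end_def)
  qed
  then show "\<tau> = closed_segment (bot_end \<tau>) (top_end \<tau>)" "bot_end \<tau> \<noteq> top_end \<tau>" by blast+
qed

lemma end_coords: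
  assumes "axes u v"
  shows "u (bot_end \<tau>) = lo u \<tau>" "v (bot_end \<tau>) = lo v \<tau>" "u (top_end \<tau>) = hi u \<tau>" "v (top_end \<tau>) = hi v \<tau>"
  using assms by (auto simp: axes_def bot_end_def top_end_def)

lemma along_endpoints:
  assumes "axes u v" "along u v \<tau>"
  shows "endpoints \<tau> = {bot_end \<tau>, top_end \<tau>}"
proof
  note seg = along_segment(1)[OF assms]
  show "{bot_end \<tau>, top_end \<tau>} \<subseteq> endpoints \<tau>"
    using seg closed_segment_commute unfolding endpoints_def by blast
  show "endpoints \<tau> \<subseteq> {bot_end \<tau>, top_end \<tau>}"
  proof
    fix a assume "a \<in> endpoints \<tau>"
    then obtain b where "\<tau> = closed_segment a b" by (auto simp: endpoints_def)
    then have "{a, b} = {bot_end \<tau>, top_end \<tau>}" using seg by (metis closed_segment_eq)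
    then show "a \<in> {bot_end \<tau>, top_end \<tau>}" by blast
  qed
qed

section \<open>The local geometry of a T-mesh\<close>

locale t_mesh =
  fixes T :: tmesh
  assumes is_tmesh: "is_tmesh T"
begin

lemma finite_faces: "finite (faces T)" using is_tmesh unfolding is_tmesh_def by (elim conjE)
lemma finite_edges: "finite (edges T)" using is_tmesh unfolding is_tmesh_def by (elim conjE)

lemma face_box: "\<forall>\<sigma>\<in>faces T. \<exists>a b. \<sigma> = box a b \<and> box a b \<noteq> {}"
  using is_tmesh unfolding is_tmesh_def by (elim conjE)

lemma edge_props: "\<forall>\<tau>\<in>edges T. (horizontal \<tau> \<or> vertical \<tau>) \<and> (\<exists>\<sigma>\<in>faces T. \<tau> \<subseteq> frontier \<sigma>)"
  using is_tmesh unfolding is_tmesh_def by (elim conjE)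

lemma frontier_Union: "\<forall>\<sigma>\<in>faces T. \<exists>A\<subseteq>edges T. frontier \<sigma> = \<Union>A"
  using is_tmesh unfolding is_tmesh_def by (elim conjE)

lemma faces_meet: "\<forall>\<sigma>\<in>faces T. \<forall>\<sigma>'\<in>faces T. \<sigma> \<noteq> \<sigma>' \<longrightarrow>
        closure \<sigma> \<inter> closure \<sigma>' = frontier \<sigma> \<inter> frontier \<sigma>' \<and>
        (\<exists>A\<subseteq>edges T. \<exists>B\<subseteq>vertices T. frontier \<sigma> \<inter> frontier \<sigma>' = \<Union>A \<union> B)"
  using is_tmesh unfolding is_tmesh_def by (elim conjE)

lemma edges_meet: "\<forall>\<tau>\<in>edges T. \<forall>\<tau>'\<in>edges T. \<tau> \<noteq> \<tau>' \<longrightarrow>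
        \<tau> \<inter> \<tau>' = {} \<or> (\<exists>\<gamma>\<in>vertices T. \<tau> \<inter> \<tau>' = {\<gamma>})"
  using is_tmesh unfolding is_tmesh_def by (elim conjE)

lemma vertex_edges: "\<forall>\<gamma>\<in>vertices T. (\<exists>\<tau>\<in>edges T. horizontal \<tau> \<and> \<gamma> \<in> \<tau>) \<and>
                     (\<exists>\<tau>\<in>edges T. vertical \<tau> \<and> \<gamma> \<in> \<tau>)"
  using is_tmesh unfolding is_tmesh_def by (elim conjE)

lemma edge_face:
  assumes "\<tau> \<in> edges T"
  obtains \<sigma> where "\<sigma> \<in> faces T" "\<tau> \<subseteq> closure \<sigma>"
proof -
  obtain \<sigma> where "\<sigma> \<in> faces T" "\<tau> \<subseteq> frontier \<sigma>"
    using edge_props[rule_format, OF assms] by (elim conjE bexE)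
  then show thesis using that[of \<sigma>] by (simp add: frontier_def subset_iff)
qed

lemma edge_along: "\<tau> \<in> edges T \<Longrightarrow> along fst snd \<tau> \<or> along snd fst \<tau>"
  using edge_props horizontal_imp_along vertical_imp_along by blast

lemma vertex_edge_along:
  assumes "axes u v" "\<gamma> \<in> vertices T"
  obtains \<tau> where "\<tau> \<in> edges T" "along u v \<tau>" "\<gamma> \<in> \<tau>"
proof -
  have "\<exists>\<tau>\<in>edges T. along u v \<tau> \<and> \<gamma> \<in> \<tau>"
    using assms(1) unfolding axes_def
  proof (elim disjE conjE)
    assume "u = fst" "v = snd"
    then show ?thesis using vertex_edges assms(2) horizontal_imp_along by blast
  next
    assume "u = snd" "v = fst"
    then show ?thesis using vertex_edges assms(2) vertical_imp_along by blast
  qed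
  then show thesis using that by blast
qed

lemma vertices_eq: "vertices T = (\<Union>\<tau>\<in>edges T. {bot_end \<tau>, top_end \<tau>})"
proof -
  have "endpoints \<tau> = {bot_end \<tau>, top_end \<tau>}" if "\<tau> \<in> edges T" for \<tau>
    using edge_along[OF that] along_endpoints[OF axes_fst_snd(1)] along_endpoints[OF axes_fst_snd(2)] by blast
  then show ?thesis by (simp add: vertices_def)
qed

lemma finite_vertices: "finite (vertices T)"
  unfolding vertices_eq using finite_edges by blast

lemma ends_in_vertices: "\<tau> \<in> edges T \<Longrightarrow> bot_end \<tau> \<in> vertices T" "\<tau> \<in> edges T \<Longrightarrow> top_end \<tau> \<in> vertices T"
  by (auto simp: vertices_eq)

lemma edge_segment: "\<tau> \<in> edges T \<Longrightarrow> \<tau> = closed_segment (bot_end \<tau>) (top_end \<tau>)"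
  "\<tau> \<in> edges T \<Longrightarrow> bot_end \<tau> \<noteq> top_end \<tau>"
  using edge_along along_segment[OF axes_fst_snd(1)] along_segment[OF axes_fst_snd(2)] by blast+

lemma face_coords:
  assumes "\<sigma> \<in> faces T" "axes u v"
  shows "lo u \<sigma> < hi u \<sigma>"
    "p \<in> \<sigma> \<longleftrightarrow> lo u \<sigma> < u p \<and> u p < hi u \<sigma> \<and> lo v \<sigma> < v p \<and> v p < hi v \<sigma>"
    "p \<in> closure \<sigma> \<longleftrightarrow> lo u \<sigma> \<le> u p \<and> u p \<le> hi u \<sigma> \<and> lo v \<sigma> \<le> v p \<and> v p \<le> hi v \<sigma>"
    "p \<in> frontier \<sigma> \<longleftrightarrow> p \<in> closure \<sigma> \<and> p \<notin> \<sigma>"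
    "open \<sigma>"
proof -
  obtain a b where ab: "\<sigma> = box a b" "box a b \<noteq> {}"
    using face_box[rule_format, OF assms(1)] by (elim exE conjE)
  then have l: "fst a < fst b" "snd a < snd b" by (auto simp: box_coords)
  have "fst ` \<sigma> = {fst a<..<fst b}"
  proof
    obtain y where "snd a < y" "y < snd b" using l dense by blast
    then have "(x, y) \<in> \<sigma>" if "x \<in> {fst a<..<fst b}" for x using that by (simp add: ab box_coords)
    then show "{fst a<..<fst b} \<subseteq> fst ` \<sigma>" by (metis fst_conv image_eqI subsetI)
  qed (auto simp: ab box_coords)
  then have f: "lo fst \<sigma> = fst a" "hi fst \<sigma> = fst b" using l by (simp_all add: lo_def hi_def)
  have "snd ` \<sigma> = {snd a<..<snd b}"
  proof
    obtain y where "fst a < y" "y < fst b" using l dense by blast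
    then have "(y, x) \<in> \<sigma>" if "x \<in> {snd a<..<snd b}" for x using that by (simp add: ab box_coords)
    then show "{snd a<..<snd b} \<subseteq> snd ` \<sigma>" by (metis snd_conv image_eqI subsetI)
  qed (auto simp: ab box_coords)
  then have s: "lo snd \<sigma> = snd a" "hi snd \<sigma> = snd b" using l by (simp_all add: lo_def hi_def)
  have o: "open \<sigma>" and c: "closure \<sigma> = cbox a b" using ab by (simp_all add: open_box)
  show "lo u \<sigma> < hi u \<sigma>" using assms(2) f s l by (auto simp: axes_def)
  show "p \<in> \<sigma> \<longleftrightarrow> lo u \<sigma> < u p \<and> u p < hi u \<sigma> \<and> lo v \<sigma> < v p \<and> v p < hi v \<sigma>"
    using assms(2) f s by (auto simp: axes_def ab box_coords)
  show "p \<in> closure \<sigma> \<longleftrightarrow> lo u \<sigma> \<le> u p \<and> u p \<le> hi u \<sigma> \<and> lo v \<sigma> \<le> v p \<and> v p \<le> hi v \<sigma>"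
    using assms(2) f s unfolding c by (auto simp: axes_def box_coords)
  show "p \<in> frontier \<sigma> \<longleftrightarrow> p \<in> closure \<sigma> \<and> p \<notin> \<sigma>"
    using o by (simp add: frontier_def interior_open)
  show "open \<sigma>" by (rule o)
qed

lemma faces_disjoint:
  assumes "\<sigma> \<in> faces T" "\<sigma>' \<in> faces T" "\<sigma> \<noteq> \<sigma>'"
  shows "\<sigma> \<inter> closure \<sigma>' = {}"
proof -
  have "closure \<sigma> \<inter> closure \<sigma>' = frontier \<sigma> \<inter> frontier \<sigma>'" using faces_meet assms by blast
  moreover have "frontier \<sigma> \<inter> \<sigma> = {}" using face_coords(4)[OF assms(1) axes_fst_snd(1)] by blast
  ultimately show ?thesis using closure_subset by blast
qed

text \<open>Otherwise the two open rectangles would have a common point.\<close>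

lemma faces_separated:
  assumes "\<sigma> \<in> faces T" "\<sigma>' \<in> faces T" "\<sigma> \<noteq> \<sigma>'" "axes u v"
  shows "hi u \<sigma> \<le> lo u \<sigma>' \<or> hi u \<sigma>' \<le> lo u \<sigma> \<or> hi v \<sigma> \<le> lo v \<sigma>' \<or> hi v \<sigma>' \<le> lo v \<sigma>"
proof (rule ccontr)
  assume *: "\<not> ?thesis"
  note l = face_coords(1)[OF assms(1,4)] face_coords(1)[OF assms(2,4)]
    face_coords(1)[OF assms(1) axes_sym[OF assms(4)]] face_coords(1)[OF assms(2) axes_sym[OF assms(4)]]
  have "max (lo u \<sigma>) (lo u \<sigma>') < min (hi u \<sigma>) (hi u \<sigma>')" "max (lo v \<sigma>) (lo v \<sigma>') < min (hi v \<sigma>) (hi v \<sigma>')"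
    using * l by auto
  then obtain x y where "max (lo u \<sigma>) (lo u \<sigma>') < x" "x < min (hi u \<sigma>) (hi u \<sigma>')"
    "max (lo v \<sigma>) (lo v \<sigma>') < y" "y < min (hi v \<sigma>) (hi v \<sigma>')" using dense by metis
  moreover obtain p where "u p = x" "v p = y" using axes_point[OF assms(4)] by blast
  ultimately have "p \<in> \<sigma>" "p \<in> \<sigma>'" using face_coords(2)[OF assms(1,4)] face_coords(2)[OF assms(2,4)] by auto
  then show False using faces_disjoint[OF assms(1-3)] closure_subset by blast
qed

lemma edge_face_disjoint:
  assumes "\<tau> \<in> edges T" "\<sigma> \<in> faces T"
  shows "\<tau> \<inter> \<sigma> = {}"
proof -
  obtain \<sigma>' where s: "\<sigma>' \<in> faces T" "\<tau> \<subseteq> frontier \<sigma>'" using edge_props assms by blast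
  show ?thesis
  proof (cases "\<sigma> = \<sigma>'")
    case True
    then show ?thesis using s face_coords(4)[OF assms(2) axes_fst_snd(1)] by blast
  next
    case False
    then show ?thesis using s faces_disjoint[OF assms(2) s(1)] by (auto simp: frontier_def)
  qed
qed

lemma edge_in_closure_iff:
  assumes "\<sigma> \<in> faces T" "axes u v" "along u v \<tau>"
  shows "\<tau> \<subseteq> closure \<sigma> \<longleftrightarrow> lo u \<sigma> \<le> lo u \<tau> \<and> hi u \<tau> \<le> hi u \<sigma> \<and> lo v \<sigma> \<le> lo v \<tau> \<and> lo v \<tau> \<le> hi v \<sigma>"
proof
  assume sub: "\<tau> \<subseteq> closure \<sigma>"
  note l = along_less[OF assms(3)]
  obtain p where p: "u p = lo u \<tau>" "v p = lo v \<tau>" using axes_point[OF assms(2)] by blast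
  obtain q where q: "u q = hi u \<tau>" "v q = lo v \<tau>" using axes_point[OF assms(2)] by blast
  have "p \<in> \<tau>" "q \<in> \<tau>" using p q l by (simp_all add: along_mem[OF assms(3)])
  then have "p \<in> closure \<sigma>" "q \<in> closure \<sigma>" using sub by blast+
  then show "lo u \<sigma> \<le> lo u \<tau> \<and> hi u \<tau> \<le> hi u \<sigma> \<and> lo v \<sigma> \<le> lo v \<tau> \<and> lo v \<tau> \<le> hi v \<sigma>"
    using p q by (simp add: face_coords(3)[OF assms(1,2)])
next
  assume r: "lo u \<sigma> \<le> lo u \<tau> \<and> hi u \<tau> \<le> hi u \<sigma> \<and> lo v \<sigma> \<le> lo v \<tau> \<and> lo v \<tau> \<le> hi v \<sigma>"
  show "\<tau> \<subseteq> closure \<sigma>"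
  proof
    fix p assume "p \<in> \<tau>"
    then have "lo u \<tau> \<le> u p \<and> u p \<le> hi u \<tau> \<and> v p = lo v \<tau>" using along_mem[OF assms(3)] by blast
    then show "p \<in> closure \<sigma>" using r face_coords(3)[OF assms(1,2)] by auto
  qed
qed

lemma edge_side:
  assumes "\<tau> \<in> edges T" "\<sigma> \<in> faces T" "axes u v" "along u v \<tau>" "\<tau> \<subseteq> closure \<sigma>"
  shows "lo v \<sigma> = lo v \<tau> \<or> hi v \<sigma> = lo v \<tau>"
proof (rule ccontr)
  assume n: "\<not> ?thesis"
  have c: "lo u \<sigma> \<le> lo u \<tau> \<and> hi u \<tau> \<le> hi u \<sigma> \<and> lo v \<sigma> \<le> lo v \<tau> \<and> lo v \<tau> \<le> hi v \<sigma>"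
    using edge_in_closure_iff[OF assms(2-4)] assms(5) by blast
  obtain x where x: "lo u \<tau> < x" "x < hi u \<tau>" using along_less[OF assms(4)] dense by blast
  obtain p where p: "u p = x" "v p = lo v \<tau>" using axes_point[OF assms(3)] by blast
  have "p \<in> \<tau>" using along_mem[OF assms(4)] p x by simp
  moreover have "p \<in> \<sigma>" using face_coords(2)[OF assms(2,3)] p x c n by auto
  ultimately show False using edge_face_disjoint[OF assms(1,2)] by blast
qed

lemma edge_unique:
  assumes "\<tau> \<in> edges T" "\<tau>' \<in> edges T" "p \<in> \<tau>" "p \<in> \<tau>'" "p \<notin> vertices T"
  shows "\<tau> = \<tau>'"
proof (rule ccontr)
  assume "\<tau> \<noteq> \<tau>'"
  then have "\<tau> \<inter> \<tau>' = {} \<or> (\<exists>\<gamma>\<in>vertices T. \<tau> \<inter> \<tau>' = {\<gamma>})" using edges_meet assms(1,2) by simp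
  moreover have "p \<in> \<tau> \<inter> \<tau>'" using assms(3,4) by blast
  ultimately show False using assms(5) by (metis empty_iff singletonD)
qed

lemma frontier_edge:
  assumes "\<sigma> \<in> faces T" "p \<in> frontier \<sigma>"
  obtains \<tau> where "\<tau> \<in> edges T" "p \<in> \<tau>" "\<tau> \<subseteq> frontier \<sigma>"
  using frontier_Union assms by blast

text \<open>Two faces meet in a union of edges and vertices, so away from the vertices a common point lies on a
  common edge.\<close>

lemma common_edge:
  assumes "\<sigma> \<in> faces T" "\<sigma>' \<in> faces T" "\<sigma> \<noteq> \<sigma>'" "p \<in> closure \<sigma>" "p \<in> closure \<sigma>'" "p \<notin> vertices T"
  obtains \<tau> where "\<tau> \<in> edges T" "p \<in> \<tau>" "\<tau> \<subseteq> closure \<sigma>" "\<tau> \<subseteq> closure \<sigma>'"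
proof -
  obtain A B where AB: "A \<subseteq> edges T" "B \<subseteq> vertices T" "frontier \<sigma> \<inter> frontier \<sigma>' = \<Union>A \<union> B"
    and c: "closure \<sigma> \<inter> closure \<sigma>' = frontier \<sigma> \<inter> frontier \<sigma>'"
    using faces_meet assms(1-3) by meson
  have "p \<in> \<Union>A" using AB c assms by blast
  then obtain \<tau> where t: "\<tau> \<in> A" "p \<in> \<tau>" by blast
  then have "\<tau> \<subseteq> closure \<sigma> \<inter> closure \<sigma>'" using AB c by blast
  then show thesis using that[of \<tau>] t AB by blast
qed

text \<open>A vertex \<open>\<gamma>\<close> inside \<open>\<tau>\<close> would lie on an edge perpendicular to \<open>\<tau>\<close>. The face \<open>\<sigma>2\<close> beside the
  perpendicular edge and the face \<open>\<sigma>1\<close> beside \<open>\<tau>\<close> do not overlap, so \<open>\<gamma>\<close> is a corner of \<open>\<sigma>2\<close> and both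
  faces contain a short piece of \<open>\<tau>\<close> starting at \<open>\<gamma>\<close>. The common edge there can only be \<open>\<tau>\<close>
  itself, but \<open>\<tau>\<close> continues beyond the corner.\<close>

lemma vertex_not_inside_edge:
  assumes "\<tau> \<in> edges T" "axes u v" "along u v \<tau>" "\<gamma> \<in> vertices T" "\<gamma> \<in> \<tau>"
    and inner: "lo u \<tau> < u \<gamma>" "u \<gamma> < hi u \<tau>"
  shows False
proof -
  note sy = axes_sym[OF assms(2)]
  obtain \<tau>2 where t2: "\<tau>2 \<in> edges T" "along v u \<tau>2" "\<gamma> \<in> \<tau>2" by (rule vertex_edge_along[OF sy assms(4)])
  obtain \<sigma>1 where s1: "\<sigma>1 \<in> faces T" "\<tau> \<subseteq> closure \<sigma>1" by (rule edge_face[OF assms(1)])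
  obtain \<sigma>2 where s2: "\<sigma>2 \<in> faces T" "\<tau>2 \<subseteq> closure \<sigma>2" by (rule edge_face[OF t2(1)])
  have g1: "v \<gamma> = lo v \<tau>" using along_mem[OF assms(3)] assms(5) by blast
  have g2: "u \<gamma> = lo u \<tau>2" "lo v \<tau>2 \<le> v \<gamma>" "v \<gamma> \<le> hi v \<tau>2" using along_mem[OF t2(2)] t2(3) by blast+
  have c1: "lo u \<sigma>1 \<le> lo u \<tau>" "hi u \<tau> \<le> hi u \<sigma>1" "lo v \<sigma>1 \<le> lo v \<tau>" "lo v \<tau> \<le> hi v \<sigma>1"
    using edge_in_closure_iff[OF s1(1) assms(2,3)] s1(2) by blast+
  have c2: "lo v \<sigma>2 \<le> lo v \<tau>2" "hi v \<tau>2 \<le> hi v \<sigma>2" "lo u \<sigma>2 \<le> lo u \<tau>2" "lo u \<tau>2 \<le> hi u \<sigma>2"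
    using edge_in_closure_iff[OF s2(1) sy t2(2)] s2(2) by blast+
  have e1: "lo v \<sigma>1 = v \<gamma> \<or> hi v \<sigma>1 = v \<gamma>" using edge_side[OF assms(1) s1(1) assms(2,3) s1(2)] g1 by simp
  have e2: "lo u \<sigma>2 = u \<gamma> \<or> hi u \<sigma>2 = u \<gamma>" using edge_side[OF t2(1) s2(1) sy t2(2) s2(2)] g2 by simp
  have ne: "\<sigma>1 \<noteq> \<sigma>2" using c1 e2 inner by auto
  note l = face_coords(1)[OF s1(1) assms(2)] face_coords(1)[OF s2(1) assms(2)]
    face_coords(1)[OF s1(1) sy] face_coords(1)[OF s2(1) sy]
  \<comment> \<open>The interval next to \<open>u \<gamma>\<close> over which \<open>\<tau>\<close> runs along the side of \<open>\<sigma>2\<close>.\<close>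
  have "\<exists>a b. a < b \<and> (\<forall>x. a < x \<and> x < b \<longrightarrow> lo u \<tau> < x \<and> x < hi u \<tau> \<and> lo u \<sigma>2 < x \<and> x < hi u \<sigma>2)"
    using e2
  proof
    assume "lo u \<sigma>2 = u \<gamma>"
    then show ?thesis using l inner by (intro exI[of _ "u \<gamma>"] exI[of _ "min (hi u \<sigma>2) (hi u \<tau>)"]) auto
  next
    assume "hi u \<sigma>2 = u \<gamma>"
    then show ?thesis using l inner by (intro exI[of _ "max (lo u \<sigma>2) (lo u \<tau>)"] exI[of _ "u \<gamma>"]) auto
  qed
  then obtain a b where ab: "a < b" "\<And>x. a < x \<Longrightarrow> x < b \<Longrightarrow> lo u \<tau> < x \<and> x < hi u \<tau> \<and> lo u \<sigma>2 < x \<and> x < hi u \<sigma>2"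
    by blast
  obtain x where "a < x" "x < b" "x \<notin> u ` vertices T"
    using finite_avoid[OF ab(1), of "u ` vertices T"] finite_vertices by blast
  then have x: "lo u \<tau> < x" "x < hi u \<tau>" "lo u \<sigma>2 < x" "x < hi u \<sigma>2" "x \<notin> u ` vertices T"
    using ab(2) by blast+
  obtain p where p: "u p = x" "v p = v \<gamma>" using axes_point[OF assms(2)] by blast
  have pv: "p \<notin> vertices T" using p x by blast
  have pt: "p \<in> \<tau>" using along_mem[OF assms(3)] p x g1 by simp
  have "p \<in> closure \<sigma>1" using pt s1 by blast
  moreover have "p \<in> closure \<sigma>2"
    using face_coords(3)[OF s2(1) assms(2)] p x g2 c2 by simp
  ultimately obtain \<tau>' where "\<tau>' \<in> edges T" "p \<in> \<tau>'" "\<tau>' \<subseteq> closure \<sigma>2"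
    by (rule common_edge[OF s1(1) s2(1) ne _ _ pv])
  with edge_unique[OF assms(1) _ pt _ pv] have "\<tau> \<subseteq> closure \<sigma>2" by blast
  then have "lo u \<sigma>2 \<le> lo u \<tau>" "hi u \<tau> \<le> hi u \<sigma>2" using edge_in_closure_iff[OF s2(1) assms(2,3)] by blast+
  then show False using e2 inner by auto
qed

lemma vertex_in_edge:
  assumes "\<gamma> \<in> vertices T" "\<tau> \<in> edges T" "\<gamma> \<in> \<tau>"
  shows "\<gamma> = bot_end \<tau> \<or> \<gamma> = top_end \<tau>"
proof -
  obtain u v where uv: "axes u v" "along u v \<tau>" using edge_along[OF assms(2)] axes_fst_snd by blast
  have "lo u \<tau> \<le> u \<gamma> \<and> u \<gamma> \<le> hi u \<tau> \<and> v \<gamma> = lo v \<tau>" using along_mem[OF uv(2)] assms(3) by blast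
  moreover have "\<not> (lo u \<tau> < u \<gamma> \<and> u \<gamma> < hi u \<tau>)"
    using vertex_not_inside_edge[OF assms(2) uv assms(1,3)] by blast
  ultimately show ?thesis
    using along_less[OF uv(2)] by (auto simp: axes_eq_iff[OF uv(1)] end_coords[OF uv(1)])
qed

end

section \<open>Jumps across edges\<close>

text \<open>If the intervals \<open>(l i, h i)\<close> tile \<open>(a, b)\<close> up to finitely many points, their end points cancel
  except for \<open>a\<close> and \<open>b\<close>: compare the number of intervals that contain a point just before and just
  after \<open>g\<close>.\<close>

lemma tiling_ends:
  fixes l h :: "'i \<Rightarrow> real"
  assumes I: "finite I" "\<And>i. i \<in> I \<Longrightarrow> l i < h i" and ab: "a < b" and X: "finite X"
    and tile: "\<And>x. x \<notin> X \<Longrightarrow> (\<Sum>i\<in>I. of_bool (l i < x \<and> x < h i)) = (of_bool (a < x \<and> x < b) :: real)"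
  shows "(\<Sum>i\<in>I. of_bool (h i = g) - of_bool (l i = g)) = (of_bool (b = g) - of_bool (a = g) :: real)"
proof -
  define Z where "Z = X \<union> l ` I \<union> h ` I \<union> {a, b}"
  have "finite Z" using I X by (simp add: Z_def)
  then obtain d where d: "d > 0" "\<And>z. z \<in> Z \<Longrightarrow> z \<noteq> g \<Longrightarrow> d \<le> dist g z"
    using finite_set_avoid[of Z g] by blast
  \<comment> \<open>Half the distance from \<open>g\<close> to the nearest other end point or exceptional point.\<close>
  define e where "e = d / 2"
  have e: "e > 0" "\<And>z. z \<in> Z \<Longrightarrow> z = g \<or> z + e < g \<or> g + e < z"
    using d by (fastforce simp: e_def dist_real_def)+
  have gX: "g - e \<notin> X" "g + e \<notin> X" using e by (force simp: Z_def)+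
  have key: "of_bool (p < g - e \<and> g - e < q) - of_bool (p < g + e \<and> g + e < q)
     = (of_bool (q = g) - of_bool (p = g) :: real)" if "p \<in> Z" "q \<in> Z" "p < q" for p q
    using e(2)[OF that(1)] e(2)[OF that(2)] e(1) that(3) by auto
  have "(\<Sum>i\<in>I. of_bool (h i = g) - of_bool (l i = g)) =
    (\<Sum>i\<in>I. of_bool (l i < g - e \<and> g - e < h i) - of_bool (l i < g + e \<and> g + e < h i) :: real)"
    using I by (intro sum.cong refl key[symmetric]) (auto simp: Z_def)
  also have "\<dots> = of_bool (a < g - e \<and> g - e < b) - of_bool (a < g + e \<and> g + e < b)"
    by (simp only: sum_subtractf tile[OF gX(1)] tile[OF gX(2)])
  also have "\<dots> = of_bool (b = g) - of_bool (a = g)"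
    using ab by (intro key) (auto simp: Z_def)
  finally show ?thesis .
qed

text \<open>The incidence number for the orientation of every edge from \<open>bot_end\<close> to \<open>top_end\<close>.\<close>

definition end_sign :: "point set \<Rightarrow> point \<Rightarrow> real" where
  "end_sign \<tau> \<gamma> = of_bool (\<gamma> = top_end \<tau>) - of_bool (\<gamma> = bot_end \<tau>)"

lemma end_sign_along:
  assumes "axes u v" "along u v \<tau>"
  shows "end_sign \<tau> \<gamma> = of_bool (lo v \<tau> = v \<gamma>) * (of_bool (hi u \<tau> = u \<gamma>) - of_bool (lo u \<tau> = u \<gamma>))"
  using along_less(2)[OF assms(2)]
  by (auto simp: end_sign_def axes_eq_iff[OF assms(1)] end_coords[OF assms(1)])

text \<open>A face beside an edge that runs along the first axis is above or below it with respect to the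
  transverse coordinate \<open>v\<close>.\<close>

definition above :: "(point \<Rightarrow> real) \<Rightarrow> point set \<Rightarrow> point set \<Rightarrow> bool" where
  "above v \<tau> \<sigma> \<longleftrightarrow> \<tau> \<subseteq> closure \<sigma> \<and> lo v \<sigma> = lo v \<tau>"

definition below :: "(point \<Rightarrow> real) \<Rightarrow> point set \<Rightarrow> point set \<Rightarrow> bool" where
  "below v \<tau> \<sigma> \<longleftrightarrow> \<tau> \<subseteq> closure \<sigma> \<and> hi v \<sigma> = lo v \<tau>"

text \<open>The incidence number of an edge and a face: positive if the face lies to the left of the edge, seen
  in the direction from \<open>bot_end\<close> to \<open>top_end\<close>. For a vertical edge the left is where \<open>fst\<close> is smaller.\<close>

definition face_sign :: "point set \<Rightarrow> point set \<Rightarrow> real" where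
  "face_sign \<tau> \<sigma> = (if along fst snd \<tau> then of_bool (above snd \<tau> \<sigma>) - of_bool (below snd \<tau> \<sigma>)
     else of_bool (below fst \<tau> \<sigma>) - of_bool (above fst \<tau> \<sigma>))"

definition coboundary :: "tmesh \<Rightarrow> (point set \<Rightarrow> 'b::real_vector) \<Rightarrow> point set \<Rightarrow> 'b" where
  "coboundary T f \<tau> = (\<Sum>\<sigma>\<in>faces T. face_sign \<tau> \<sigma> *\<^sub>R f \<sigma>)"

context t_mesh begin

lemma closed_domain: "closed (domain T)"
  unfolding domain_def using finite_faces by blast

lemma interior_closure_face: "\<sigma> \<in> faces T \<Longrightarrow> interior (closure \<sigma>) = \<sigma>"
proof -
  assume "\<sigma> \<in> faces T"
  then obtain a b where ab: "\<sigma> = box a b" "box a b \<noteq> {}"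
    using face_box[rule_format] by (metis (no_types))
  then have "closure \<sigma> = cbox a b" by simp
  then show ?thesis using ab(1) by simp
qed

lemma not_along_both: "axes u v \<Longrightarrow> along u v \<tau> \<Longrightarrow> \<not> along v u \<tau>"
  using along_less by fastforce

lemma edge_beside:
  assumes "\<tau> \<in> edges T" "\<sigma> \<in> faces T" "axes u v" "along u v \<tau>" "\<tau> \<subseteq> closure \<sigma>"
  shows "above v \<tau> \<sigma> \<or> below v \<tau> \<sigma>"
  using edge_side[OF assms] assms(5) by (auto simp: above_def below_def)

lemma above_unique:
  assumes "\<tau> \<in> edges T" "\<sigma> \<in> faces T" "\<sigma>' \<in> faces T" "axes u v" "along u v \<tau>"
    and ab: "above v \<tau> \<sigma> \<and> above v \<tau> \<sigma>' \<or> below v \<tau> \<sigma> \<and> below v \<tau> \<sigma>'"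
  shows "\<sigma> = \<sigma>'"
proof (rule ccontr)
  assume ne: "\<sigma> \<noteq> \<sigma>'"
  have "\<tau> \<subseteq> closure \<sigma>" "\<tau> \<subseteq> closure \<sigma>'" using ab by (auto simp: above_def below_def)
  then have c: "lo u \<sigma> \<le> lo u \<tau>" "hi u \<tau> \<le> hi u \<sigma>" "lo u \<sigma>' \<le> lo u \<tau>" "hi u \<tau> \<le> hi u \<sigma>'"
    using edge_in_closure_iff[OF assms(2,4,5)] edge_in_closure_iff[OF assms(3,4,5)] by auto
  have "lo v \<sigma> = lo v \<sigma>' \<or> hi v \<sigma> = hi v \<sigma>'" using ab by (auto simp: above_def below_def)
  moreover note face_coords(1)[OF assms(2) axes_sym[OF assms(4)]] face_coords(1)[OF assms(3) axes_sym[OF assms(4)]]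
    along_less(1)[OF assms(5)]
  ultimately show False using c faces_separated[OF assms(2,3) ne assms(4)] by auto
qed

text \<open>Near an interior point of the domain that lies on \<open>\<tau>\<close>, one closed face alone cannot cover a
  neighbourhood, so there is a second face, which shares the whole of \<open>\<tau>\<close>. Being disjoint, the two
  faces lie on different sides of \<open>\<tau>\<close>.\<close>

lemma interior_edge_faces:
  assumes "\<tau> \<in> interior_edges T" "axes u v" "along u v \<tau>"
  obtains \<sigma>p \<sigma>m where "\<sigma>p \<in> faces T" "\<sigma>m \<in> faces T" "above v \<tau> \<sigma>p" "below v \<tau> \<sigma>m"
proof -
  have tE: "\<tau> \<in> edges T" using assms by (simp add: interior_edges_def)
  obtain p where p: "p \<in> \<tau>" "p \<in> interior (domain T)" using assms by (auto simp: interior_edges_def)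
  then obtain e where e: "e > 0" "ball p e \<subseteq> interior (domain T)"
    using open_contains_ball open_interior by blast
  have pu: "lo u \<tau> \<le> u p" "u p \<le> hi u \<tau>" "v p = lo v \<tau>" using p along_mem[OF assms(3)] by blast+
  \<comment> \<open>The given point \<open>p\<close> may be an end of \<open>\<tau>\<close>; a nearby point \<open>q\<close> of \<open>\<tau>\<close> is not a vertex.\<close>
  have "max (lo u \<tau>) (u p - e) < min (hi u \<tau>) (u p + e)" using pu e along_less(1)[OF assms(3)] by auto
  then obtain x where "max (lo u \<tau>) (u p - e) < x" "x < min (hi u \<tau>) (u p + e)" "x \<notin> u ` vertices T"
    by (rule finite_avoid[OF _ finite_imageI[OF finite_vertices]])
  then have x: "lo u \<tau> < x" "x < hi u \<tau>" "\<bar>x - u p\<bar> < e" "x \<notin> u ` vertices T" by auto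
  obtain q where q: "u q = x" "v q = lo v \<tau>" using axes_point[OF assms(2)] by blast
  have "dist p q < e" using q x pu assms(2) by (auto simp: axes_def dist_prod_def dist_real_def)
  then have qi: "q \<in> interior (domain T)" using e by auto
  have qt: "q \<in> \<tau>" using q x along_mem[OF assms(3)] by simp
  have qv: "q \<notin> vertices T" using q x by blast
  obtain \<sigma>1 where s1: "\<sigma>1 \<in> faces T" "\<tau> \<subseteq> closure \<sigma>1" by (rule edge_face[OF tE])
  have "\<exists>\<sigma>2\<in>faces T. \<sigma>2 \<noteq> \<sigma>1 \<and> q \<in> closure \<sigma>2"
  proof (rule ccontr)
    assume n: "\<not> ?thesis"
    \<comment> \<open>If no other closed face contained \<open>q\<close>, a neighbourhood of \<open>q\<close> would be covered by \<open>\<sigma>1\<close>.\<close>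
    define U where "U = interior (domain T) - (\<Union>\<sigma>\<in>faces T - {\<sigma>1}. closure \<sigma>)"
    have "open U" unfolding U_def using finite_faces by (intro open_Diff open_interior closed_UN) auto
    moreover have "q \<in> U" using n qi by (auto simp: U_def)
    moreover have "U \<subseteq> closure \<sigma>1" using interior_subset[of "domain T"] by (auto simp: U_def domain_def)
    ultimately have "q \<in> interior (closure \<sigma>1)" by (rule interiorI)
    then show False using interior_closure_face[OF s1(1)] edge_face_disjoint[OF tE s1(1)] qt by auto
  qed
  then obtain \<sigma>2 where s2: "\<sigma>2 \<in> faces T" "\<sigma>2 \<noteq> \<sigma>1" "q \<in> closure \<sigma>2" by blast
  have "q \<in> closure \<sigma>1" using s1 qt by blast
  then obtain \<tau>' where t': "\<tau>' \<in> edges T" "q \<in> \<tau>'" "\<tau>' \<subseteq> closure \<sigma>2"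
    by (rule common_edge[OF s1(1) s2(1) s2(2)[symmetric] _ s2(3) qv])
  then have t2: "\<tau> \<subseteq> closure \<sigma>2" using edge_unique[OF tE t'(1) qt t'(2) qv] by simp
  have 1: "above v \<tau> \<sigma>1 \<or> below v \<tau> \<sigma>1" by (rule edge_beside[OF tE s1(1) assms(2,3) s1(2)])
  have 2: "above v \<tau> \<sigma>2 \<or> below v \<tau> \<sigma>2" by (rule edge_beside[OF tE s2(1) assms(2,3) t2])
  show thesis using 1 2 above_unique[OF tE s1(1) s2(1) assms(2,3)] s1(1) s2(1,2) that by blast
qed

lemma not_above_below:
  assumes "\<sigma> \<in> faces T" "axes u v" shows "\<not> (above v \<tau> \<sigma> \<and> below v \<tau> \<sigma>)"
  using face_coords(1)[OF assms(1) axes_sym[OF assms(2)]] by (auto simp: above_def below_def)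

lemma coboundary_two_faces:
  assumes "\<tau> \<in> edges T" "\<sigma>p \<in> faces T" "\<sigma>m \<in> faces T"
    "axes u v" "along u v \<tau>" "above v \<tau> \<sigma>p" "below v \<tau> \<sigma>m"
  shows "coboundary T f \<tau> = (if u = fst then 1 else -1) *\<^sub>R (f \<sigma>p - f \<sigma>m)"
proof -
  have ne: "\<sigma>p \<noteq> \<sigma>m" using not_above_below[OF assms(2,4)] assms by blast
  have fs: "(fst :: point \<Rightarrow> real) \<noteq> snd" by (metis fst_conv snd_conv zero_neq_one)
  have a: "above v \<tau> \<sigma> \<longleftrightarrow> \<sigma> = \<sigma>p" "below v \<tau> \<sigma> \<longleftrightarrow> \<sigma> = \<sigma>m" if "\<sigma> \<in> faces T" for \<sigma>
    using above_unique[OF assms(1) that assms(2,4,5)] above_unique[OF assms(1) that assms(3,4,5)] assms(6,7) by blast+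
  define k :: real where "k = (if u = fst then 1 else -1)"
  have "face_sign \<tau> \<sigma> = k * (of_bool (above v \<tau> \<sigma>) - of_bool (below v \<tau> \<sigma>))" for \<sigma>
    using assms(4) unfolding axes_def
  proof (elim disjE conjE)
    assume "u = fst" "v = snd"
    then show ?thesis using assms(5) by (simp add: face_sign_def k_def)
  next
    assume uv: "u = snd" "v = fst"
    then have "\<not> along fst snd \<tau>" using not_along_both[OF assms(4,5)] by simp
    then show ?thesis using uv fs by (simp add: face_sign_def k_def fs[symmetric])
  qed
  then have "coboundary T f \<tau> = (\<Sum>\<sigma>\<in>faces T. (if \<sigma> = \<sigma>p then k *\<^sub>R f \<sigma> else 0) + (if \<sigma> = \<sigma>m then - (k *\<^sub>R f \<sigma>) else 0))"
    unfolding coboundary_def by (intro sum.cong refl) (auto simp: a ne)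
  also have "\<dots> = k *\<^sub>R f \<sigma>p - k *\<^sub>R f \<sigma>m"
    using assms(2,3) finite_faces by (simp add: sum.distrib)
  finally show ?thesis by (simp add: k_def scaleR_right_diff_distrib)
qed

text \<open>Off the vertices every point of a side of a face lies on exactly one edge.\<close>

lemma side_tiled:
  assumes "\<sigma> \<in> faces T" "axes u v" "c = lo v \<sigma> \<or> c = hi v \<sigma>" "x \<notin> u ` vertices T"
  shows "(\<Sum>\<tau>\<in>{\<tau>\<in>edges T. along u v \<tau> \<and> \<tau> \<subseteq> closure \<sigma> \<and> lo v \<tau> = c}. of_bool (lo u \<tau> < x \<and> x < hi u \<tau>))
    = (of_bool (lo u \<sigma> < x \<and> x < hi u \<sigma>) :: real)"
proof -
  let ?S = "{\<tau>\<in>edges T. along u v \<tau> \<and> \<tau> \<subseteq> closure \<sigma> \<and> lo v \<tau> = c}"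
  have fin: "finite ?S" using finite_edges by simp
  show ?thesis
  proof (cases "lo u \<sigma> < x \<and> x < hi u \<sigma>")
    case False
    have "\<not> (lo u \<tau> < x \<and> x < hi u \<tau>)" if "\<tau> \<in> ?S" for \<tau>
      using that False edge_in_closure_iff[OF assms(1,2), of \<tau>] by auto
    then show ?thesis using False by (simp add: sum.neutral)
  next
    case True
    note sy = axes_sym[OF assms(2)]
    obtain p where p: "u p = x" "v p = c" using axes_point[OF assms(2)] by blast
    have "p \<in> closure \<sigma>" "p \<notin> \<sigma>"
      using True p assms(3) face_coords(1)[OF assms(1) sy] face_coords(2,3)[OF assms(1,2), of p] by auto
    then have pf: "p \<in> frontier \<sigma>" using face_coords(4)[OF assms(1,2)] by blast
    have pv: "p \<notin> vertices T" using assms(4) p by blast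
    obtain \<tau> where t: "\<tau> \<in> edges T" "p \<in> \<tau>" "\<tau> \<subseteq> frontier \<sigma>" by (rule frontier_edge[OF assms(1) pf])
    have tc: "\<tau> \<subseteq> closure \<sigma>" using t(3) by (simp add: frontier_def subset_iff)
    have "along u v \<tau> \<or> along v u \<tau>" using edge_along[OF t(1)] assms(2) by (auto simp: axes_def)
    moreover have "\<not> along v u \<tau>"
    proof
      assume a: "along v u \<tau>"
      have "lo u \<tau> = x" using t(2) along_mem[OF a] p by simp
      then show False using edge_side[OF t(1) assms(1) sy a tc] True by auto
    qed
    ultimately have a: "along u v \<tau>" by blast
    have tS: "\<tau> \<in> ?S" using t a tc p along_mem[OF a] by simp
    have "of_bool (lo u \<tau>' < x \<and> x < hi u \<tau>') = (if \<tau>' = \<tau> then 1 else 0 :: real)" if "\<tau>' \<in> ?S" for \<tau>'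
    proof -
      have t': "\<tau>' \<in> edges T" "along u v \<tau>'" "lo v \<tau>' = c" using that by auto
      have "p \<in> \<tau>'" if "lo u \<tau>' < x" "x < hi u \<tau>'" using that along_mem[OF t'(2)] p t'(3) by simp
      then have 1: "lo u \<tau>' < x \<Longrightarrow> x < hi u \<tau>' \<Longrightarrow> \<tau>' = \<tau>"
        using edge_unique[OF t'(1) t(1) _ t(2) pv] by blast
      have "lo u \<tau> \<le> x" "x \<le> hi u \<tau>" using along_mem[OF a] t(2) p by auto
      moreover have "lo u \<tau> \<noteq> x" "hi u \<tau> \<noteq> x"
        using assms(4) imageI[OF ends_in_vertices(1)[OF t(1)], of u] imageI[OF ends_in_vertices(2)[OF t(1)], of u]
        unfolding end_coords[OF assms(2)] by metis+
      ultimately have "lo u \<tau> < x" "x < hi u \<tau>" by auto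
      then have 2: "lo u \<tau> < x \<and> x < hi u \<tau>" by simp
      show ?thesis
      proof (cases "\<tau>' = \<tau>")
        case True
        show ?thesis unfolding True using 2 by simp
      next
        case False
        then have "\<not> (lo u \<tau>' < x \<and> x < hi u \<tau>')" using 1 by blast
        then show ?thesis using False by simp
      qed
    qed
    then have "(\<Sum>\<tau>\<in>?S. of_bool (lo u \<tau> < x \<and> x < hi u \<tau>)) = (\<Sum>\<tau>'\<in>?S. if \<tau>' = \<tau> then 1 else 0 :: real)"
      by (rule sum.cong[OF refl])
    also have "\<dots> = 1" using tS fin by simp
    finally show ?thesis using True by simp
  qed
qed

lemma side_ends:
  assumes "\<sigma> \<in> faces T" "axes u v" "c = lo v \<sigma> \<or> c = hi v \<sigma>"
  shows "(\<Sum>\<tau>\<in>{\<tau>\<in>edges T. along u v \<tau> \<and> \<tau> \<subseteq> closure \<sigma> \<and> lo v \<tau> = c}. end_sign \<tau> \<gamma>)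
    = of_bool (c = v \<gamma>) * (of_bool (hi u \<sigma> = u \<gamma>) - of_bool (lo u \<sigma> = u \<gamma>))"
proof -
  let ?S = "{\<tau>\<in>edges T. along u v \<tau> \<and> \<tau> \<subseteq> closure \<sigma> \<and> lo v \<tau> = c}"
  have "(\<Sum>\<tau>\<in>?S. end_sign \<tau> \<gamma>) = (\<Sum>\<tau>\<in>?S. of_bool (c = v \<gamma>) * (of_bool (hi u \<tau> = u \<gamma>) - of_bool (lo u \<tau> = u \<gamma>)))"
    by (rule sum.cong) (auto simp: end_sign_along[OF assms(2)])
  also have "\<dots> = of_bool (c = v \<gamma>) * (\<Sum>\<tau>\<in>?S. of_bool (hi u \<tau> = u \<gamma>) - of_bool (lo u \<tau> = u \<gamma>))"
    by (simp add: sum_distrib_left)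
  also have "(\<Sum>\<tau>\<in>?S. of_bool (hi u \<tau> = u \<gamma>) - of_bool (lo u \<tau> = u \<gamma>)) =
     (of_bool (hi u \<sigma> = u \<gamma>) - of_bool (lo u \<sigma> = u \<gamma>) :: real)"
    by (rule tiling_ends[where X = "u ` vertices T"])
       (use finite_edges finite_vertices along_less face_coords(1)[OF assms(1,2)] side_tiled[OF assms] in auto)
  finally show ?thesis .
qed

text \<open>The contribution of the two sides of \<open>\<sigma>\<close> along \<open>u\<close>: only the corners of \<open>\<sigma>\<close> remain. The right-hand side
  is symmetric in \<open>u\<close> and \<open>v\<close>, which makes the horizontal and the vertical sides cancel.\<close>

lemma face_boundary_part:
  assumes "\<sigma> \<in> faces T" "axes u v"
  shows "(\<Sum>\<tau>\<in>{\<tau>\<in>edges T. along u v \<tau>}. end_sign \<tau> \<gamma> * (of_bool (above v \<tau> \<sigma>) - of_bool (below v \<tau> \<sigma>)))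
    = (of_bool (lo v \<sigma> = v \<gamma>) - of_bool (hi v \<sigma> = v \<gamma>)) * (of_bool (hi u \<sigma> = u \<gamma>) - of_bool (lo u \<sigma> = u \<gamma>))"
proof -
  let ?A = "{\<tau>\<in>edges T. along u v \<tau>}"
  have fin: "finite ?A" using finite_edges by simp
  have "(\<Sum>\<tau>\<in>?A. end_sign \<tau> \<gamma> * (of_bool (above v \<tau> \<sigma>) - of_bool (below v \<tau> \<sigma>))) =
     (\<Sum>\<tau>\<in>?A. end_sign \<tau> \<gamma> * of_bool (above v \<tau> \<sigma>)) - (\<Sum>\<tau>\<in>?A. end_sign \<tau> \<gamma> * of_bool (below v \<tau> \<sigma>))"
    by (simp add: right_diff_distrib sum_subtractf)
  also have "(\<Sum>\<tau>\<in>?A. end_sign \<tau> \<gamma> * of_bool (above v \<tau> \<sigma>)) =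
     (\<Sum>\<tau>\<in>{\<tau>\<in>edges T. along u v \<tau> \<and> \<tau> \<subseteq> closure \<sigma> \<and> lo v \<tau> = lo v \<sigma>}. end_sign \<tau> \<gamma>)"
    using fin by (intro sum.mono_neutral_cong_right) (auto simp: above_def)
  also have "(\<Sum>\<tau>\<in>?A. end_sign \<tau> \<gamma> * of_bool (below v \<tau> \<sigma>)) =
     (\<Sum>\<tau>\<in>{\<tau>\<in>edges T. along u v \<tau> \<and> \<tau> \<subseteq> closure \<sigma> \<and> lo v \<tau> = hi v \<sigma>}. end_sign \<tau> \<gamma>)"
    using fin by (intro sum.mono_neutral_cong_right) (auto simp: below_def)
  finally show ?thesis by (simp add: side_ends[OF assms] left_diff_distrib)
qed

lemma face_boundary_closed:
  assumes "\<sigma> \<in> faces T"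
  shows "(\<Sum>\<tau>\<in>edges T. end_sign \<tau> \<gamma> * face_sign \<tau> \<sigma>) = 0"
proof -
  let ?H = "{\<tau>\<in>edges T. along fst snd \<tau>}" and ?V = "{\<tau>\<in>edges T. along snd fst \<tau>}"
  have "edges T = ?H \<union> ?V" using edge_along by blast
  moreover have dis: "?H \<inter> ?V = {}" using not_along_both[OF axes_fst_snd(1)] by blast
  ultimately have "(\<Sum>\<tau>\<in>edges T. end_sign \<tau> \<gamma> * face_sign \<tau> \<sigma>) =
     (\<Sum>\<tau>\<in>?H. end_sign \<tau> \<gamma> * face_sign \<tau> \<sigma>) + (\<Sum>\<tau>\<in>?V. end_sign \<tau> \<gamma> * face_sign \<tau> \<sigma>)"
    using finite_edges by (metis (no_types, lifting) sum.union_disjoint finite_Un)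
  also have "(\<Sum>\<tau>\<in>?H. end_sign \<tau> \<gamma> * face_sign \<tau> \<sigma>) =
     (\<Sum>\<tau>\<in>?H. end_sign \<tau> \<gamma> * (of_bool (above snd \<tau> \<sigma>) - of_bool (below snd \<tau> \<sigma>)))"
    by (rule sum.cong) (auto simp: face_sign_def)
  also have "(\<Sum>\<tau>\<in>?V. end_sign \<tau> \<gamma> * face_sign \<tau> \<sigma>) =
     - (\<Sum>\<tau>\<in>?V. end_sign \<tau> \<gamma> * (of_bool (above fst \<tau> \<sigma>) - of_bool (below fst \<tau> \<sigma>)))"
    unfolding sum_negf[symmetric]
    using not_along_both[OF axes_fst_snd(2)] by (intro sum.cong refl) (auto simp: face_sign_def)
  finally show ?thesis
    unfolding face_boundary_part[OF assms axes_fst_snd(1)] face_boundary_part[OF assms axes_fst_snd(2)]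
    by (simp add: algebra_simps)
qed

text \<open>By linearity it is enough to sum over the boundary of each face separately.\<close>

lemma boundary_coboundary:
  "(\<Sum>\<tau>\<in>edges T. end_sign \<tau> \<gamma> *\<^sub>R coboundary T f \<tau>) = 0"
proof -
  have "(\<Sum>\<tau>\<in>edges T. end_sign \<tau> \<gamma> *\<^sub>R coboundary T f \<tau>) =
    (\<Sum>\<tau>\<in>edges T. \<Sum>\<sigma>\<in>faces T. (end_sign \<tau> \<gamma> * face_sign \<tau> \<sigma>) *\<^sub>R f \<sigma>)"
    by (simp add: coboundary_def scaleR_sum_right)
  also have "\<dots> = (\<Sum>\<sigma>\<in>faces T. \<Sum>\<tau>\<in>edges T. (end_sign \<tau> \<gamma> * face_sign \<tau> \<sigma>) *\<^sub>R f \<sigma>)"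
    by (rule sum.swap)
  also have "\<dots> = (\<Sum>\<sigma>\<in>faces T. (\<Sum>\<tau>\<in>edges T. end_sign \<tau> \<gamma> * face_sign \<tau> \<sigma>) *\<^sub>R f \<sigma>)"
    by (simp only: scaleR_sum_left)
  also have "\<dots> = 0" by (simp add: face_boundary_closed)
  finally show ?thesis .
qed


section \<open>Potentials of flows without sources\<close>

text \<open>Minus the total weight of the vertical edges that the ray from \<open>(x, y)\<close> to the left crosses.\<close>

definition left_sum :: "(point set \<Rightarrow> 'b::real_vector) \<Rightarrow> real \<Rightarrow> real \<Rightarrow> 'b" where
  "left_sum c x y = (\<Sum>\<tau>\<in>edges T.
     (- of_bool (along snd fst \<tau> \<and> lo fst \<tau> < x \<and> lo snd \<tau> < y \<and> y < hi snd \<tau>)) *\<^sub>R c \<tau>)"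

lemma end_coords_fs:
  "fst (bot_end \<tau>) = lo fst \<tau>" "snd (bot_end \<tau>) = lo snd \<tau>" "fst (top_end \<tau>) = hi fst \<tau>" "snd (top_end \<tau>) = hi snd \<tau>"
  by (simp_all add: bot_end_def top_end_def)

lemma generic_avoids:
  assumes "\<tau> \<in> edges T" "u = fst \<or> u = snd" "x \<notin> u ` vertices T"
  shows "lo u \<tau> \<noteq> x" "hi u \<tau> \<noteq> x"
proof -
  have "u (bot_end \<tau>) = lo u \<tau>" "u (top_end \<tau>) = hi u \<tau>" using assms(2) end_coords_fs by auto
  then show "lo u \<tau> \<noteq> x" "hi u \<tau> \<noteq> x"
    using assms(3) imageI[OF ends_in_vertices(1)[OF assms(1)], of u]
      imageI[OF ends_in_vertices(2)[OF assms(1)], of u] by metis+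
qed

text \<open>A discrete Green's formula. Sum the net flow over all vertices to the left of \<open>x\<close> and between the
  heights \<open>y\<close> and \<open>y'\<close>. Edges with both ends in this half-strip cancel. What remains are the
  horizontal edges that cross its right side and the vertical edges that cross its bottom or top,
  which are those counted by \<open>left_sum\<close>.\<close>

lemma left_sum_vertical_step:
  fixes c :: "point set \<Rightarrow> 'b::real_vector"
  assumes closed: "\<And>\<gamma>. \<gamma> \<in> vertices T \<Longrightarrow> (\<Sum>\<tau>\<in>edges T. end_sign \<tau> \<gamma> *\<^sub>R c \<tau>) = 0"
    and x: "x \<notin> fst ` vertices T" and y: "y \<notin> snd ` vertices T" "y' \<notin> snd ` vertices T" "y < y'"
  shows "left_sum c x y' - left_sum c x y =
    (\<Sum>\<tau>\<in>edges T. of_bool (along fst snd \<tau> \<and> lo fst \<tau> < x \<and> x < hi fst \<tau> \<and> y < lo snd \<tau> \<and> lo snd \<tau> < y') *\<^sub>R c \<tau>)"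
    (is "_ = (\<Sum>\<tau>\<in>_. of_bool (?h \<tau>) *\<^sub>R c \<tau>)")
proof -
  define S where "S = {\<gamma>\<in>vertices T. fst \<gamma> < x \<and> y < snd \<gamma> \<and> snd \<gamma> < y'}"
  have finS: "finite S" using finite_vertices by (simp add: S_def)
  have ends: "(\<Sum>\<gamma>\<in>S. end_sign \<tau> \<gamma>) = of_bool (top_end \<tau> \<in> S) - of_bool (bot_end \<tau> \<in> S)" for \<tau>
  proof -
    have "(\<Sum>\<gamma>\<in>S. of_bool (\<gamma> = a)) = (of_bool (a \<in> S) :: real)" for a
      using finS by (simp add: of_bool_def)
    then show ?thesis by (simp add: end_sign_def sum_subtractf)
  qed
  define w where "w y \<tau> = (- of_bool (along snd fst \<tau> \<and> lo fst \<tau> < x \<and> lo snd \<tau> < y \<and> y < hi snd \<tau>) :: real)" for y \<tau>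
  have key: "(\<Sum>\<gamma>\<in>S. end_sign \<tau> \<gamma>) = w y' \<tau> - w y \<tau> - of_bool (?h \<tau>)" if t: "\<tau> \<in> edges T" for \<tau>
  proof -
    note g = generic_avoids[OF t, of fst, simplified, OF x] generic_avoids[OF t, of snd, simplified, OF y(1)]
      generic_avoids[OF t, of snd, simplified, OF y(2)]
    have m: "top_end \<tau> \<in> S \<longleftrightarrow> hi fst \<tau> < x \<and> y < hi snd \<tau> \<and> hi snd \<tau> < y'"
      "bot_end \<tau> \<in> S \<longleftrightarrow> lo fst \<tau> < x \<and> y < lo snd \<tau> \<and> lo snd \<tau> < y'"
      using ends_in_vertices[OF t] by (auto simp: S_def end_coords_fs)
    from edge_along[OF t] show ?thesis
    proof
      assume a: "along fst snd \<tau>"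
      have "\<not> along snd fst \<tau>" using not_along_both[OF axes_fst_snd(1) a] .
      then show ?thesis unfolding ends m w_def using a along_less[OF a] g y(3) by auto
    next
      assume a: "along snd fst \<tau>"
      have "\<not> along fst snd \<tau>" using not_along_both[OF axes_fst_snd(2) a] .
      then show ?thesis unfolding ends m w_def using a along_less[OF a] g y(3) by auto
    qed
  qed
  have "0 = (\<Sum>\<gamma>\<in>S. \<Sum>\<tau>\<in>edges T. end_sign \<tau> \<gamma> *\<^sub>R c \<tau>)" using closed by (simp add: S_def)
  also have "\<dots> = (\<Sum>\<tau>\<in>edges T. \<Sum>\<gamma>\<in>S. end_sign \<tau> \<gamma> *\<^sub>R c \<tau>)" by (rule sum.swap)
  also have "\<dots> = (\<Sum>\<tau>\<in>edges T. (\<Sum>\<gamma>\<in>S. end_sign \<tau> \<gamma>) *\<^sub>R c \<tau>)" by (simp only: scaleR_sum_left)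
  also have "\<dots> = (\<Sum>\<tau>\<in>edges T. (w y' \<tau> - w y \<tau> - of_bool (?h \<tau>)) *\<^sub>R c \<tau>)"
    by (rule sum.cong[OF refl]) (simp only: key)
  also have "\<dots> = left_sum c x y' - left_sum c x y - (\<Sum>\<tau>\<in>edges T. of_bool (?h \<tau>) *\<^sub>R c \<tau>)"
    unfolding left_sum_def w_def by (simp only: scaleR_left_diff_distrib sum_subtractf)
  finally show ?thesis by simp
qed

lemma left_sum_horizontal_step:
  assumes "x \<notin> fst ` vertices T" "x' \<notin> fst ` vertices T" "x < x'"
  shows "left_sum c x' y - left_sum c x y =
    - (\<Sum>\<tau>\<in>edges T. of_bool (along snd fst \<tau> \<and> x < lo fst \<tau> \<and> lo fst \<tau> < x' \<and> lo snd \<tau> < y \<and> y < hi snd \<tau>) *\<^sub>R c \<tau>)"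
  unfolding left_sum_def sum_subtractf[symmetric] sum_negf[symmetric]
proof (rule sum.cong[OF refl])
  fix \<tau> assume t: "\<tau> \<in> edges T"
  have "lo fst \<tau> \<noteq> x" "lo fst \<tau> \<noteq> x'" using generic_avoids[OF t, of fst] assms by auto
  then show "- of_bool (along snd fst \<tau> \<and> lo fst \<tau> < x' \<and> lo snd \<tau> < y \<and> y < hi snd \<tau>) *\<^sub>R c \<tau> -
      - of_bool (along snd fst \<tau> \<and> lo fst \<tau> < x \<and> lo snd \<tau> < y \<and> y < hi snd \<tau>) *\<^sub>R c \<tau> =
      - (of_bool (along snd fst \<tau> \<and> x < lo fst \<tau> \<and> lo fst \<tau> < x' \<and> lo snd \<tau> < y \<and> y < hi snd \<tau>) *\<^sub>R c \<tau>)"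
    using assms(3) by (auto simp: of_bool_def)
qed

text \<open>Points that avoid all horizontal and vertical lines through vertices. On these lines \<open>left_sum\<close> may
  miss edges that end there.\<close>

definition generic_in :: "point set \<Rightarrow> real \<times> real \<Rightarrow> bool" where
  "generic_in \<sigma> p \<longleftrightarrow> p \<in> \<sigma> \<and> fst p \<notin> fst ` vertices T \<and> snd p \<notin> snd ` vertices T"

lemma generic_exists:
  assumes "\<sigma> \<in> faces T" shows "\<exists>p. generic_in \<sigma> p"
proof -
  obtain x where x: "lo fst \<sigma> < x" "x < hi fst \<sigma>" "x \<notin> fst ` vertices T"
    by (rule finite_avoid[OF face_coords(1)[OF assms axes_fst_snd(1)] finite_imageI[OF finite_vertices]])
  obtain y where y: "lo snd \<sigma> < y" "y < hi snd \<sigma>" "y \<notin> snd ` vertices T"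
    by (rule finite_avoid[OF face_coords(1)[OF assms axes_fst_snd(2)] finite_imageI[OF finite_vertices]])
  have "(x, y) \<in> \<sigma>" using x y face_coords(2)[OF assms axes_fst_snd(1)] by simp
  then show ?thesis using x y by (intro exI[of _ "(x, y)"]) (simp add: generic_in_def)
qed

lemma sum_no_edge:
  assumes "\<And>\<tau>'. \<tau>' \<in> edges T \<Longrightarrow> \<not> P \<tau>'"
  shows "(\<Sum>\<tau>'\<in>edges T. of_bool (P \<tau>') *\<^sub>R c \<tau>') = (0 :: 'b::real_vector)"
  using assms by (intro sum.neutral ballI) simp

text \<open>No edge meets an open face, so neither a horizontal nor a vertical step inside a face crosses one.\<close>

lemma left_sum_face_constant:
  fixes c :: "point set \<Rightarrow> 'b::real_vector"
  assumes closed: "\<And>\<gamma>. \<gamma> \<in> vertices T \<Longrightarrow> (\<Sum>\<tau>\<in>edges T. end_sign \<tau> \<gamma> *\<^sub>R c \<tau>) = 0"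
    and s: "\<sigma> \<in> faces T" and p: "generic_in \<sigma> p" "generic_in \<sigma> q"
  shows "left_sum c (fst p) (snd p) = left_sum c (fst q) (snd q)"
proof -
  note mem = face_coords(2)[OF s axes_fst_snd(1)]
  have b: "lo fst \<sigma> < fst p \<and> fst p < hi fst \<sigma> \<and> lo snd \<sigma> < snd p \<and> snd p < hi snd \<sigma>"
    "lo fst \<sigma> < fst q \<and> fst q < hi fst \<sigma> \<and> lo snd \<sigma> < snd q \<and> snd q < hi snd \<sigma>"
    using p mem by (auto simp: generic_in_def)
  have g: "fst p \<notin> fst ` vertices T" "fst q \<notin> fst ` vertices T" "snd p \<notin> snd ` vertices T" "snd q \<notin> snd ` vertices T"
    using p by (auto simp: generic_in_def)
  have H: "left_sum c x' (snd p) = left_sum c x (snd p)"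
    if "x < x'" "x \<notin> fst ` vertices T" "x' \<notin> fst ` vertices T" "lo fst \<sigma> < x" "x' < hi fst \<sigma>" for x x'
  proof -
    have "\<not> (along snd fst \<tau> \<and> x < lo fst \<tau> \<and> lo fst \<tau> < x' \<and> lo snd \<tau> < snd p \<and> snd p < hi snd \<tau>)"
      if t: "\<tau> \<in> edges T" for \<tau>
    proof
      assume a: "along snd fst \<tau> \<and> x < lo fst \<tau> \<and> lo fst \<tau> < x' \<and> lo snd \<tau> < snd p \<and> snd p < hi snd \<tau>"
      then have "(lo fst \<tau>, snd p) \<in> \<tau>" using along_mem[of snd fst \<tau>] by simp
      moreover have "(lo fst \<tau>, snd p) \<in> \<sigma>" using mem a b \<open>lo fst \<sigma> < x\<close> \<open>x' < hi fst \<sigma>\<close> by simp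
      ultimately show False using edge_face_disjoint[OF t s] by blast
    qed
    then have "left_sum c x' (snd p) - left_sum c x (snd p) = 0"
      unfolding left_sum_horizontal_step[OF that(2,3,1)] by (subst sum_no_edge) simp_all
    then show ?thesis by simp
  qed
  have V: "left_sum c (fst q) y' = left_sum c (fst q) y"
    if "y < y'" "y \<notin> snd ` vertices T" "y' \<notin> snd ` vertices T" "lo snd \<sigma> < y" "y' < hi snd \<sigma>" for y y'
  proof -
    have "\<not> (along fst snd \<tau> \<and> lo fst \<tau> < fst q \<and> fst q < hi fst \<tau> \<and> y < lo snd \<tau> \<and> lo snd \<tau> < y')"
      if t: "\<tau> \<in> edges T" for \<tau>
    proof
      assume a: "along fst snd \<tau> \<and> lo fst \<tau> < fst q \<and> fst q < hi fst \<tau> \<and> y < lo snd \<tau> \<and> lo snd \<tau> < y'"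
      then have "(fst q, lo snd \<tau>) \<in> \<tau>" using along_mem[of fst snd \<tau>] by simp
      moreover have "(fst q, lo snd \<tau>) \<in> \<sigma>" using mem a b \<open>lo snd \<sigma> < y\<close> \<open>y' < hi snd \<sigma>\<close> by simp
      ultimately show False using edge_face_disjoint[OF t s] by blast
    qed
    then have "(\<Sum>\<tau>\<in>edges T. of_bool (along fst snd \<tau> \<and> lo fst \<tau> < fst q \<and> fst q < hi fst \<tau>
        \<and> y < lo snd \<tau> \<and> lo snd \<tau> < y') *\<^sub>R c \<tau>) = 0"
      by (rule sum_no_edge)
    then have "left_sum c (fst q) y' - left_sum c (fst q) y = 0"
      using left_sum_vertical_step[OF closed g(2) that(2,3,1)] by simp
    then show ?thesis by simp
  qed
  have "left_sum c (fst p) (snd p) = left_sum c (fst q) (snd p)"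
    using H[of "fst p" "fst q"] H[of "fst q" "fst p"] g b by (cases "fst p" "fst q" rule: linorder_cases) auto
  also have "\<dots> = left_sum c (fst q) (snd q)"
    using V[of "snd p" "snd q"] V[of "snd q" "snd p"] g b by (cases "snd p" "snd q" rule: linorder_cases) auto
  finally show ?thesis .
qed

lemma sum_single_edge:
  assumes "\<tau> \<in> edges T" "\<And>\<tau>'. \<tau>' \<in> edges T \<Longrightarrow> P \<tau>' \<longleftrightarrow> \<tau>' = \<tau>"
  shows "(\<Sum>\<tau>'\<in>edges T. of_bool (P \<tau>') *\<^sub>R c \<tau>') = (c \<tau> :: 'b::real_vector)"
proof -
  have "(\<Sum>\<tau>'\<in>edges T. of_bool (P \<tau>') *\<^sub>R c \<tau>') = (\<Sum>\<tau>'\<in>edges T. if \<tau>' = \<tau> then c \<tau> else 0)"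
    by (rule sum.cong[OF refl]) (simp add: assms(2))
  then show ?thesis using assms(1) finite_edges by simp
qed

text \<open>The potential of a face is \<open>left_sum\<close> at a generic point of it. A step between
  the two faces at an interior edge crosses no other edge, so that the jump is the weight of this edge.\<close>

lemma potential_exists:
  fixes c :: "point set \<Rightarrow> 'b::real_vector"
  assumes closed: "\<And>\<gamma>. \<gamma> \<in> vertices T \<Longrightarrow> (\<Sum>\<tau>\<in>edges T. end_sign \<tau> \<gamma> *\<^sub>R c \<tau>) = 0"
    and P: "subspace P" "\<And>\<tau>. \<tau> \<in> edges T \<Longrightarrow> c \<tau> \<in> P"
  obtains f where "f \<in> direct_sum (faces T) (\<lambda>_. P)"
    "\<And>\<tau>. \<tau> \<in> interior_edges T \<Longrightarrow> coboundary T f \<tau> = c \<tau>"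
proof -
  define f where "f \<sigma> = (if \<sigma> \<in> faces T then
     left_sum c (fst (SOME p. generic_in \<sigma> p)) (snd (SOME p. generic_in \<sigma> p)) else 0)" for \<sigma>
  have fval: "f \<sigma> = left_sum c x y" if "\<sigma> \<in> faces T" "generic_in \<sigma> (x, y)" for \<sigma> x y
    using left_sum_face_constant[OF closed that(1) someI_ex[OF generic_exists[OF that(1)]] that(2)] that(1)
    by (simp add: f_def)
  have "left_sum c x y \<in> P" for x y
    unfolding left_sum_def by (intro subspace_sum subspace_scale P)
  then have "f \<in> direct_sum (faces T) (\<lambda>_. P)" by (auto simp: direct_sum_def f_def)
  moreover have "coboundary T f \<tau> = c \<tau>" if t: "\<tau> \<in> interior_edges T" for \<tau>
  proof -
    have tE: "\<tau> \<in> edges T" using t by (simp add: interior_edges_def)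
    from edge_along[OF tE] show ?thesis
    proof
      assume a: "along fst snd \<tau>"
      obtain \<sigma>p \<sigma>m where s: "\<sigma>p \<in> faces T" "\<sigma>m \<in> faces T" "above snd \<tau> \<sigma>p" "below snd \<tau> \<sigma>m"
        by (rule interior_edge_faces[OF t axes_fst_snd(1) a])
      note m = face_coords(2)[OF s(1) axes_fst_snd(1)] face_coords(2)[OF s(2) axes_fst_snd(1)]
      have e: "lo snd \<sigma>p = lo snd \<tau>" "hi snd \<sigma>m = lo snd \<tau>"
        "lo fst \<sigma>p \<le> lo fst \<tau>" "hi fst \<tau> \<le> hi fst \<sigma>p" "lo fst \<sigma>m \<le> lo fst \<tau>" "hi fst \<tau> \<le> hi fst \<sigma>m"
        using s edge_in_closure_iff[OF s(1) axes_fst_snd(1) a] edge_in_closure_iff[OF s(2) axes_fst_snd(1) a]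
        by (auto simp: above_def below_def)
      have l: "lo snd \<sigma>m < lo snd \<tau>" "lo snd \<tau> < hi snd \<sigma>p"
        using face_coords(1)[OF s(1) axes_fst_snd(2)] face_coords(1)[OF s(2) axes_fst_snd(2)] e by auto
      obtain x where x: "lo fst \<tau> < x" "x < hi fst \<tau>" "x \<notin> fst ` vertices T"
        by (rule finite_avoid[OF along_less(1)[OF a] finite_imageI[OF finite_vertices]])
      obtain y where y: "lo snd \<sigma>m < y" "y < lo snd \<tau>" "y \<notin> snd ` vertices T"
        by (rule finite_avoid[OF l(1) finite_imageI[OF finite_vertices]])
      obtain y' where y': "lo snd \<tau> < y'" "y' < hi snd \<sigma>p" "y' \<notin> snd ` vertices T"
        by (rule finite_avoid[OF l(2) finite_imageI[OF finite_vertices]])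
      have fp: "f \<sigma>p = left_sum c x y'" using x y' e by (intro fval s) (simp add: generic_in_def m)
      have fm: "f \<sigma>m = left_sum c x y" using x y e by (intro fval s) (simp add: generic_in_def m)
      have "along fst snd \<tau>' \<and> lo fst \<tau>' < x \<and> x < hi fst \<tau>' \<and> y < lo snd \<tau>' \<and> lo snd \<tau>' < y' \<longleftrightarrow> \<tau>' = \<tau>"
        if t': "\<tau>' \<in> edges T" for \<tau>'
      proof
        assume a': "along fst snd \<tau>' \<and> lo fst \<tau>' < x \<and> x < hi fst \<tau>' \<and> y < lo snd \<tau>' \<and> lo snd \<tau>' < y'"
        then have q: "(x, lo snd \<tau>') \<in> \<tau>'" using along_mem[of fst snd \<tau>'] by simp
        have "(x, lo snd \<tau>') \<notin> \<sigma>p" "(x, lo snd \<tau>') \<notin> \<sigma>m"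
          using q edge_face_disjoint[OF t' s(1)] edge_face_disjoint[OF t' s(2)] by blast+
        then have "lo snd \<tau>' = lo snd \<tau>" using m a' x y y' e by auto
        then have "(x, lo snd \<tau>') \<in> \<tau>" using along_mem[OF a] x by simp
        moreover have "(x, lo snd \<tau>') \<notin> vertices T" using x(3) by (metis fst_conv imageI)
        ultimately show "\<tau>' = \<tau>" using edge_unique[OF t' tE q] by blast
      next
        assume "\<tau>' = \<tau>"
        then show "along fst snd \<tau>' \<and> lo fst \<tau>' < x \<and> x < hi fst \<tau>' \<and> y < lo snd \<tau>' \<and> lo snd \<tau>' < y'"
          using a x y y' by simp
      qed
      then have "(\<Sum>\<tau>'\<in>edges T. of_bool (along fst snd \<tau>' \<and> lo fst \<tau>' < x \<and> x < hi fst \<tau>'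
          \<and> y < lo snd \<tau>' \<and> lo snd \<tau>' < y') *\<^sub>R c \<tau>') = c \<tau>"
        by (rule sum_single_edge[OF tE])
      then have "left_sum c x y' - left_sum c x y = c \<tau>"
        using left_sum_vertical_step[OF closed x(3) y(3) y'(3)] y y' by simp
      then show ?thesis
        using coboundary_two_faces[OF tE s(1,2) axes_fst_snd(1) a s(3,4), of f] fp fm by simp
    next
      assume a: "along snd fst \<tau>"
      obtain \<sigma>p \<sigma>m where s: "\<sigma>p \<in> faces T" "\<sigma>m \<in> faces T" "above fst \<tau> \<sigma>p" "below fst \<tau> \<sigma>m"
        by (rule interior_edge_faces[OF t axes_fst_snd(2) a])
      note m = face_coords(2)[OF s(1) axes_fst_snd(1)] face_coords(2)[OF s(2) axes_fst_snd(1)]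
      have e: "lo fst \<sigma>p = lo fst \<tau>" "hi fst \<sigma>m = lo fst \<tau>"
        "lo snd \<sigma>p \<le> lo snd \<tau>" "hi snd \<tau> \<le> hi snd \<sigma>p" "lo snd \<sigma>m \<le> lo snd \<tau>" "hi snd \<tau> \<le> hi snd \<sigma>m"
        using s edge_in_closure_iff[OF s(1) axes_fst_snd(2) a] edge_in_closure_iff[OF s(2) axes_fst_snd(2) a]
        by (auto simp: above_def below_def)
      have l: "lo fst \<sigma>m < lo fst \<tau>" "lo fst \<tau> < hi fst \<sigma>p"
        using face_coords(1)[OF s(1) axes_fst_snd(1)] face_coords(1)[OF s(2) axes_fst_snd(1)] e by auto
      obtain y where y: "lo snd \<tau> < y" "y < hi snd \<tau>" "y \<notin> snd ` vertices T"
        by (rule finite_avoid[OF along_less(1)[OF a] finite_imageI[OF finite_vertices]])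
      obtain x where x: "lo fst \<sigma>m < x" "x < lo fst \<tau>" "x \<notin> fst ` vertices T"
        by (rule finite_avoid[OF l(1) finite_imageI[OF finite_vertices]])
      obtain x' where x': "lo fst \<tau> < x'" "x' < hi fst \<sigma>p" "x' \<notin> fst ` vertices T"
        by (rule finite_avoid[OF l(2) finite_imageI[OF finite_vertices]])
      have fp: "f \<sigma>p = left_sum c x' y" using y x' e by (intro fval s) (simp add: generic_in_def m)
      have fm: "f \<sigma>m = left_sum c x y" using y x e by (intro fval s) (simp add: generic_in_def m)
      have "along snd fst \<tau>' \<and> x < lo fst \<tau>' \<and> lo fst \<tau>' < x' \<and> lo snd \<tau>' < y \<and> y < hi snd \<tau>' \<longleftrightarrow> \<tau>' = \<tau>"
        if t': "\<tau>' \<in> edges T" for \<tau>'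
      proof
        assume a': "along snd fst \<tau>' \<and> x < lo fst \<tau>' \<and> lo fst \<tau>' < x' \<and> lo snd \<tau>' < y \<and> y < hi snd \<tau>'"
        then have q: "(lo fst \<tau>', y) \<in> \<tau>'" using along_mem[of snd fst \<tau>'] by simp
        have "(lo fst \<tau>', y) \<notin> \<sigma>p" "(lo fst \<tau>', y) \<notin> \<sigma>m"
          using q edge_face_disjoint[OF t' s(1)] edge_face_disjoint[OF t' s(2)] by blast+
        then have "lo fst \<tau>' = lo fst \<tau>" using m a' x x' y e by auto
        then have "(lo fst \<tau>', y) \<in> \<tau>" using along_mem[OF a] y by simp
        moreover have "(lo fst \<tau>', y) \<notin> vertices T" using y(3) by (metis snd_conv imageI)
        ultimately show "\<tau>' = \<tau>" using edge_unique[OF t' tE q] by blast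
      next
        assume "\<tau>' = \<tau>"
        then show "along snd fst \<tau>' \<and> x < lo fst \<tau>' \<and> lo fst \<tau>' < x' \<and> lo snd \<tau>' < y \<and> y < hi snd \<tau>'"
          using a x x' y by simp
      qed
      then have "(\<Sum>\<tau>'\<in>edges T. of_bool (along snd fst \<tau>' \<and> x < lo fst \<tau>' \<and> lo fst \<tau>' < x'
          \<and> lo snd \<tau>' < y \<and> y < hi snd \<tau>') *\<^sub>R c \<tau>') = c \<tau>"
        by (rule sum_single_edge[OF tE])
      then have "left_sum c x' y - left_sum c x y = - c \<tau>"
        using left_sum_horizontal_step[OF x(3) x'(3), of c y] x x' by simp
      moreover have "(snd :: point \<Rightarrow> real) \<noteq> fst" by (metis fst_conv snd_conv zero_neq_one)
      ultimately show ?thesis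
        using coboundary_two_faces[OF tE s(1,2) axes_fst_snd(2) a s(3,4), of f] fp fm by simp
    qed
  qed
  ultimately show thesis by (rule that)
qed


section \<open>The graph of the boundary edges\<close>

lemma closure_face_convex: "\<sigma> \<in> faces T \<Longrightarrow> convex (closure \<sigma>) \<and> compact (closure \<sigma>)"
proof -
  assume "\<sigma> \<in> faces T"
  then obtain a b where "\<sigma> = box a b" "box a b \<noteq> {}" using face_box[rule_format] by (metis (no_types))
  then show ?thesis by simp
qed

text \<open>For compact subsets of the complex plane this is Borsuk's separation theorem: on a simply connected,
  locally path connected set every map to the circle has a logarithm. Finite unions of closed
  rectangles are absolute neighbourhood retracts and hence locally path connected.\<close>

lemma connected_outside:
  assumes "simply_connected (domain T)"
  shows "connected (- domain T)"
proof -
  \<comment> \<open>The separation theorem is applied in the complex plane, to which \<open>h\<close> identifies the points.\<close>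
  define h :: "point \<Rightarrow> complex" where "h p = Complex (fst p) (snd p)" for p
  define g :: "complex \<Rightarrow> point" where "g z = (Re z, Im z)" for z
  have inv: "g (h p) = p" "h (g z) = z" for p z by (simp_all add: g_def h_def)
  have ch: "continuous_on A h" for A
    unfolding h_def Complex_eq by (intro continuous_intros)
  have cg: "continuous_on A g" for A
    unfolding g_def by (intro continuous_intros)
  have homeo: "domain T homeomorphic h ` domain T"
    unfolding homeomorphic_def homeomorphism_def
    by (intro exI[of _ h] exI[of _ g]) (use ch cg inv in \<open>auto simp: image_image\<close>)
  have "ANR (\<Union>(closure ` faces T))"
    using finite_faces closure_face_convex by (intro ANR_finite_Union_convex_closed) auto
  then have "ANR (domain T)" by (simp add: domain_def)
  then have "ANR (h ` domain T)" using homeomorphic_ANR_iff_ANR[OF homeo] by blast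
  then have l: "locally path_connected (h ` domain T)" by (rule ANR_imp_locally_path_connected)
  have s: "simply_connected (h ` domain T)" using assms homeomorphic_simply_connected_eq[OF homeo] by blast
  have "compact (domain T)"
    unfolding domain_def using finite_faces closure_face_convex by (intro compact_UN) auto
  then have "compact (h ` domain T)" by (intro compact_continuous_image ch)
  then have "connected (- (h ` domain T))"
    using simply_connected_imp_Borsukian[OF s l] Borsukian_separation_compact by blast
  then have "connected (g ` (- (h ` domain T)))" by (intro connected_continuous_image cg)
  moreover have "g ` (- (h ` domain T)) = - domain T"
  proof (intro equalityI subsetI)
    fix p assume "p \<in> - domain T"
    then have "h p \<in> - (h ` domain T)" using inv by (metis ComplD ComplI imageE)
    then show "p \<in> g ` (- (h ` domain T))" using inv(1) by (metis imageI)
  next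
    fix p assume "p \<in> g ` (- (h ` domain T))"
    then obtain z where z: "z \<notin> h ` domain T" "p = g z" by blast
    then show "p \<in> - domain T" using inv(2) by (metis ComplI imageI)
  qed
  ultimately show ?thesis by simp
qed

lemma connected_frontier_domain:
  assumes "simply_connected (domain T)"
  shows "connected (frontier (domain T))"
  using connected_frontier_simple[OF simply_connected_imp_connected[OF assms] connected_outside[OF assms]] .

lemma nonvertex_inside:
  assumes "\<tau> \<in> edges T" "axes u v" "along u v \<tau>" "p \<in> \<tau>" "p \<notin> vertices T"
  shows "lo u \<tau> < u p" "u p < hi u \<tau>" "v p = lo v \<tau>"
proof -
  have m: "lo u \<tau> \<le> u p" "u p \<le> hi u \<tau>" "v p = lo v \<tau>" using along_mem[OF assms(3)] assms(4) by blast+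
  have "p \<noteq> bot_end \<tau>" "p \<noteq> top_end \<tau>" using assms(5) ends_in_vertices[OF assms(1)] by blast+
  then have "lo u \<tau> \<noteq> u p" "hi u \<tau> \<noteq> u p"
    using m(3) along_less(2)[OF assms(3)] by (auto simp: axes_eq_iff[OF assms(2)] end_coords[OF assms(2)])
  then show "lo u \<tau> < u p" "u p < hi u \<tau>" "v p = lo v \<tau>" using m by auto
qed

text \<open>The faces above and below \<open>\<tau>\<close> together cover a neighbourhood of each inner point of \<open>\<tau>\<close>.\<close>

lemma interior_edge_point:
  assumes "\<tau> \<in> interior_edges T" "p \<in> \<tau>" "p \<notin> vertices T"
  shows "p \<in> interior (domain T)"
proof -
  have tE: "\<tau> \<in> edges T" using assms(1) by (simp add: interior_edges_def)
  obtain u v where uv: "axes u v" "along u v \<tau>" using edge_along[OF tE] axes_fst_snd by blast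
  obtain \<sigma>p \<sigma>m where s: "\<sigma>p \<in> faces T" "\<sigma>m \<in> faces T" "above v \<tau> \<sigma>p" "below v \<tau> \<sigma>m"
    by (rule interior_edge_faces[OF assms(1) uv])
  have e: "lo v \<sigma>p = lo v \<tau>" "hi v \<sigma>m = lo v \<tau>"
     "lo u \<sigma>p \<le> lo u \<tau>" "hi u \<tau> \<le> hi u \<sigma>p" "lo u \<sigma>m \<le> lo u \<tau>" "hi u \<tau> \<le> hi u \<sigma>m"
    using s edge_in_closure_iff[OF s(1) uv] edge_in_closure_iff[OF s(2) uv]
    by (auto simp: above_def below_def)
  define N where "N = {q. lo u \<tau> < u q \<and> u q < hi u \<tau> \<and> lo v \<sigma>m < v q \<and> v q < hi v \<sigma>p}"
  have cu: "continuous_on UNIV u" "continuous_on UNIV v" using axes_continuous[OF uv(1)] by auto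
  have "open N"
    unfolding N_def using cu by (intro open_Collect_conj open_Collect_less continuous_on_const)
  moreover have "p \<in> N"
    using nonvertex_inside[OF tE uv assms(2,3)] e face_coords(1)[OF s(1) axes_sym[OF uv(1)]]
      face_coords(1)[OF s(2) axes_sym[OF uv(1)]] by (simp add: N_def)
  moreover have "N \<subseteq> domain T"
  proof
    fix q assume q: "q \<in> N"
    have "q \<in> closure \<sigma>p \<or> q \<in> closure \<sigma>m"
      using q e by (auto simp: N_def face_coords(3)[OF s(1) uv(1)] face_coords(3)[OF s(2) uv(1)])
    then show "q \<in> domain T" using s by (auto simp: domain_def)
  qed
  ultimately show ?thesis by (rule interiorI)
qed

definition boundary_edges :: "point set set" where
  "boundary_edges = edges T - interior_edges T"

lemma boundary_edge_ends:
  assumes "\<tau> \<in> boundary_edges"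
  shows "\<tau> \<in> edges T" "bot_end \<tau> \<in> vertices T - interior_vertices T" "top_end \<tau> \<in> vertices T - interior_vertices T"
proof -
  show t: "\<tau> \<in> edges T" using assms by (simp add: boundary_edges_def)
  have "bot_end \<tau> \<in> \<tau>" "top_end \<tau> \<in> \<tau>"
    using edge_segment(1)[OF t] ends_in_segment by blast+
  then show "bot_end \<tau> \<in> vertices T - interior_vertices T" "top_end \<tau> \<in> vertices T - interior_vertices T"
    using assms ends_in_vertices[OF t] by (auto simp: boundary_edges_def interior_edges_def interior_vertices_def)
qed

lemma frontier_nonvertex:
  assumes "x \<in> frontier (domain T)" "x \<notin> vertices T"
  shows "x \<in> \<Union>boundary_edges"
proof -
  have "x \<in> domain T" "x \<notin> interior (domain T)" using assms(1) closed_domain by (auto simp: frontier_def)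
  then obtain \<sigma> where s: "\<sigma> \<in> faces T" "x \<in> closure \<sigma>" by (auto simp: domain_def)
  have "\<sigma> \<subseteq> interior (domain T)"
    using s(1) face_coords(5)[OF s(1) axes_fst_snd(1)] closure_subset[of \<sigma>]
    by (intro interior_maximal) (auto simp: domain_def)
  then have "x \<in> frontier \<sigma>"
    using s \<open>x \<notin> interior (domain T)\<close> face_coords(4)[OF s(1) axes_fst_snd(1)] by blast
  then obtain \<tau> where t: "\<tau> \<in> edges T" "x \<in> \<tau>" by (rule frontier_edge[OF s(1)])
  then have "\<tau> \<notin> interior_edges T" using interior_edge_point assms(2) \<open>x \<notin> interior (domain T)\<close> by blast
  then show ?thesis using t by (auto simp: boundary_edges_def)
qed

lemma edge_closed: "\<tau> \<in> edges T \<Longrightarrow> closed \<tau>"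
  using edge_segment(1) closed_segment by metis

text \<open>For vertices on the frontier this is not a local statement about single edges: a connected set with
  more than one point has no isolated points, and the frontier points other than vertices lie on
  boundary edges by \<open>frontier_nonvertex\<close>.\<close>

lemma frontier_subset_boundary_edges:
  assumes "connected (frontier (domain T))" "\<And>x. frontier (domain T) \<noteq> {x}"
  shows "frontier (domain T) \<subseteq> \<Union>boundary_edges"
proof
  fix x assume x: "x \<in> frontier (domain T)"
  have cl: "closed (\<Union>boundary_edges)"
    using finite_edges edge_closed by (intro closed_Union) (auto simp: boundary_edges_def)
  have "x islimpt frontier (domain T)" by (rule connected_imp_perfect[OF assms(1) x assms(2)])
  then have "x islimpt ((frontier (domain T) - vertices T) \<union> (frontier (domain T) \<inter> vertices T))"
    by (simp add: Un_Diff_Int)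
  then have "x islimpt (frontier (domain T) - vertices T)"
    using finite_vertices by (simp add: islimpt_Un islimpt_finite)
  then have "x islimpt \<Union>boundary_edges"
    by (rule islimpt_subset) (use frontier_nonvertex in blast)
  then show "x \<in> \<Union>boundary_edges" using cl closed_limpt by blast
qed

lemma vertex_in_domain: "\<gamma> \<in> vertices T \<Longrightarrow> \<gamma> \<in> domain T"
proof -
  assume g: "\<gamma> \<in> vertices T"
  obtain \<tau> where t: "\<tau> \<in> edges T" "\<gamma> \<in> \<tau>" by (rule vertex_edge_along[OF axes_fst_snd(1) g])
  obtain \<sigma> where "\<sigma> \<in> faces T" "\<tau> \<subseteq> closure \<sigma>" by (rule edge_face[OF t(1)])
  then show ?thesis using t by (auto simp: domain_def)
qed

text \<open>The boundary map on all edges and all vertices, that is, not relative to the boundary of the domain.\<close>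

definition full_boundary :: "(point set \<Rightarrow> 'b::real_vector) \<Rightarrow> point \<Rightarrow> 'b" where
  "full_boundary c = (\<lambda>\<gamma>. if \<gamma> \<in> vertices T then \<Sum>\<tau>\<in>edges T. end_sign \<tau> \<gamma> *\<^sub>R c \<tau> else 0)"

lemma linear_full_boundary: "linear (full_boundary :: (point set \<Rightarrow> 'b::real_vector) \<Rightarrow> _)"
  by (rule linearI)
     (simp_all add: full_boundary_def fun_eq_iff scaleR_fun_def scaleR_add_right sum.distrib
       scaleR_sum_right mult.commute)

lemma full_boundary_single:
  assumes "\<tau> \<in> edges T"
  shows "full_boundary (single \<tau> p) = single (top_end \<tau>) p - single (bot_end \<tau>) p"
proof
  fix \<gamma>
  have "(\<Sum>\<tau>'\<in>edges T. end_sign \<tau>' \<gamma> *\<^sub>R single \<tau> p \<tau>') =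
      (\<Sum>\<tau>'\<in>edges T. if \<tau>' = \<tau> then end_sign \<tau> \<gamma> *\<^sub>R p else 0)"
    by (rule sum.cong) (auto simp: single_def)
  also have "\<dots> = end_sign \<tau> \<gamma> *\<^sub>R p" using assms finite_edges by simp
  finally have *: "(\<Sum>\<tau>'\<in>edges T. end_sign \<tau>' \<gamma> *\<^sub>R single \<tau> p \<tau>') = end_sign \<tau> \<gamma> *\<^sub>R p" .
  show "full_boundary (single \<tau> p) \<gamma> = (single (top_end \<tau>) p - single (bot_end \<tau>) p) \<gamma>"
    unfolding full_boundary_def * using ends_in_vertices[OF assms] edge_segment(2)[OF assms]
    by (simp add: single_def end_sign_def)
qed

text \<open>The set \<open>S\<close> of vertices that can be reached from \<open>v\<close> is closed under boundary edges. If it missed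
  some vertex \<open>w\<close>, the boundary edges with ends inside \<open>S\<close> and those with ends outside \<open>S\<close> would separate
  the frontier into two closed sets: distinct edges only meet in vertices, and a vertex on an edge is an end
  of it.\<close>

lemma boundary_graph_connected:
  fixes p :: "'b::real_vector"
  assumes sc: "simply_connected (domain T)" and P: "subspace P" "p \<in> P"
    and v: "v \<in> vertices T - interior_vertices T" and w: "w \<in> vertices T - interior_vertices T"
  shows "single w p - single v p \<in> full_boundary ` direct_sum boundary_edges (\<lambda>_. P)" (is "_ \<in> ?M")
proof -
  have M: "subspace ?M" by (intro linear_subspace_image linear_full_boundary direct_sum_subspace P)
  define S where "S = {x \<in> vertices T - interior_vertices T. single x p - single v p \<in> ?M}"
  have edge: "single (top_end \<tau>) p - single (bot_end \<tau>) p \<in> ?M" if "\<tau> \<in> boundary_edges" for \<tau>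
  proof -
    have "single \<tau> p \<in> direct_sum boundary_edges (\<lambda>_. P)"
      by (rule single_mem_direct_sum[OF that]) (use P subspace_0 in auto)
    then show ?thesis unfolding full_boundary_single[OF boundary_edge_ends(1)[OF that], symmetric] by (rule imageI)
  qed
  have ends: "top_end \<tau> \<in> S \<longleftrightarrow> bot_end \<tau> \<in> S" if t: "\<tau> \<in> boundary_edges" for \<tau>
  proof
    assume "bot_end \<tau> \<in> S"
    then have "single (bot_end \<tau>) p - single v p \<in> ?M" by (simp add: S_def)
    from subspace_add[OF M edge[OF t] this] show "top_end \<tau> \<in> S"
      using boundary_edge_ends[OF t] by (simp add: S_def)
  next
    assume "top_end \<tau> \<in> S"
    then have "single (top_end \<tau>) p - single v p \<in> ?M" by (simp add: S_def)
    from subspace_diff[OF M this edge[OF t]] show "bot_end \<tau> \<in> S"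
      using boundary_edge_ends[OF t] by (simp add: S_def)
  qed
  have vS: "v \<in> S" using v subspace_0[OF M] by (simp add: S_def)
  have "w \<in> S"
  proof (rule ccontr)
    assume wS: "w \<notin> S"
    define K where "K Q = \<Union>{\<tau> \<in> boundary_edges. Q (bot_end \<tau>)}" for Q
    have cl: "closed (K Q)" for Q
      unfolding K_def using finite_edges edge_closed
      by (intro closed_Union) (auto simp: boundary_edges_def)
    have end_S: "x \<in> S \<longleftrightarrow> bot_end \<tau> \<in> S" if "x \<in> vertices T" "\<tau> \<in> boundary_edges" "x \<in> \<tau>" for x \<tau>
      using vertex_in_edge[OF that(1) boundary_edge_ends(1)[OF that(2)] that(3)] ends[OF that(2)] by metis
    have fr: "v \<in> frontier (domain T)" "w \<in> frontier (domain T)"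
      using v w vertex_in_domain closed_domain by (auto simp: frontier_def interior_vertices_def)
    have "v \<noteq> w" using vS wS by blast
    have ns: "frontier (domain T) \<noteq> {x}" for x
    proof
      assume "frontier (domain T) = {x}"
      then show False using fr \<open>v \<noteq> w\<close> by simp
    qed
    note sub = frontier_subset_boundary_edges[OF connected_frontier_domain[OF sc] ns]
    have disj: "K (\<lambda>x. x \<in> S) \<inter> K (\<lambda>x. x \<notin> S) = {}"
    proof (rule ccontr)
      assume "\<not> ?thesis"
      then obtain x \<tau>1 \<tau>2 where x: "\<tau>1 \<in> boundary_edges" "\<tau>2 \<in> boundary_edges" "x \<in> \<tau>1" "x \<in> \<tau>2"
        "bot_end \<tau>1 \<in> S" "bot_end \<tau>2 \<notin> S" unfolding K_def by blast
      then have "\<tau>1 \<noteq> \<tau>2" by blast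
      then have "x \<in> vertices T"
        using edge_unique[OF boundary_edge_ends(1)[OF x(1)] boundary_edge_ends(1)[OF x(2)] x(3,4)] by blast
      then show False using end_S x by blast
    qed
    have cov: "frontier (domain T) \<subseteq> K (\<lambda>x. x \<in> S) \<union> K (\<lambda>x. x \<notin> S)"
      using sub unfolding K_def by blast
    have vK: "v \<in> K (\<lambda>x. x \<in> S)"
    proof -
      obtain \<tau> where t: "\<tau> \<in> boundary_edges" "v \<in> \<tau>" using fr(1) sub by blast
      then show ?thesis using end_S[OF _ t] v vS unfolding K_def by blast
    qed
    have wK: "w \<in> K (\<lambda>x. x \<notin> S)"
    proof -
      obtain \<tau> where t: "\<tau> \<in> boundary_edges" "w \<in> \<tau>" using fr(2) sub by blast
      then show ?thesis using end_S[OF _ t] w wS unfolding K_def by blast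
    qed
    have "K (\<lambda>x. x \<in> S) \<inter> frontier (domain T) = {} \<or> K (\<lambda>x. x \<notin> S) \<inter> frontier (domain T) = {}"
      by (rule connected_closedD[OF connected_frontier_domain[OF sc] _ cov cl cl]) (simp add: disj)
    then show False using vK wK fr by blast
  qed
  then show ?thesis by (simp add: S_def)
qed

text \<open>A flow with total zero on a connected graph is a boundary: send everything to one base vertex \<open>v0\<close>.\<close>

lemma boundary_fill:
  fixes \<rho> :: "point \<Rightarrow> 'b::real_vector"
  assumes sc: "simply_connected (domain T)" and P: "subspace P"
    and \<rho>: "\<rho> \<in> direct_sum (vertices T - interior_vertices T) (\<lambda>_. P)"
    and total: "(\<Sum>\<gamma>\<in>vertices T - interior_vertices T. \<rho> \<gamma>) = 0"
  obtains c where "c \<in> direct_sum boundary_edges (\<lambda>_. P)" "full_boundary c = \<rho>"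
proof -
  let ?V = "vertices T - interior_vertices T"
  let ?M = "full_boundary ` direct_sum boundary_edges (\<lambda>_. P)"
  have M: "subspace ?M" by (intro linear_subspace_image linear_full_boundary direct_sum_subspace P)
  have fin: "finite ?V" using finite_vertices by simp
  have ex: "\<rho> = (\<Sum>v\<in>?V. single v (\<rho> v))" by (rule direct_sum_expand[OF fin \<rho>])
  have "\<rho> \<in> ?M"
  proof (cases "?V = {}")
    case True
    have "\<rho> = 0" using ex unfolding True by simp
    then show ?thesis using subspace_0[OF M] by simp
  next
    case False
    then obtain v0 where v0: "v0 \<in> ?V" by blast
    have "(\<Sum>v\<in>?V. single v0 (\<rho> v)) = single v0 (\<Sum>v\<in>?V. \<rho> v)"
      by (rule linear_sum[OF linear_single, symmetric])
    also have "\<dots> = 0" unfolding total by (rule linear_0[OF linear_single])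
    finally have "\<rho> = (\<Sum>v\<in>?V. single v (\<rho> v) - single v0 (\<rho> v))"
      using ex by (simp add: sum_subtractf)
    also have "\<dots> \<in> ?M"
    proof (rule subspace_sum[OF M])
      fix v assume v: "v \<in> ?V"
      then have "\<rho> v \<in> P" using \<rho> by (simp add: direct_sum_def)
      then show "single v (\<rho> v) - single v0 (\<rho> v) \<in> ?M"
        by (rule boundary_graph_connected[OF sc P _ v0 v])
    qed
    finally show ?thesis .
  qed
  then show thesis using that by blast
qed

lemma total_boundary_zero: "(\<Sum>\<gamma>\<in>vertices T. full_boundary c \<gamma>) = (0 :: 'b::real_vector)"
proof -
  have "(\<Sum>\<gamma>\<in>vertices T. full_boundary c \<gamma>) = (\<Sum>\<gamma>\<in>vertices T. \<Sum>\<tau>\<in>edges T. end_sign \<tau> \<gamma> *\<^sub>R c \<tau>)"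
    by (simp add: full_boundary_def)
  also have "\<dots> = (\<Sum>\<tau>\<in>edges T. (\<Sum>\<gamma>\<in>vertices T. end_sign \<tau> \<gamma>) *\<^sub>R c \<tau>)"
    unfolding scaleR_sum_left by (rule sum.swap)
  also have "\<dots> = 0"
  proof (rule sum.neutral, rule ballI)
    fix \<tau> assume t: "\<tau> \<in> edges T"
    have "(\<Sum>\<gamma>\<in>vertices T. of_bool (\<gamma> = a)) = (1 :: real)" if "a \<in> vertices T" for a
      using finite_vertices that by (simp add: of_bool_def)
    then show "(\<Sum>\<gamma>\<in>vertices T. end_sign \<tau> \<gamma>) *\<^sub>R c \<tau> = 0"
      using ends_in_vertices[OF t] by (simp add: end_sign_def sum_subtractf)
  qed
  finally show ?thesis .
qed

text \<open>The net flow \<open>full_boundary c\<close> is supported on the boundary vertices and has total zero, since each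
  edge contributes with both signs. A chain \<open>c'\<close> on the boundary edges compensates it, and the potential
  of \<open>c + c'\<close> has the jumps \<open>c\<close> across interior edges.\<close>

lemma cycle_is_coboundary:
  fixes c :: "point set \<Rightarrow> 'b::real_vector"
  assumes sc: "simply_connected (domain T)" and P: "subspace P"
    and c: "c \<in> direct_sum (interior_edges T) (\<lambda>_. P)"
    and cyc: "\<And>\<gamma>. \<gamma> \<in> interior_vertices T \<Longrightarrow> (\<Sum>\<tau>\<in>edges T. end_sign \<tau> \<gamma> *\<^sub>R c \<tau>) = 0"
  obtains f where "f \<in> direct_sum (faces T) (\<lambda>_. P)"
    "\<And>\<tau>. \<tau> \<in> interior_edges T \<Longrightarrow> coboundary T f \<tau> = c \<tau>"
proof -
  let ?V = "vertices T - interior_vertices T"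
  have cP: "c \<tau> \<in> P" for \<tau> using c subspace_0[OF P] by (auto simp: direct_sum_def)
  have iv: "interior_vertices T \<subseteq> vertices T" by (simp add: interior_vertices_def)
  define \<rho> where "\<rho> = - full_boundary c"
  have z: "full_boundary c \<gamma> = 0" if "\<gamma> \<notin> ?V" for \<gamma> using that cyc by (auto simp: full_boundary_def)
  have fP: "full_boundary c \<gamma> \<in> P" for \<gamma>
    using cP by (auto simp: full_boundary_def intro!: subspace_sum subspace_scale subspace_0 P)
  have r1: "\<rho> \<in> direct_sum ?V (\<lambda>_. P)"
    unfolding \<rho>_def direct_sum_def using z fP subspace_neg[OF P] by auto
  have "(\<Sum>\<gamma>\<in>?V. full_boundary c \<gamma>) = (\<Sum>\<gamma>\<in>vertices T. full_boundary c \<gamma>)"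
    using finite_vertices z by (intro sum.mono_neutral_left) auto
  then have r2: "(\<Sum>\<gamma>\<in>?V. \<rho> \<gamma>) = 0"
    by (simp add: \<rho>_def sum_negf total_boundary_zero)
  obtain c' where c': "c' \<in> direct_sum boundary_edges (\<lambda>_. P)" "full_boundary c' = \<rho>"
    by (rule boundary_fill[OF sc P r1 r2])
  have tot: "full_boundary (c + c') = 0" by (simp add: linear_add[OF linear_full_boundary] c' \<rho>_def)
  have closed: "(\<Sum>\<tau>\<in>edges T. end_sign \<tau> \<gamma> *\<^sub>R (c + c') \<tau>) = 0" if "\<gamma> \<in> vertices T" for \<gamma>
    using fun_cong[OF tot, of \<gamma>] that by (simp add: full_boundary_def)
  have inP: "(c + c') \<tau> \<in> P" for \<tau>
  proof -
    have "c' \<tau> \<in> P" using c'(1) subspace_0[OF P] by (cases "\<tau> \<in> boundary_edges") (auto simp: direct_sum_def)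
    then show ?thesis using subspace_add[OF P cP] by simp
  qed
  obtain f where f: "f \<in> direct_sum (faces T) (\<lambda>_. P)"
    "\<And>\<tau>. \<tau> \<in> interior_edges T \<Longrightarrow> coboundary T f \<tau> = (c + c') \<tau>"
    using potential_exists[OF closed P inP] by blast
  have "coboundary T f \<tau> = c \<tau>" if "\<tau> \<in> interior_edges T" for \<tau>
    using f(2)[OF that] c'(1) that by (simp add: direct_sum_def boundary_edges_def)
  with f(1) show thesis by (rule that)
qed

end

section \<open>Counting dimensions\<close>

text \<open>The ambient spaces of functions are infinite-dimensional, so finite dimension is asked only of the
  subspace \<open>V\<close>.\<close>

lemma rank_nullity:
  fixes L :: "'a::real_vector \<Rightarrow> 'b::real_vector"
  assumes L: "linear L" and V: "subspace V" and S: "finite S" "V \<subseteq> span S"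
  shows "dim V = dim {v\<in>V. L v = 0} + dim (L ` V)"
proof -
  let ?N = "{v\<in>V. L v = 0}"
  have N: "subspace ?N"
    using V linear_0[OF L] linear_add[OF L] linear_scale[OF L] by (auto simp: subspace_def)
  have fin: "finite D" if "independent D" "D \<subseteq> V" for D
    using independent_span_bound[OF S(1) that(1)] that(2) S(2) by blast
  obtain C where C: "C \<subseteq> ?N" "independent C" "?N \<subseteq> span C" "card C = dim ?N"
    using basis_exists by blast
  obtain D where D: "C \<subseteq> D" "D \<subseteq> V" "independent D" "V \<subseteq> span D"
    using maximal_independent_subset_extend[of C V] C by blast
  have fD: "finite D" using fin D by blast
  have fC: "finite C" using fD D(1) finite_subset by blast
  have dV: "dim V = card D" using D dim_unique by blast
  have zero: "(\<forall>b\<in>D - C. u b = 0)" if "(\<Sum>b\<in>D - C. u b *\<^sub>R L b) = 0" for u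
  proof -
    define x where "x = (\<Sum>b\<in>D - C. u b *\<^sub>R b)"
    have "L x = 0" using that by (simp add: x_def linear_sum[OF L] linear_scale[OF L])
    moreover have "x \<in> V" unfolding x_def using D by (intro subspace_sum subspace_scale V) auto
    ultimately have "x \<in> span C" using C by blast
    then obtain w where w: "x = (\<Sum>c\<in>C. w c *\<^sub>R c)" using span_finite[OF fC] by auto
    let ?g = "\<lambda>b. if b \<in> C then - w b else u b"
    have "(\<Sum>b\<in>D. ?g b *\<^sub>R b) = (\<Sum>b\<in>D - C. ?g b *\<^sub>R b) + (\<Sum>b\<in>C. ?g b *\<^sub>R b)"
      by (rule sum.subset_diff[OF D(1) fD])
    also have "\<dots> = (\<Sum>b\<in>D - C. u b *\<^sub>R b) + (\<Sum>b\<in>C. - (w b *\<^sub>R b))"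
      by (intro arg_cong2[where f = "(+)"] sum.cong) auto
    also have "\<dots> = x - x" unfolding sum_negf w[symmetric] x_def[symmetric] by simp
    finally have "(\<Sum>b\<in>D. ?g b *\<^sub>R b) = 0" by simp
    then have "?g b = 0" if "b \<in> D" for b
      using independentD[OF D(3) fD subset_refl, of ?g b] that by simp
    then show ?thesis by (metis DiffD1 DiffD2)
  qed
  have fE: "finite (D - C)" using fD by simp
  have inj: "inj_on L (D - C)"
  proof (rule inj_onI, rule ccontr)
    fix x y assume xy: "x \<in> D - C" "y \<in> D - C" "L x = L y" "x \<noteq> y"
    let ?u = "\<lambda>b. of_bool (b = x) - of_bool (b = y) :: real"
    have "(\<Sum>b\<in>D - C. ?u b *\<^sub>R L b) = (\<Sum>b\<in>D - C. (if b = x then L b else 0) - (if b = y then L b else 0))"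
      by (rule sum.cong) auto
    also have "\<dots> = 0" using xy fE by (simp add: sum_subtractf)
    finally have "\<forall>b\<in>D - C. ?u b = 0" by (rule zero)
    then have "?u x = 0" using xy(1) by (rule bspec)
    then show False using xy(4) by simp
  qed
  have "independent (L ` (D - C))"
  proof (rule independent_if_scalars_zero)
    fix f x assume "(\<Sum>x\<in>L ` (D - C). f x *\<^sub>R x) = 0" and x: "x \<in> L ` (D - C)"
    then have "(\<Sum>b\<in>D - C. f (L b) *\<^sub>R L b) = 0" by (simp add: sum.reindex[OF inj])
    then show "f x = 0" using zero[of "\<lambda>b. f (L b)"] x by blast
  qed (use fE in simp)
  moreover have "L ` V \<subseteq> span (L ` (D - C))"
  proof -
    have "L ` V \<subseteq> L ` span D" using D(4) by blast
    also have "\<dots> = span (L ` D)" by (rule linear_span_image[OF L, symmetric])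
    also have "\<dots> \<subseteq> span (L ` (D - C))"
    proof (rule span_minimal)
      show "L ` D \<subseteq> span (L ` (D - C))"
      proof
        fix y assume "y \<in> L ` D"
        then obtain d where d: "d \<in> D" "y = L d" by blast
        show "y \<in> span (L ` (D - C))"
        proof (cases "d \<in> C")
          case True
          then have "y = 0" using C d by auto
          then show ?thesis by (simp add: span_zero)
        next
          case False
          then show ?thesis using d by (intro span_base) blast
        qed
      qed
    qed (rule subspace_span)
    finally show ?thesis .
  qed
  moreover have "L ` (D - C) \<subseteq> L ` V" using D(2) by blast
  ultimately have "dim (L ` V) = card (L ` (D - C))" by (intro dim_unique) auto
  also have "\<dots> = card (D - C)" by (rule card_image[OF inj])
  also have "\<dots> = card D - card C" by (rule card_Diff_subset[OF fC D(1)])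
  finally show ?thesis using dV C(4) card_mono[OF fD D(1)] by simp
qed

lemma direct_sum_finite_span:
  assumes A: "finite A" and G: "\<And>a. a \<in> A \<Longrightarrow> G a \<subseteq> span S" and S: "finite S"
  shows "\<exists>S'. finite S' \<and> direct_sum A G \<subseteq> span S'"
proof (intro exI conjI subsetI)
  let ?S = "\<Union>a\<in>A. single a ` S"
  show "finite ?S" using A S by simp
  fix f assume f: "f \<in> direct_sum A G"
  have "single a (f a) \<in> span ?S" if a: "a \<in> A" for a
  proof -
    have "f a \<in> span S" using f G[OF a] a by (auto simp: direct_sum_def)
    then have "single a (f a) \<in> span (single a ` S)"
      unfolding linear_span_image[OF linear_single] by (rule imageI)
    then show ?thesis using a span_mono[of "single a ` S" ?S] by blast
  qed
  then have "(\<Sum>a\<in>A. single a (f a)) \<in> span ?S" by (rule span_sum)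
  then show "f \<in> span ?S" using direct_sum_expand[OF A f] by (metis (no_types, lifting))
qed

text \<open>The sign that compares an arbitrary orientation with the one from \<open>bot_end\<close> to \<open>top_end\<close>.\<close>

definition orient_sign :: "(point set \<Rightarrow> point \<times> point) \<Rightarrow> point set \<Rightarrow> real" where
  "orient_sign ori \<tau> = (if ori \<tau> = (bot_end \<tau>, top_end \<tau>) then 1 else -1)"

context t_mesh begin

lemma orientation_ends:
  assumes "orientation T ori" "\<tau> \<in> edges T"
  shows "ori \<tau> = (bot_end \<tau>, top_end \<tau>) \<or> ori \<tau> = (top_end \<tau>, bot_end \<tau>)"
proof -
  have "\<tau> = closed_segment (fst (ori \<tau>)) (snd (ori \<tau>))" using assms by (simp add: orientation_def)
  from trans[OF sym[OF this] edge_segment(1)[OF assms(2)]]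
  have "{fst (ori \<tau>), snd (ori \<tau>)} = {bot_end \<tau>, top_end \<tau>}" by (simp only: closed_segment_eq)
  then show ?thesis by (cases "ori \<tau>") (auto simp: doubleton_eq_iff)
qed

lemma incidence_eq:
  assumes "orientation T ori" "\<tau> \<in> edges T"
  shows "incidence ori \<tau> \<gamma> = orient_sign ori \<tau> * end_sign \<tau> \<gamma>"
  using orientation_ends[OF assms]
proof
  assume "ori \<tau> = (bot_end \<tau>, top_end \<tau>)"
  then show ?thesis by (simp add: incidence_def orient_sign_def end_sign_def)
next
  assume "ori \<tau> = (top_end \<tau>, bot_end \<tau>)"
  then show ?thesis using edge_segment(2)[OF assms(2)]
    by (simp add: incidence_def orient_sign_def end_sign_def)
qed

lemma end_sign_zero:
  assumes "\<tau> \<in> edges T" "\<tau> \<notin> interior_edges T" "\<gamma> \<in> interior_vertices T"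
  shows "end_sign \<tau> \<gamma> = 0"
proof -
  have "\<gamma> \<notin> \<tau>" using vertex_edge_interior assms by blast
  moreover have "bot_end \<tau> \<in> \<tau>" "top_end \<tau> \<in> \<tau>" using edge_segment(1)[OF assms(1)] ends_in_segment by blast+
  ultimately show ?thesis by (auto simp: end_sign_def)
qed

lemma boundary_map_eq:
  assumes "orientation T ori" "\<gamma> \<in> interior_vertices T"
  shows "boundary_map T ori g \<gamma> = (\<Sum>\<tau>\<in>edges T. end_sign \<tau> \<gamma> *\<^sub>R (orient_sign ori \<tau> *\<^sub>R g \<tau>))"
proof -
  have "boundary_map T ori g \<gamma> = (\<Sum>\<tau>\<in>interior_edges T. incidence ori \<tau> \<gamma> *\<^sub>R g \<tau>)"
    using assms(2) by (simp add: boundary_map_def)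
  also have "\<dots> = (\<Sum>\<tau>\<in>interior_edges T. end_sign \<tau> \<gamma> *\<^sub>R (orient_sign ori \<tau> *\<^sub>R g \<tau>))"
    by (rule sum.cong) (auto simp: incidence_eq[OF assms(1)] interior_edges_def mult.commute)
  also have "\<dots> = (\<Sum>\<tau>\<in>edges T. end_sign \<tau> \<gamma> *\<^sub>R (orient_sign ori \<tau> *\<^sub>R g \<tau>))"
    using finite_edges end_sign_zero assms(2)
    by (intro sum.mono_neutral_left) (auto simp: interior_edges_def)
  finally show ?thesis .
qed

lemma orient_sign_square: "orient_sign ori \<tau> *\<^sub>R (orient_sign ori \<tau> *\<^sub>R x) = (x :: 'b::real_vector)"
  by (simp add: orient_sign_def)

definition oriented_coboundary ::
  "(point set \<Rightarrow> point \<times> point) \<Rightarrow> (point set \<Rightarrow> real poly poly) \<Rightarrow> point set \<Rightarrow> real poly poly" where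
  "oriented_coboundary ori f \<tau> =
     (if \<tau> \<in> interior_edges T then orient_sign ori \<tau> *\<^sub>R coboundary T f \<tau> else 0)"

lemma linear_oriented_coboundary: "linear (oriented_coboundary ori)"
  by (rule linearI)
     (simp_all add: oriented_coboundary_def coboundary_def fun_eq_iff scaleR_fun_def scaleR_add_right sum.distrib
       scaleR_sum_right mult.commute mult.left_commute)

text \<open>Exactness at the interior edges. The signs of the orientation enter both maps and cancel.\<close>

lemma range_oriented_coboundary:
  assumes sc: "simply_connected (domain T)" and ori: "orientation T ori" and P: "subspace P"
  shows "oriented_coboundary ori ` direct_sum (faces T) (\<lambda>_. P) =
    {g \<in> direct_sum (interior_edges T) (\<lambda>_. P). boundary_map T ori g = 0}"
proof (intro equalityI subsetI)
  fix g assume "g \<in> oriented_coboundary ori ` direct_sum (faces T) (\<lambda>_. P)"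
  then obtain f where f: "f \<in> direct_sum (faces T) (\<lambda>_. P)" "g = oriented_coboundary ori f" by blast
  have "coboundary T f \<tau> \<in> P" for \<tau>
    unfolding coboundary_def using f(1) by (intro subspace_sum subspace_scale P) (auto simp: direct_sum_def)
  then have g: "g \<in> direct_sum (interior_edges T) (\<lambda>_. P)"
    using subspace_scale[OF P] by (auto simp: direct_sum_def f(2) oriented_coboundary_def)
  have "boundary_map T ori g \<gamma> = 0" for \<gamma>
  proof (cases "\<gamma> \<in> interior_vertices T")
    case True
    have "boundary_map T ori g \<gamma> = (\<Sum>\<tau>\<in>edges T. end_sign \<tau> \<gamma> *\<^sub>R (orient_sign ori \<tau> *\<^sub>R g \<tau>))"
      by (rule boundary_map_eq[OF ori True])
    also have "\<dots> = (\<Sum>\<tau>\<in>edges T. end_sign \<tau> \<gamma> *\<^sub>R coboundary T f \<tau>)"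
    proof (rule sum.cong[OF refl])
      fix \<tau> assume t: "\<tau> \<in> edges T"
      show "end_sign \<tau> \<gamma> *\<^sub>R (orient_sign ori \<tau> *\<^sub>R g \<tau>) = end_sign \<tau> \<gamma> *\<^sub>R coboundary T f \<tau>"
      proof (cases "\<tau> \<in> interior_edges T")
        case True
        then show ?thesis by (simp only: f(2) oriented_coboundary_def if_True orient_sign_square)
      next
        case False
        then show ?thesis using end_sign_zero[OF t _ \<open>\<gamma> \<in> interior_vertices T\<close>] by simp
      qed
    qed
    also have "\<dots> = 0" by (rule boundary_coboundary)
    finally show ?thesis .
  qed (simp add: boundary_map_def)
  then show "g \<in> {g \<in> direct_sum (interior_edges T) (\<lambda>_. P). boundary_map T ori g = 0}"
    using g by (simp add: fun_eq_iff)
next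
  fix g assume "g \<in> {g \<in> direct_sum (interior_edges T) (\<lambda>_. P). boundary_map T ori g = 0}"
  then have g: "g \<in> direct_sum (interior_edges T) (\<lambda>_. P)" "boundary_map T ori g = 0" by auto
  define c where "c \<tau> = orient_sign ori \<tau> *\<^sub>R g \<tau>" for \<tau>
  have c: "c \<in> direct_sum (interior_edges T) (\<lambda>_. P)"
    using g(1) subspace_scale[OF P] by (auto simp: direct_sum_def c_def)
  have "(\<Sum>\<tau>\<in>edges T. end_sign \<tau> \<gamma> *\<^sub>R c \<tau>) = 0" if "\<gamma> \<in> interior_vertices T" for \<gamma>
    using boundary_map_eq[OF ori that, of g] g(2) by (simp add: c_def)
  then obtain f where f: "f \<in> direct_sum (faces T) (\<lambda>_. P)"
    "\<And>\<tau>. \<tau> \<in> interior_edges T \<Longrightarrow> coboundary T f \<tau> = c \<tau>"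
    using cycle_is_coboundary[OF sc P c] by blast
  have "oriented_coboundary ori f = g"
  proof
    fix \<tau>
    show "oriented_coboundary ori f \<tau> = g \<tau>"
    proof (cases "\<tau> \<in> interior_edges T")
      case True
      then show ?thesis by (simp only: oriented_coboundary_def f(2) c_def if_True orient_sign_square)
    next
      case False
      then show ?thesis using g(1) by (simp add: oriented_coboundary_def direct_sum_def)
    qed
  qed
  then show "g \<in> oriented_coboundary ori ` direct_sum (faces T) (\<lambda>_. P)" using f(1) by blast
qed

text \<open>Exactly two faces contain an interior edge, so the conditions on all pairs of faces at the edge
  reduce to one condition on the jump.\<close>

lemma spline_space_eq:
  "spline_space T m m' r =
    {f \<in> direct_sum (faces T) (\<lambda>_. bipoly_space m m'). oriented_coboundary ori f \<in> I_chains1 T m m' r}"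
proof -
  have "(\<forall>\<tau>\<in>interior_edges T. \<forall>\<sigma>\<in>faces T. \<forall>\<sigma>'\<in>faces T.
          \<sigma> \<noteq> \<sigma>' \<and> \<tau> \<subseteq> closure \<sigma> \<and> \<tau> \<subseteq> closure \<sigma>' \<longrightarrow>
          edge_form \<tau> ^ nat (r \<tau> + 1) dvd f \<sigma> - f \<sigma>') \<longleftrightarrow> oriented_coboundary ori f \<in> I_chains1 T m m' r"
    if f: "f \<in> direct_sum (faces T) (\<lambda>_. bipoly_space m m')" for f
  proof -
    have fB: "f \<sigma> \<in> bipoly_space m m'" if "\<sigma> \<in> faces T" for \<sigma> using f that by (simp add: direct_sum_def)
    have "(\<forall>\<sigma>\<in>faces T. \<forall>\<sigma>'\<in>faces T. \<sigma> \<noteq> \<sigma>' \<and> \<tau> \<subseteq> closure \<sigma> \<and> \<tau> \<subseteq> closure \<sigma>' \<longrightarrow>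
          edge_form \<tau> ^ nat (r \<tau> + 1) dvd f \<sigma> - f \<sigma>') \<longleftrightarrow> oriented_coboundary ori f \<tau> \<in> edge_ideal m m' r \<tau>"
      (is "?L \<longleftrightarrow> _") if t: "\<tau> \<in> interior_edges T" for \<tau>
    proof -
      have tE: "\<tau> \<in> edges T" using t by (simp add: interior_edges_def)
      obtain u v where uv: "axes u v" "along u v \<tau>" using edge_along[OF tE] axes_fst_snd by blast
      obtain \<sigma>p \<sigma>m where s: "\<sigma>p \<in> faces T" "\<sigma>m \<in> faces T" "above v \<tau> \<sigma>p" "below v \<tau> \<sigma>m"
        by (rule interior_edge_faces[OF t uv])
      let ?d = "f \<sigma>p - f \<sigma>m" and ?l = "edge_form \<tau> ^ nat (r \<tau> + 1)"
      have ne: "\<sigma>p \<noteq> \<sigma>m" using not_above_below[OF s(1) uv(1)] s by blast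
      have sub: "\<tau> \<subseteq> closure \<sigma>p" "\<tau> \<subseteq> closure \<sigma>m" using s by (auto simp: above_def below_def)
      have two: "\<sigma> = \<sigma>p \<or> \<sigma> = \<sigma>m" if "\<sigma> \<in> faces T" "\<tau> \<subseteq> closure \<sigma>" for \<sigma>
        using edge_beside[OF tE that(1) uv that(2)] above_unique[OF tE that(1) s(1) uv]
          above_unique[OF tE that(1) s(2) uv] s(3,4) by blast
      have "?L \<longleftrightarrow> ?l dvd ?d"
      proof
        assume ?L
        then show "?l dvd ?d" using s(1,2) ne sub by blast
      next
        assume d: "?l dvd ?d"
        then have d': "?l dvd f \<sigma>m - f \<sigma>p" by (metis dvd_minus_iff minus_diff_eq)
        show ?L
        proof (intro ballI impI, elim conjE)
          fix \<sigma> \<sigma>' assume a: "\<sigma> \<in> faces T" "\<sigma>' \<in> faces T" "\<sigma> \<noteq> \<sigma>'" "\<tau> \<subseteq> closure \<sigma>" "\<tau> \<subseteq> closure \<sigma>'"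
          then show "?l dvd f \<sigma> - f \<sigma>'" using two[OF a(1,4)] two[OF a(2,5)] d d' by metis
        qed
      qed
      also have "\<dots> \<longleftrightarrow> oriented_coboundary ori f \<tau> \<in> edge_ideal m m' r \<tau>"
      proof -
        define k where "k = orient_sign ori \<tau> * (if u = fst then 1 else -1)"
        have k: "oriented_coboundary ori f \<tau> = k *\<^sub>R ?d" "k *\<^sub>R (k *\<^sub>R ?d) = ?d"
          using t coboundary_two_faces[OF tE s(1,2) uv s(3,4), of f]
          by (simp_all add: oriented_coboundary_def k_def orient_sign_def)
        have "?d \<in> bipoly_space m m'" using subspace_diff[OF subspace_bipoly] fB s(1,2) by blast
        then have "?l dvd ?d \<longleftrightarrow> ?d \<in> edge_ideal m m' r \<tau>" by (simp add: edge_ideal_def)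
        also have "\<dots> \<longleftrightarrow> k *\<^sub>R ?d \<in> edge_ideal m m' r \<tau>"
          using subspace_scale[OF subspace_edge_ideal] k(2) by metis
        finally show ?thesis using k(1) by simp
      qed
      finally show ?thesis .
    qed
    then show ?thesis by (auto simp: I_chains1_def direct_sum_def oriented_coboundary_def)
  qed
  then show ?thesis unfolding spline_space_def by (intro Collect_cong) (rule conj_cong[OF refl])
qed


text \<open>With \<open>Z\<close> the kernel of \<open>\<partial>\<close>, which is the image of \<open>\<delta>\<close>, rank-nullity is used four times: for \<open>\<delta>\<close> on all
  piecewise polynomials and on splines, and for \<open>\<partial>\<close> on all 1-chains and on those of the complex \<open>I\<close>. The
  kernel of \<open>\<delta>\<close> and the intersection of \<open>Z\<close> with the 1-chains of \<open>I\<close> cancel.\<close>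

lemma spline_dimension:
  assumes sc: "simply_connected (domain T)" and ori: "orientation T ori"
    and onto: "boundary_map T ori ` direct_sum (interior_edges T) (\<lambda>_. bipoly_space m m') =
      direct_sum (interior_vertices T) (\<lambda>_. bipoly_space m m')"
    and H: "I_homology0_zero T ori m m' r"
  shows "int (dim (spline_space T m m' r)) = Q_euler_char T m m' r"
proof -
  let ?P = "bipoly_space m m'"
  let ?C2 = "direct_sum (faces T) (\<lambda>_. ?P)" and ?C1 = "direct_sum (interior_edges T) (\<lambda>_. ?P)"
    and ?C0 = "direct_sum (interior_vertices T) (\<lambda>_. ?P)"
  let ?J1 = "I_chains1 T m m' r" and ?J0 = "I_chains0 T m m' r"
  let ?d = "oriented_coboundary ori" and ?b = "boundary_map T ori"
  let ?Z = "{g \<in> ?C1. ?b g = 0}"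
  have fin: "finite (faces T)" "finite (interior_edges T)" "finite (interior_vertices T)"
    using finite_faces finite_edges finite_vertices by (auto simp: interior_edges_def interior_vertices_def)
  have fg: "\<exists>S. finite S \<and> direct_sum A (\<lambda>_. ?P) \<subseteq> span S" if "finite A" for A :: "'z set"
    using direct_sum_finite_span[OF that, of "\<lambda>_. ?P"] finite_bipoly_gen[of m m'] unfolding bipoly_space_def by blast
  obtain S2 where S2: "finite S2" "?C2 \<subseteq> span S2" using fg[OF fin(1)] by blast
  obtain S1 where S1: "finite S1" "?C1 \<subseteq> span S1" using fg[OF fin(2)] by blast
  obtain S0 where S0: "finite S0" "?C0 \<subseteq> span S0" using fg[OF fin(3)] by blast
  have sub: "subspace ?C2" "subspace ?C1" "subspace ?C0" "subspace ?J1" "subspace ?J0"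
    by (intro direct_sum_subspace subspace_bipoly subspace_I_chains1 subspace_I_chains0)+
  have J1: "?J1 \<subseteq> ?C1" by (auto simp: I_chains1_def direct_sum_def edge_ideal_def)
  have "vertex_ideal T m m' r \<gamma> \<subseteq> ?P" for \<gamma>
    unfolding vertex_ideal_def by (intro span_minimal subspace_bipoly) (auto simp: edge_ideal_def)
  then have J0: "?J0 \<subseteq> ?C0" by (auto simp: I_chains0_def direct_sum_def)
  have bJ: "?b ` ?J1 = ?J0"
  proof
    show "?J0 \<subseteq> ?b ` ?J1" using H unfolding I_homology0_zero_iff I_boundaries0_def .
    show "?b ` ?J1 \<subseteq> ?J0"
    proof
      fix h assume "h \<in> ?b ` ?J1"
      then obtain g where g: "g \<in> ?J1" "h = ?b g" by blast
      have "?b g \<gamma> \<in> vertex_ideal T m m' r \<gamma>" if v: "\<gamma> \<in> interior_vertices T" for \<gamma>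
      proof -
        have "incidence ori \<tau> \<gamma> *\<^sub>R g \<tau> \<in> vertex_ideal T m m' r \<gamma>" if t: "\<tau> \<in> interior_edges T" for \<tau>
        proof (cases "\<gamma> \<in> \<tau>")
          case True
          have "g \<tau> \<in> edge_ideal m m' r \<tau>" using g(1) t by (simp add: I_chains1_def direct_sum_def)
          then show ?thesis unfolding vertex_ideal_def using t True by (intro span_scale span_base) blast
        next
          case False
          have tE: "\<tau> \<in> edges T" using t by (simp add: interior_edges_def)
          have "bot_end \<tau> \<in> \<tau>" "top_end \<tau> \<in> \<tau>" using edge_segment(1)[OF tE] ends_in_segment by blast+
          then have "end_sign \<tau> \<gamma> = 0" using False by (auto simp: end_sign_def)
          then show ?thesis by (simp add: incidence_eq[OF ori tE] vertex_ideal_def span_zero)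
        qed
        then have "(\<Sum>\<tau>\<in>interior_edges T. incidence ori \<tau> \<gamma> *\<^sub>R g \<tau>) \<in> vertex_ideal T m m' r \<gamma>"
          unfolding vertex_ideal_def by (rule span_sum)
        then show ?thesis using v by (simp add: boundary_map_def)
      qed
      then show "h \<in> ?J0" unfolding g(2) I_chains0_def by (simp add: direct_sum_def boundary_map_def)
    qed
  qed
  have dC: "?d ` ?C2 = ?Z" by (rule range_oriented_coboundary[OF sc ori subspace_bipoly])
  have spl: "spline_space T m m' r = {f \<in> ?C2. ?d f \<in> ?J1}" by (rule spline_space_eq)
  have Rsub: "subspace {f \<in> ?C2. ?d f \<in> ?J1}"
    using sub(1,4) linear_oriented_coboundary[of ori]
    by (auto simp: subspace_def linear_0 linear_add linear_scale)
  have dR: "?d ` {f \<in> ?C2. ?d f \<in> ?J1} = {g \<in> ?J1. ?b g = 0}"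
  proof (intro equalityI subsetI)
    fix g assume "g \<in> ?d ` {f \<in> ?C2. ?d f \<in> ?J1}"
    then obtain f where f: "f \<in> ?C2" "?d f \<in> ?J1" "g = ?d f" by blast
    then have "g \<in> ?Z" using imageI[of f ?C2 ?d] unfolding dC by simp
    then show "g \<in> {g \<in> ?J1. ?b g = 0}" using f by simp
  next
    fix g assume g: "g \<in> {g \<in> ?J1. ?b g = 0}"
    then have "g \<in> ?d ` ?C2" unfolding dC using J1 by blast
    then show "g \<in> ?d ` {f \<in> ?C2. ?d f \<in> ?J1}" using g by blast
  qed
  have kR: "{f \<in> {f \<in> ?C2. ?d f \<in> ?J1}. ?d f = 0} = {f \<in> ?C2. ?d f = 0}"
    using subspace_0[OF sub(4)] by auto
  have 1: "dim ?C2 = dim {f \<in> ?C2. ?d f = 0} + dim ?Z"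
    using rank_nullity[OF linear_oriented_coboundary[of ori] sub(1) S2] unfolding dC .
  have 2: "dim ?C1 = dim ?Z + dim ?C0"
    using rank_nullity[OF linear_boundary_map[of T ori] sub(2) S1] unfolding onto .
  have 3: "dim ?J1 = dim {g \<in> ?J1. ?b g = 0} + dim ?J0"
    using rank_nullity[OF linear_boundary_map[of T ori] sub(4) S1(1)] S1(2) J1 unfolding bJ by blast
  have 4: "dim (spline_space T m m' r) = dim {f \<in> ?C2. ?d f = 0} + dim {g \<in> ?J1. ?b g = 0}"
    unfolding spl
    using rank_nullity[OF linear_oriented_coboundary[of ori] Rsub S2(1)] S2(2) unfolding dR kR by blast
  have 5: "Q_dim1 T m m' r + dim ?J1 = dim ?C1"
    unfolding Q_dim1_def by (rule quotient_dim_eq[OF sub(2,4) J1 S1])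
  have 6: "Q_dim0 T m m' r + dim ?J0 = dim ?C0"
    unfolding Q_dim0_def by (rule quotient_dim_eq[OF sub(3,5) J0 S0])
  show ?thesis
    unfolding Q_euler_char_def Q_dim2_def using 1 2 3 4 5 6 by linarith
qed

text \<open>For the smoothness \<open>-1\<close> the edge and vertex ideals are the whole polynomial space.\<close>

lemma boundary_map_onto:
  assumes "I_homology0_zero T ori m m' (\<lambda>_. - 1)"
  shows "boundary_map T ori ` direct_sum (interior_edges T) (\<lambda>_. bipoly_space m m') =
      direct_sum (interior_vertices T) (\<lambda>_. bipoly_space m m')"
proof
  let ?P = "bipoly_space m m'"
  have e: "edge_ideal m m' (\<lambda>_. - 1) \<tau> = ?P" for \<tau> by (simp add: edge_ideal_def)
  have "vertex_ideal T m m' (\<lambda>_. - 1) \<gamma> = ?P" if g: "\<gamma> \<in> interior_vertices T" for \<gamma>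
  proof -
    have "\<gamma> \<in> vertices T" using g by (simp add: interior_vertices_def)
    then obtain \<tau> where "\<tau> \<in> edges T" "\<gamma> \<in> \<tau>" by (rule vertex_edge_along[OF axes_fst_snd(1)])
    then have "\<tau> \<in> {\<tau>\<in>interior_edges T. \<gamma> \<in> \<tau>}" using vertex_edge_interior[OF g] by blast
    then have "(\<Union>\<tau>\<in>{\<tau>\<in>interior_edges T. \<gamma> \<in> \<tau>}. ?P) = ?P" by blast
    then show ?thesis unfolding vertex_ideal_def e using subspace_bipoly span_eq_iff by metis
  qed
  then have "I_chains0 T m m' (\<lambda>_. - 1) = direct_sum (interior_vertices T) (\<lambda>_. ?P)"
    by (auto simp: I_chains0_def direct_sum_def)
  then show "direct_sum (interior_vertices T) (\<lambda>_. ?P) \<subseteq>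
     boundary_map T ori ` direct_sum (interior_edges T) (\<lambda>_. ?P)"
    using assms unfolding I_homology0_zero_iff I_boundaries0_def I_chains1_def e by simp
  show "boundary_map T ori ` direct_sum (interior_edges T) (\<lambda>_. ?P) \<subseteq>
     direct_sum (interior_vertices T) (\<lambda>_. ?P)"
  proof
    fix h assume "h \<in> boundary_map T ori ` direct_sum (interior_edges T) (\<lambda>_. ?P)"
    then obtain g where g: "g \<in> direct_sum (interior_edges T) (\<lambda>_. ?P)" "h = boundary_map T ori g" by blast
    have "(\<Sum>\<tau>\<in>interior_edges T. incidence ori \<tau> \<gamma> *\<^sub>R g \<tau>) \<in> ?P" for \<gamma>
      using g(1) by (intro subspace_sum subspace_scale subspace_bipoly) (simp add: direct_sum_def)
    then show "h \<in> direct_sum (interior_vertices T) (\<lambda>_. ?P)"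
      by (simp add: g(2) direct_sum_def boundary_map_def)
  qed
qed

end

theorem theorem4p5:
  fixes T :: tmesh
    and m m' :: nat
    and r s :: "point set \<Rightarrow> int"
    and ori :: "point set \<Rightarrow> point \<times> point"
  assumes "simply_connected_tmesh T"
    and "orientation T ori"
    and "bounded_smoothness_distribution T m m' r"
    and "smoothness_distribution T s"
    and "\<forall>\<tau>\<in>edges T. s \<tau> \<le> r \<tau>"
    and "I_homology0_zero T ori m m' r"
  shows "I_homology0_zero T ori m m' s \<and>
         int (dim (spline_space T m m' s)) = Q_euler_char T m m' s"
proof -
  have T: "is_tmesh T" and sc: "simply_connected (domain T)"
    using assms(1) by (simp_all add: simply_connected_tmesh_def)
  interpret t_mesh T by unfold_locales (rule T)
  have VE: "\<gamma> = fst (ori \<tau>) \<or> \<gamma> = snd (ori \<tau>)" if "\<gamma> \<in> vertices T" "\<tau> \<in> edges T" "\<gamma> \<in> \<tau>" for \<gamma> \<tau>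
    using vertex_in_edge[OF that] orientation_ends[OF assms(2) that(2)] by auto
  have decreasing: "I_homology0_zero T ori m m' q" if "\<forall>\<tau>\<in>edges T. q \<tau> \<le> r \<tau>" for q
    by (rule I_homology0_zero_decreasing[OF T assms(2) _ assms(3) that assms(6)]) (rule VE)
  have s: "I_homology0_zero T ori m m' s" using decreasing assms(5) by blast
  have "\<forall>\<tau>\<in>edges T. - 1 \<le> r \<tau>"
    using assms(3) by (simp add: bounded_smoothness_distribution_def smoothness_distribution_def)
  then have "I_homology0_zero T ori m m' (\<lambda>_. - 1)" by (intro decreasing)
  then show ?thesis using s spline_dimension[OF sc assms(2) boundary_map_onto s] by blast
qed

end
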